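(* For any $\beta\in(0,1/2)$ there are constants $C_2,C_3,C_4,C_5,C_6>0$ such that the following holds for all $\delta<1/2$ and $n\ge 4$ for any dataset satisfying the cluster assumptions below with parameters $\epsilon,r,\Delta$. If $\Delta<C_2$, $r<C_2$, $\epsilon<C_2$, $\alpha_0=p^{-(1/2+\beta)}$, $\sigma=p^{-(1/2+\beta/2)}$, $h=1/p$, and $p\ge \ln^{C_3}(nd/\delta)$, then: (a) with probability at least $1-\delta$, $L(\theta^{(1)})\le \exp(-C_4\,p^{1/2-\beta})$; (b) if for all $t\ge1$ the step-sizes are $\alpha_t=\frac{C_5\log^2(1/L(\theta^{(t)}))}{p}$, then with probability at least $1-\delta$, for all $t>1$, \[ L(\theta^{(t)})\le \frac{C_6\,d}{p^{1-3\beta}\,t}. \]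
   Context: $\log$ and $\ln$ denote the natural logarithm. The Huberized ReLU with bandwidth $h>0$ is $\phi(z)=0$ for $z<0$, $\phi(z)=z^2/(2h)$ for $z\in[0,h]$, $\phi(z)=z-h/2$ for $z>h$. The network has $2p$ hidden units with input weights $v_i\in\mathbb{R}^d$ and biases $b_i\in\mathbb{R}$; output weights are fixed: $u_1=\cdots=u_p=1$, $u_{p+1}=\cdots=u_{2p}=-1$. Trainable parameters $\theta=(v_1,b_1,\ldots,v_{2p},b_{2p})$; $f_\theta(x)=\sum_{i=1}^{2p}u_i\phi(v_i\cdot x+b_i)$; training loss $L(\theta)=\frac1n\sum_{s=1}^n\ln(1+\exp(-y_sf_\theta(x_s)))$ on data $(x_1,y_1),\ldots,(x_n,y_n)\in\mathbb{R}^d\times\{-1,1\}$. Initialization: all entries of $\theta^{(0)}$ are drawn independently from $\mathcal N(0,\sigma^2)$; then $\theta^{(t+1)}=\theta^{(t)}-\alpha_t\nabla_\theta L(\theta^{(t)})$ for $t\ge0$, with initial step-size $\alpha_0$. Cluster assumptions: the index set $[n]$ is partitioned into four clusters $\mathcal K_1,\ldots,\mathcal K_4$; all examples in $\mathcal K_1,\mathcal K_2$ have label $1$ and all in $\mathcal K_3,\mathcal K_4$ have label $-1$ (write $y_k$ for the common label of $\mathcal K_k$); for some $\epsilon>0$ each $n_k=|\mathcal K_k|$ satisfies $(1/4-\epsilon)n\le n_k\le(1/4+\epsilon)n$; $\lVert x_s\rVert=1$ for all $s$; for some $r>0$ each cluster $\mathcal K_k$ has a center $\mu_k$ with $\lVert\mu_k\rVert=1$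 and $\lVert x_s-\mu_k\rVert\le r$ for all $s\in\mathcal K_k$; for some $\Delta>0$, $\mu_k\cdot\mu_\ell\le\Delta$ whenever $y_k\ne y_\ell$. The probability is over the random initialization. *)

theory Defs
  imports "HOL-Probability.Probability"
begin

text \<open>Parameters theta are functions on index pairs (i,j): for hidden unit i in {1..2p},
  theta(i,j) for j in {1..d} is coordinate j of v_i, and theta(i,0) is the bias b_i.
  Vectors in R^d are functions nat => real with coordinates 1..d.\<close>

type_synonym params = "nat \<times> nat \<Rightarrow> real"

definition huber :: "real \<Rightarrow> real \<Rightarrow> real" where
  "huber h z = (if z < 0 then 0 else if z \<le> h then z^2 / (2*h) else z - h/2)"

definition outw :: "nat \<Rightarrow> nat \<Rightarrow> real" where
  "outw p i = (if i \<le> p then 1 else -1)"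

definition dotp :: "nat \<Rightarrow> (nat \<Rightarrow> real) \<Rightarrow> (nat \<Rightarrow> real) \<Rightarrow> real" where
  "dotp d v w = (\<Sum>j=1..d. v j * w j)"

definition vnorm :: "nat \<Rightarrow> (nat \<Rightarrow> real) \<Rightarrow> real" where
  "vnorm d v = sqrt (\<Sum>j=1..d. (v j)^2)"

definition net :: "nat \<Rightarrow> nat \<Rightarrow> real \<Rightarrow> params \<Rightarrow> (nat \<Rightarrow> real) \<Rightarrow> real" where
  "net d p h \<theta> x = (\<Sum>i=1..2*p. outw p i * huber h ((\<Sum>j=1..d. \<theta> (i,j) * x j) + \<theta> (i,0)))"

definition loss :: "nat \<Rightarrow> nat \<Rightarrow> real \<Rightarrow> nat \<Rightarrow> (nat \<Rightarrow> nat \<Rightarrow> real) \<Rightarrow> (nat \<Rightarrow> real)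
    \<Rightarrow> params \<Rightarrow> real" where
  "loss d p h n x y \<theta> = (\<Sum>s=1..n. ln (1 + exp (- (y s * net d p h \<theta> (x s))))) / real n"

definition param_idx :: "nat \<Rightarrow> nat \<Rightarrow> (nat \<times> nat) set" where
  "param_idx d p = {1..2*p} \<times> {0..d}"

definition partial_grad :: "(params \<Rightarrow> real) \<Rightarrow> params \<Rightarrow> nat \<times> nat \<Rightarrow> real" where
  "partial_grad F \<theta> k = deriv (\<lambda>t. F (\<theta>(k := t))) (\<theta> k)"

definition gd_step :: "(nat \<times> nat) set \<Rightarrow> (params \<Rightarrow> real) \<Rightarrow> real \<Rightarrow> params \<Rightarrow> params" where
  "gd_step I F a \<theta> = (\<lambda>k. if k \<in> I then \<theta> k - a * partial_grad F \<theta> k else \<theta> k)"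

fun gd_iter :: "(nat \<times> nat) set \<Rightarrow> (params \<Rightarrow> real) \<Rightarrow> (nat \<Rightarrow> params \<Rightarrow> real) \<Rightarrow> params
    \<Rightarrow> nat \<Rightarrow> params" where
  "gd_iter I F \<alpha> \<theta>0 0 = \<theta>0"
| "gd_iter I F \<alpha> \<theta>0 (Suc t) =
     (let \<theta> = gd_iter I F \<alpha> \<theta>0 t in gd_step I F (\<alpha> t \<theta>) \<theta>)"

definition gauss_init :: "(nat \<times> nat) set \<Rightarrow> real \<Rightarrow> params measure" where
  "gauss_init I \<sigma> = PiM I (\<lambda>_. density lborel (normal_density 0 \<sigma>))"

definition cluster_assms :: "nat \<Rightarrow> nat \<Rightarrow> (nat \<Rightarrow> nat \<Rightarrow> real) \<Rightarrow> (nat \<Rightarrow> real)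
    \<Rightarrow> (nat \<Rightarrow> nat set) \<Rightarrow> (nat \<Rightarrow> nat \<Rightarrow> real) \<Rightarrow> real \<Rightarrow> real \<Rightarrow> real \<Rightarrow> bool" where
  "cluster_assms d n x y K \<mu> \<epsilon> r \<Delta> \<longleftrightarrow>
     (\<forall>s\<in>{1..n}. y s = 1 \<or> y s = -1) \<and>
     (\<Union>k\<in>{1..4}. K k) = {1..n} \<and>
     (\<forall>k\<in>{1..4}. \<forall>l\<in>{1..4}. k \<noteq> l \<longrightarrow> K k \<inter> K l = {}) \<and>
     (\<forall>k\<in>{1..4}. \<forall>s\<in>K k. y s = (if k \<le> 2 then 1 else -1)) \<and>
     0 < \<epsilon> \<and>
     (\<forall>k\<in>{1..4}. (1/4 - \<epsilon>) * real n \<le> real (card (K k)) \<and>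
                   real (card (K k)) \<le> (1/4 + \<epsilon>) * real n) \<and>
     (\<forall>s\<in>{1..n}. vnorm d (x s) = 1) \<and>
     0 < r \<and>
     (\<forall>k\<in>{1..4}. vnorm d (\<mu> k) = 1 \<and> (\<forall>s\<in>K k. vnorm d (\<lambda>j. x s j - \<mu> k j) \<le> r)) \<and>
     0 < \<Delta> \<and>
     (\<forall>k\<in>{1..4}. \<forall>l\<in>{1..4}. (k \<le> 2) \<noteq> (l \<le> 2) \<longrightarrow> dotp d (\<mu> k) (\<mu> l) \<le> \<Delta>)"

end

theory Submission
  imports Defs "HOL-Real_Asymp.Real_Asymp"
begin

text \<open>
  At initialisation all outputs are close to \<open>0\<close>, so every example has weight about \<open>1/2\<close> in the
  gradient, and only a vanishing fraction of the neurons changes its activation pattern during the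
  first step. Hence the first step adds to the margin of example \<open>s\<close> about \<open>p powr (1/2 - \<beta>)\<close> times
  the average over \<open>t\<close> of \<open>y\<^sub>s y\<^sub>t (1 + x\<^sub>s \<bullet> x\<^sub>t)\<close> times the probability that a Gaussian neuron is
  active on both \<open>s\<close> and \<open>t\<close>. The own cluster contributes nearly \<open>2 * 1/2\<close>, each of the two opposite
  clusters at most \<open>1 * (1/2 - c)\<close> for a positive constant \<open>c\<close>, so the average is bounded away from \<open>0\<close>.

  Afterwards the gradient is at least of order \<open>L \<Lambda> / N\<close>, by the near-homogeneity of the network, where
  \<open>\<Lambda> = ln (1 / L)\<close> and \<open>N\<close> is the norm of the parameters. A step of length \<open>\<Lambda>\<^sup>2 / p\<close> decreases the loss
  and does not increase \<open>N / \<Lambda>\<^sup>2\<close>, so \<open>1 / L\<close> grows in each step by a constant of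
  order \<open>\<Lambda>\<^sub>1 ^ 4 / (p * N\<^sub>1\<^sup>2)\<close>.
\<close>

section \<open>The Huberized ReLU and the logistic loss\<close>

text \<open>The first step rests on an exact tie. With weight 1/2, the own cluster (a quarter of the
  data) contributes 1/4 * 1/2 * 2 * 1/2 = 1/8 per neuron, and the opposite half of the data at most
  1/2 * 1/2 * 1 * (1/2 - c) = 1/8 - c/4. The whole gain is c/4, so c must be an explicit number, and
  every other tolerance (cluster radius, size of the initial outputs, Hoeffding deviations, neurons
  near the kink) is chosen small against it. For orthogonal inputs the true value of c is 1/6; the
  value 1/200 used here is much smaller but follows from one-dimensional moments. The second cluster
  of the same label cannot hurt, because the bias makes every inner product 1 + x . x' nonnegative.

  Randomness enters only through a list of inequalities on the initial parameters; from there on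
  everything is deterministic. The bandwidth 1/p balances two effects: the deviation from
  homogeneity, summed over 2p neurons, is at most 1, while the curvature p of a neuron is offset by
  a gradient norm of order sqrt p * L, which shrinks with the loss and so permits growing
  steps.\<close>

definition dhuber :: "real \<Rightarrow> real \<Rightarrow> real" where
  "dhuber h z = (if z < 0 then 0 else if z \<le> h then z / h else 1)"

lemma dhuber_bounds: "h > 0 \<Longrightarrow> 0 \<le> dhuber h z \<and> dhuber h z \<le> 1"
  by (auto simp: dhuber_def divide_simps)

text \<open>Up to the factor 1/(2h), the Huberized ReLU is the difference of two squared positive
  parts, taken at \<open>z\<close> and at \<open>z - h\<close>. The first-order remainder of each
  lies in [0, e^2], so their difference is at most e^2 in absolute value.\<close>

lemma huber_taylor:
  assumes "h > 0"
  shows "\<bar>huber h (z + e) - huber h z - dhuber h z * e\<bar> \<le> e^2 / (2 * h)"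
proof -
  define P where "P = (\<lambda>z::real. (max z 0)^2)"
  have huber_eq: "huber h z = (P z - P (z - h)) / (2 * h)" for z
    using assms by (auto simp: huber_def P_def max_def field_simps power2_eq_square)
  have dhuber_eq: "dhuber h z = (2 * max z 0 - 2 * max (z - h) 0) / (2 * h)" for z
    using assms by (auto simp: dhuber_def max_def field_simps)
  have P: "0 \<le> P (z + e) - P z - 2 * max z 0 * e \<and> P (z + e) - P z - 2 * max z 0 * e \<le> e^2" for z
  proof -
    consider "z \<ge> 0" "z + e \<ge> 0" | "z \<ge> 0" "z + e < 0" | "z < 0" "z + e \<ge> 0" | "z < 0" "z + e < 0" by linarith
    then show ?thesis
    proof cases
      case 2
      then have "0 \<le> z * (- (z + 2 * e))" by (intro mult_nonneg_nonneg) auto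
      moreover have "0 \<le> (z + e)^2" by simp
      ultimately show ?thesis using 2 by (simp add: P_def max_def power2_eq_square algebra_simps)
    next
      case 3
      then have "(z + e)^2 \<le> e^2" by (intro power_mono) auto
      then show ?thesis using 3 by (simp add: P_def max_def)
    qed (simp_all add: P_def max_def power2_eq_square algebra_simps)
  qed
  have "huber h (z + e) - huber h z - dhuber h z * e =
     ((P (z + e) - P z - 2 * max z 0 * e) - (P (z - h + e) - P (z - h) - 2 * max (z - h) 0 * e)) / (2 * h)"
    unfolding huber_eq dhuber_eq using assms by (simp add: field_simps)
  moreover have "\<bar>(P (z + e) - P z - 2 * max z 0 * e) - (P (z - h + e) - P (z - h) - 2 * max (z - h) 0 * e)\<bar> \<le> e^2"
    using P[of z] P[of "z - h"] by linarith
  ultimately show ?thesis using assms by (simp add: divide_right_mono)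
qed

lemma huber_has_derivative:
  assumes "h > 0"
  shows "(huber h has_real_derivative dhuber h z) (at z)"
proof -
  have "((\<lambda>e. (huber h (z + e) - huber h z) / e - dhuber h z) \<longlongrightarrow> 0) (at 0)"
  proof (rule Lim_null_comparison)
    show "((\<lambda>e. \<bar>e\<bar> / (2 * h)) \<longlongrightarrow> 0) (at 0)"
      using tendsto_divide[OF tendsto_rabs[OF tendsto_ident_at] tendsto_const, of "2 * h" 0 UNIV] assms by simp
    have "norm ((huber h (z + e) - huber h z) / e - dhuber h z) \<le> \<bar>e\<bar> / (2 * h)" if "e \<noteq> 0" for e
    proof -
      have "(huber h (z + e) - huber h z) / e - dhuber h z = (huber h (z + e) - huber h z - dhuber h z * e) / e"
        using that by (simp add: field_simps)
      then have "norm ((huber h (z + e) - huber h z) / e - dhuber h z) \<le> e^2 / (2 * h) / \<bar>e\<bar>"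
        using divide_right_mono[OF huber_taylor[OF assms, of z e], of "\<bar>e\<bar>"] by (simp add: abs_divide)
      also have "\<dots> = (\<bar>e\<bar> * \<bar>e\<bar>) / (2 * h) / \<bar>e\<bar>" by (simp add: power2_eq_square)
      also have "\<dots> = \<bar>e\<bar> / (2 * h)" using that by (simp del: abs_mult_self_eq)
      finally show ?thesis .
    qed
    then show "\<forall>\<^sub>F e in at 0. norm ((huber h (z + e) - huber h z) / e - dhuber h z) \<le> \<bar>e\<bar> / (2 * h)"
      by (auto simp: eventually_at_filter)
  qed
  then show ?thesis unfolding DERIV_def by (rule LIM_zero_cancel)
qed

text \<open>Mean value theorem. It serves the neurons close to the kink, where nothing more precise
  than a slope in [0,1] is available.\<close>

lemma huber_secant:
  assumes "h > 0"
  shows "\<exists>c. 0 \<le> c \<and> c \<le> 1 \<and> huber h (z + e) - huber h z = c * e"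
proof -
  have *: "\<exists>c. 0 \<le> c \<and> c \<le> 1 \<and> huber h b - huber h a = c * (b - a)" if "a < b" for a b
    using MVT2[OF that huber_has_derivative[OF assms]] dhuber_bounds[OF assms]
    by (metis mult.commute)
  consider "e = 0" | "e > 0" | "e < 0" by linarith
  then show ?thesis
  proof cases
    case 3
    then obtain c where "0 \<le> c" "c \<le> 1" "huber h z - huber h (z + e) = c * (z - (z + e))"
      using *[of "z + e" z] by auto
    then show ?thesis by (intro exI[of _ c]) (auto simp: algebra_simps)
  qed (use *[of z "z + e"] in auto)
qed

lemma huber_far:
  assumes "h > 0" "\<bar>z\<bar> > \<bar>e\<bar> + h"
  shows "huber h (z + e) - huber h z = (if z > 0 then e else 0)"
  using assms by (auto simp: huber_def)

text \<open>A substitute for Euler's identity: for the unsmoothed ReLU both bounds would be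
  equalities with h = 0. The defect \<open>dhuber h z * z - huber h z\<close> is z^2/(2h) on the
  quadratic piece and h/2 beyond it.\<close>

lemma huber_euler:
  assumes "h > 0"
  shows "huber h z \<le> dhuber h z * z" "dhuber h z * z \<le> huber h z + h / 2"
proof -
  show "huber h z \<le> dhuber h z * z"
    using assms by (auto simp: huber_def dhuber_def power2_eq_square field_simps)
  have "z^2 \<le> h^2" if "0 \<le> z" "z \<le> h" using that by (simp add: power_mono)
  then show "dhuber h z * z \<le> huber h z + h / 2"
    using assms by (auto simp: huber_def dhuber_def field_simps power2_eq_square)
qed

section \<open>The logistic loss as a function of the margin\<close>

definition logi :: "real \<Rightarrow> real" where "logi m = ln (1 + exp (- m))"
text \<open>The logistic function at \<open>-m\<close>, hence decreasing: it is the weight that an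
  example of margin \<open>m\<close> receives in the gradient.\<close>

definition sigm :: "real \<Rightarrow> real" where "sigm m = 1 / (1 + exp m)"

lemma sigm_pos: "0 < sigm m" and sigm_less_1: "sigm m < 1"
  by (auto simp: sigm_def field_simps add_pos_pos)

lemma logi_pos: "0 < logi m"
  unfolding logi_def by (rule ln_gt_zero) simp

text \<open>Eliminates the margin: the weight becomes a function of the loss alone, so comparing
  weights with losses reduces to elementary bounds on the exponential.\<close>

lemma sigm_logi: "sigm m = 1 - exp (- logi m)"
proof -
  have pos': "exp m + 1 > 0" by (simp add: add_pos_pos)
  have "1 + exp (-m) > 0" by (simp add: add_pos_pos)
  then have "exp (- logi m) = 1 / (1 + exp (- m))"
    by (simp add: logi_def exp_minus inverse_eq_divide)
  also have "\<dots> = exp m / (exp m + 1)"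
    by (simp add: exp_minus field_simps add_pos_pos)
  finally show ?thesis
    using pos' by (simp add: sigm_def field_simps del: exp_gt_zero)
qed

lemma sigm_le_logi: "sigm m \<le> logi m"
  using exp_ge_add_one_self[of "- logi m"] by (simp add: sigm_logi)

lemma logi_has_derivative: "(logi has_real_derivative - sigm m) (at m)"
proof -
  have "1 + exp (- m) > 0" by (simp add: add_pos_pos)
  then show ?thesis
    unfolding logi_def[abs_def]
    by (auto intro!: derivative_eq_intros simp: sigm_def exp_minus field_simps add_pos_pos)
qed

lemma logi_le_exp: "logi m \<le> exp (- m)"
  unfolding logi_def by (rule ln_add_one_self_le_self) simp

text \<open>The point is the factor \<open>sigm m\<close> in the quadratic term: the curvature of
  the loss is proportional to the weight, hence controlled by the loss itself. The ratio of the two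
  arguments of ln is 1 + sigm m * (exp (-e) - 1), and ln r <= r - 1.\<close>

lemma logi_quadratic:
  assumes "\<bar>e\<bar> \<le> 1"
  shows "logi (m + e) \<le> logi m - sigm m * e + sigm m * e^2"
proof -
  have pos: "1 + exp (-m) > 0" "1 + exp (- (m+e)) > 0" "1 + exp m > 0" by (simp_all add: add_pos_pos)
  have E: "exp (- e) \<le> 1 - e + e^2"
  proof (cases "e \<le> 0")
    case True
    then show ?thesis using exp_bound[of "-e"] assms by auto
  next
    case False
    have "1 - e + e^2 > 0" using sum_power2_ge_zero[of "e - 1/2" 0] by (simp add: power2_eq_square algebra_simps)
    have "1 / exp e \<le> 1 / (1 + e)" using False exp_ge_add_one_self[of e] by (simp add: frac_le)
    \<comment> \<open>Because (1 + e) * (1 - e + e^2) = 1 + e^3.\<close>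
    also have "\<dots> \<le> 1 - e + e^2" using False by (simp add: field_simps power2_eq_square)
    finally show ?thesis by (simp add: exp_minus inverse_eq_divide)
  qed
  have r: "(1 + exp (- (m+e))) / (1 + exp (-m)) = 1 + sigm m * (exp (-e) - 1)"
  proof -
    have "exp (- (m + e)) = exp (- e) / exp m" using exp_diff[of "-e" m] by (simp add: algebra_simps)
    moreover have "exp (- m) = 1 / exp m" by (simp add: exp_minus inverse_eq_divide)
    moreover have "(1 + q / E) / (1 + 1 / E) = 1 + 1 / (1 + E) * (q - 1)" if "E > 0" for q E :: real
    proof -
      have "1 + q / E = (E + q) / E" "1 + 1 / E = (E + 1) / E" using that by (simp_all add: field_simps)
      then have "(1 + q / E) / (1 + 1 / E) = (E + q) / (E + 1)" using that by simp
      also have "\<dots> = 1 + 1 / (1 + E) * (q - 1)" using that by (simp add: field_simps)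
      finally show ?thesis .
    qed
    ultimately show ?thesis by (simp add: sigm_def)
  qed
  have "logi (m + e) - logi m = ln ((1 + exp (- (m+e))) / (1 + exp (-m)))"
    using pos by (simp add: logi_def ln_div)
  also have "\<dots> \<le> (1 + exp (- (m+e))) / (1 + exp (-m)) - 1"
    using pos by (intro ln_le_minus_one divide_pos_pos) auto
  also have "\<dots> = sigm m * (exp (-e) - 1)" using r by simp
  also have "\<dots> \<le> sigm m * (- e + e^2)"
    using E sigm_pos[of m] by (intro mult_left_mono) auto
  finally show ?thesis by (simp add: algebra_simps)
qed

lemma sigm_ge_logi:
  assumes "logi m \<le> 1/10"
  shows "9/10 * logi m \<le> sigm m"
proof -
  let ?l = "logi m"
  have "exp (- ?l) \<le> 1 / (1 + ?l)"
    using exp_ge_add_one_self[of ?l] logi_pos[of m] by (simp add: exp_minus inverse_eq_divide frac_le)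
  also have "\<dots> \<le> 1 - 9/10 * ?l"
    using logi_pos[of m] assms mult_left_mono[OF assms, of ?l] by (simp add: field_simps)
  finally show ?thesis by (simp add: sigm_logi)
qed

text \<open>Inverts the loss: exp (-m) = exp (logi m) - 1, which is at most 2 * logi m as long as
  the loss is at most 1.\<close>

lemma margin_ge_ln_logi:
  assumes "logi m \<le> 1"
  shows "m \<ge> - ln (2 * logi m)"
proof -
  have "exp (logi m) = 1 + exp (- m)" by (simp add: logi_def add_pos_pos)
  moreover have "exp (logi m) \<le> 1 + logi m + (logi m)^2"
    using assms logi_pos[of m] by (intro exp_bound) auto
  moreover have "(logi m)^2 \<le> logi m" using assms logi_pos[of m] by (simp add: power2_eq_square mult_left_le)
  ultimately have "exp (- m) \<le> 2 * logi m" by simp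
  then have "- m \<le> ln (2 * logi m)" using ln_ge_iff logi_pos[of m] by simp
  then show ?thesis by simp
qed

lemma abs_sigm_half: "\<bar>sigm m - 1/2\<bar> \<le> \<bar>m\<bar> / 2"
proof -
  have pos: "1 + exp m > 0" by (simp add: add_pos_pos)
  have eq: "sigm m - 1/2 = (1 - exp m) / (2 * (1 + exp m))"
    using pos by (simp add: sigm_def field_simps)
  have "\<bar>1 - exp m\<bar> \<le> \<bar>m\<bar> * (1 + exp m)"
  proof (cases "m \<ge> 0")
    case True
    have "(1 - m) * exp m \<le> exp (- m) * exp m"
      using exp_ge_add_one_self[of "-m"] by (intro mult_right_mono) auto
    then have "(1 - m) * exp m \<le> 1" by (simp add: exp_minus)
    then show ?thesis using True by (simp add: algebra_simps)
  next
    case False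
    then have "0 \<le> - m * exp m" by (intro mult_nonneg_nonneg) auto
    moreover have "\<bar>1 - exp m\<bar> = 1 - exp m" "\<bar>m\<bar> = - m" using False by auto
    ultimately show ?thesis using exp_ge_add_one_self[of m] by (simp only: distrib_left)
  qed
  then have "\<bar>1 - exp m\<bar> / (2 * (1 + exp m)) \<le> \<bar>m\<bar> / 2"
    using pos by (simp add: field_simps)
  then show ?thesis using pos by (simp add: eq abs_divide)
qed

lemma abs_sum_mult_le:
  fixes a b :: "'a \<Rightarrow> real"
  shows "\<bar>\<Sum>i\<in>A. a i * b i\<bar> \<le> sqrt (\<Sum>i\<in>A. (a i)^2) * sqrt (\<Sum>i\<in>A. (b i)^2)"
  using Cauchy_Schwarz_ineq_sum[of a b A]
  by (metis real_sqrt_abs real_sqrt_le_iff real_sqrt_mult)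

section \<open>Gradient descent on the network\<close>

text \<open>Collects what gradient descent needs from the data; neither clusters nor randomness are
  fixed at this level.\<close>

locale net_data =
  fixes d p n :: nat and x :: "nat \<Rightarrow> nat \<Rightarrow> real" and y :: "nat \<Rightarrow> real"
  assumes p_pos: "0 < p" and n_pos: "0 < n"
    and label: "s \<in> {1..n} \<Longrightarrow> \<bar>y s\<bar> = 1"
    and unit: "s \<in> {1..n} \<Longrightarrow> (\<Sum>j=1..d. (x s j)^2) = 1"
begin

abbreviation "h \<equiv> 1 / real p"
abbreviation "L \<equiv> loss d p h n x y"
abbreviation "Ix \<equiv> param_idx d p"

text \<open>The input with a constant coordinate 1 at index 0, so that the bias is an ordinary
  weight. Its squared norm is 2, and \<open>gram\<close> takes values in [0,2].\<close>

definition ext :: "nat \<Rightarrow> nat \<Rightarrow> real" where "ext s j = (if j = 0 then 1 else x s j)"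
definition gram :: "nat \<Rightarrow> nat \<Rightarrow> real" where "gram s t = (\<Sum>j=0..d. ext s j * ext t j)"
definition pre :: "params \<Rightarrow> nat \<Rightarrow> nat \<Rightarrow> real" where "pre \<theta> i s = (\<Sum>j=0..d. \<theta> (i,j) * ext s j)"
definition act :: "params \<Rightarrow> nat \<Rightarrow> nat \<Rightarrow> real" where "act \<theta> i s = dhuber h (pre \<theta> i s)"
definition marg :: "params \<Rightarrow> nat \<Rightarrow> real" where "marg \<theta> s = y s * net d p h \<theta> (x s)"
definition wt :: "params \<Rightarrow> nat \<Rightarrow> real" where "wt \<theta> s = sigm (marg \<theta> s)"
text \<open>Velocity of the preactivation along the negative gradient. Preactivations are linear in
  the parameters, so a step of length \<open>a\<close> moves them by exactly
  \<open>a * disp\<close>.\<close>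

definition disp :: "params \<Rightarrow> nat \<Rightarrow> nat \<Rightarrow> real" where
  "disp \<theta> i s = (\<Sum>j=0..d. - partial_grad L \<theta> (i,j) * ext s j)"
definition grad2 :: "params \<Rightarrow> real" where "grad2 \<theta> = (\<Sum>k\<in>Ix. (partial_grad L \<theta> k)^2)"
definition nrm2 :: "params \<Rightarrow> real" where "nrm2 \<theta> = (\<Sum>k\<in>Ix. (\<theta> k)^2)"

lemma h_pos: "0 < h" using p_pos by simp

lemma abs_outw: "\<bar>outw p i\<bar> = 1" "outw p i * outw p i = 1" "(outw p i)^2 = 1"
  by (auto simp: outw_def)

lemma label_sq: "s \<in> {1..n} \<Longrightarrow> y s * y s = 1"
  using label[of s] by (metis abs_mult_self_eq mult_1)

lemma sum_Ix: "(\<Sum>k\<in>Ix. F k) = (\<Sum>i=1..2*p. \<Sum>j=0..d. F (i,j))"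
  unfolding param_idx_def by (simp add: sum.cartesian_product)

lemma sum_0_d: "(\<Sum>j=0..d. F j) = F 0 + (\<Sum>j=1..d. F j)" for F :: "nat \<Rightarrow> real"
  by (simp add: sum.atLeast_Suc_atMost)

lemma ext_norm: "s \<in> {1..n} \<Longrightarrow> (\<Sum>j=0..d. (ext s j)^2) = 2"
  using unit[of s] by (simp add: sum_0_d ext_def)

lemma gram_eq: "gram s t = 1 + dotp d (x s) (x t)"
  by (simp add: gram_def sum_0_d ext_def dotp_def)

lemma abs_dotp_le:
  assumes "s \<in> {1..n}" "t \<in> {1..n}" shows "\<bar>dotp d (x s) (x t)\<bar> \<le> 1"
  using abs_sum_mult_le[of "x s" "x t" "{1..d}"] unit[OF assms(1)] unit[OF assms(2)] by (simp add: dotp_def)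

lemma gram_bounds:
  assumes "s \<in> {1..n}" "t \<in> {1..n}" shows "0 \<le> gram s t" "gram s t \<le> 2"
  using abs_dotp_le[OF assms] by (auto simp: gram_eq)

lemma pre_eq: "pre \<theta> i s = (\<Sum>j=1..d. \<theta> (i,j) * x s j) + \<theta> (i,0)"
  by (simp add: pre_def sum_0_d ext_def)

lemma net_eq: "net d p h \<theta> (x s) = (\<Sum>i=1..2*p. outw p i * huber h (pre \<theta> i s))"
  by (simp add: net_def pre_eq)

lemma loss_eq: "L \<theta> = (\<Sum>s=1..n. logi (marg \<theta> s)) / real n"
  by (simp add: loss_def logi_def marg_def)

lemma loss_pos: "0 < L \<theta>"
  unfolding loss_eq using n_pos logi_pos by (intro divide_pos_pos sum_pos) auto

lemma act_bounds: "0 \<le> act \<theta> i s" "act \<theta> i s \<le> 1"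
  using dhuber_bounds[OF h_pos] by (auto simp: act_def)

lemma wt_bounds: "0 < wt \<theta> s" "wt \<theta> s < 1" by (auto simp: wt_def sigm_pos sigm_less_1)

lemma pre_upd:
  assumes "j \<in> {0..d}"
  shows "pre (\<theta>((i,j) := t)) i' s = pre \<theta> i' s + (if i' = i then (t - \<theta> (i,j)) * ext s j else 0)"
proof (cases "i' = i")
  case True
  have "pre (\<theta>((i,j) := t)) i s = (\<Sum>k=0..d. \<theta> (i,k) * ext s k + (if k = j then (t - \<theta> (i,j)) * ext s j else 0))"
    unfolding pre_def by (intro sum.cong) (auto simp: algebra_simps)
  then show ?thesis using True assms by (simp add: sum.distrib pre_def)
next
  case False
  then show ?thesis by (simp add: pre_def)
qed

text \<open>\<open>deriv\<close> is informative only where a derivative exists. Thanks to the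
  smoothing, the chain rule applies at every parameter, and no exceptional set of kinks has to be
  avoided along the iteration.\<close>

lemma grad_eq:
  assumes "i \<in> {1..2*p}" "j \<in> {0..d}"
  shows "partial_grad L \<theta> (i,j) =
    - (\<Sum>s=1..n. wt \<theta> s * (y s * (outw p i * (act \<theta> i s * ext s j)))) / real n"
proof -
  have pd: "((\<lambda>t. huber h (pre (\<theta>((i,j) := t)) i' s)) has_real_derivative
      (if i' = i then act \<theta> i s * ext s j else 0)) (at (\<theta> (i,j)))" for i' s
  proof (cases "i' = i")
    case True
    have "((\<lambda>t. pre \<theta> i s + (t - \<theta> (i,j)) * ext s j) has_real_derivative ext s j) (at (\<theta> (i,j)))"
      by (auto intro!: derivative_eq_intros)
    from DERIV_chain2[OF _ this, of "huber h"] huber_has_derivative[OF h_pos, of "pre \<theta> i s"]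
    show ?thesis using True assms by (simp add: pre_upd act_def)
  next
    case False
    then show ?thesis using assms by (simp add: pre_upd)
  qed
  have nd: "((\<lambda>t. marg (\<theta>((i,j) := t)) s) has_real_derivative
      y s * (\<Sum>i'=1..2*p. outw p i' * (if i' = i then act \<theta> i s * ext s j else 0))) (at (\<theta> (i,j)))" for s
    unfolding marg_def net_eq by (intro DERIV_cmult DERIV_sum pd)
  have sm: "(\<Sum>i'=1..2*p. outw p i' * (if i' = i then act \<theta> i s * ext s j else 0)) = outw p i * (act \<theta> i s * ext s j)" for s
    using assms by (subst sum.remove[of _ i]) auto
  have md: "((\<lambda>t. logi (marg (\<theta>((i,j) := t)) s)) has_real_derivative
      - wt \<theta> s * (y s * (outw p i * (act \<theta> i s * ext s j)))) (at (\<theta> (i,j)))" for s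
    using DERIV_chain2[OF _ nd[of s, unfolded sm], of logi "- sigm (marg \<theta> s)"] logi_has_derivative[of "marg \<theta> s"]
    by (simp add: wt_def)
  have "((\<lambda>t. L (\<theta>((i,j) := t))) has_real_derivative
     (\<Sum>s=1..n. - wt \<theta> s * (y s * (outw p i * (act \<theta> i s * ext s j)))) / real n) (at (\<theta> (i,j)))"
    unfolding loss_eq by (intro DERIV_cdivide DERIV_sum md)
  then show ?thesis
    unfolding partial_grad_def by (simp add: DERIV_imp_deriv sum_negf)
qed

lemma disp_eq:
  assumes "i \<in> {1..2*p}"
  shows "disp \<theta> i s = (\<Sum>t=1..n. wt \<theta> t * (y t * (outw p i * (act \<theta> i t * gram t s)))) / real n"
proof -
  have "disp \<theta> i s = (\<Sum>j=0..d. (\<Sum>t=1..n. wt \<theta> t * (y t * (outw p i * (act \<theta> i t * ext t j)))) / real n * ext s j)"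
    unfolding disp_def using assms by (intro sum.cong) (simp_all add: grad_eq)
  also have "\<dots> = (\<Sum>j=0..d. \<Sum>t=1..n. wt \<theta> t * (y t * (outw p i * (act \<theta> i t * (ext t j * ext s j))))) / real n"
    by (simp add: sum_divide_distrib sum_distrib_right mult.assoc)
  also have "\<dots> = (\<Sum>t=1..n. wt \<theta> t * (y t * (outw p i * (act \<theta> i t * gram t s)))) / real n"
    by (subst sum.swap) (simp add: gram_def sum_distrib_left)
  finally show ?thesis .
qed

lemma pre_step:
  assumes "i \<in> {1..2*p}"
  shows "pre (gd_step Ix L a \<theta>) i s = pre \<theta> i s + a * disp \<theta> i s"
proof -
  have "pre (gd_step Ix L a \<theta>) i s = (\<Sum>j=0..d. \<theta> (i,j) * ext s j + a * (- partial_grad L \<theta> (i,j) * ext s j))"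
    unfolding pre_def using assms
    by (intro sum.cong) (auto simp: gd_step_def param_idx_def algebra_simps)
  then show ?thesis by (simp only: sum.distrib pre_def disp_def sum_distrib_left)
qed

lemma disp_sq_le:
  assumes "s \<in> {1..n}"
  shows "(\<Sum>i=1..2*p. (disp \<theta> i s)^2) \<le> 2 * grad2 \<theta>"
proof -
  have "(disp \<theta> i s)^2 \<le> (\<Sum>j=0..d. (partial_grad L \<theta> (i,j))^2) * 2" for i
    using Cauchy_Schwarz_ineq_sum[of "\<lambda>j. - partial_grad L \<theta> (i,j)" "ext s" "{0..d}"] ext_norm[OF assms]
    by (simp add: disp_def)
  then have "(\<Sum>i=1..2*p. (disp \<theta> i s)^2) \<le> (\<Sum>i=1..2*p. (\<Sum>j=0..d. (partial_grad L \<theta> (i,j))^2) * 2)"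
    by (intro sum_mono)
  then show ?thesis by (simp only: grad2_def sum_Ix mult.commute[of 2 "sum _ _"] sum_distrib_right)
qed

text \<open>The directional derivative of the margin of \<open>s\<close> along the negative gradient of the loss.\<close>

definition dirm :: "params \<Rightarrow> nat \<Rightarrow> real" where
  "dirm \<theta> s = y s * (\<Sum>i=1..2*p. outw p i * (act \<theta> i s * disp \<theta> i s))"

text \<open>Stated for an arbitrary direction because it is used twice: with the negative gradient
  for the squared gradient norm, and with the parameters themselves for the homogeneity
  argument.\<close>

lemma grad_inner_eq:
  "(\<Sum>k\<in>Ix. - partial_grad L \<theta> k * \<psi> k) =
    (\<Sum>s=1..n. wt \<theta> s * (y s * (\<Sum>i=1..2*p. outw p i * (act \<theta> i s * pre \<psi> i s)))) / real n"
proof -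
  let ?c = "\<lambda>s i. wt \<theta> s * (y s * (outw p i * act \<theta> i s))"
  have "(\<Sum>k\<in>Ix. - partial_grad L \<theta> k * \<psi> k) =
      (\<Sum>i=1..2*p. \<Sum>j=0..d. \<psi> (i,j) * ((\<Sum>s=1..n. ?c s i * ext s j) / real n))"
    unfolding sum_Ix by (intro sum.cong) (simp_all add: grad_eq mult.assoc)
  also have "\<dots> = (\<Sum>i=1..2*p. \<Sum>j=0..d. \<Sum>s=1..n. ?c s i * (\<psi> (i,j) * ext s j)) / real n"
    unfolding times_divide_eq_right sum_divide_distrib[symmetric] sum_distrib_left
    by (intro arg_cong2[of _ _ _ _ "(/)"] sum.cong refl) (simp only: mult_ac)
  also have "(\<Sum>i=1..2*p. \<Sum>j=0..d. \<Sum>s=1..n. ?c s i * (\<psi> (i,j) * ext s j))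
     = (\<Sum>i=1..2*p. \<Sum>s=1..n. \<Sum>j=0..d. ?c s i * (\<psi> (i,j) * ext s j))"
    by (intro sum.cong refl sum.swap)
  also have "\<dots> = (\<Sum>i=1..2*p. \<Sum>s=1..n. ?c s i * pre \<psi> i s)"
    by (simp only: pre_def sum_distrib_left)
  also have "\<dots> = (\<Sum>s=1..n. \<Sum>i=1..2*p. ?c s i * pre \<psi> i s)" by (rule sum.swap)
  also have "\<dots> = (\<Sum>s=1..n. wt \<theta> s * (y s * (\<Sum>i=1..2*p. outw p i * (act \<theta> i s * pre \<psi> i s))))"
    by (simp add: sum_distrib_left mult.assoc)
  finally show ?thesis .
qed

lemma grad2_eq: "grad2 \<theta> = (\<Sum>s=1..n. wt \<theta> s * dirm \<theta> s) / real n"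
proof -
  have "grad2 \<theta> = (\<Sum>k\<in>Ix. - partial_grad L \<theta> k * - partial_grad L \<theta> k)"
    by (simp add: grad2_def power2_eq_square)
  also have "\<dots> = (\<Sum>s=1..n. wt \<theta> s * dirm \<theta> s) / real n"
    unfolding grad_inner_eq dirm_def disp_def pre_def ..
  finally show ?thesis .
qed

lemma grad2_nonneg: "0 \<le> grad2 \<theta>" unfolding grad2_def by (intro sum_nonneg) auto

text \<open>Cauchy-Schwarz twice: over 2p neurons with slopes at most 1, and over the coordinates of
  \<open>ext s\<close>, whose squared norm is 2.\<close>

lemma abs_dirm_le:
  assumes "s \<in> {1..n}"
  shows "\<bar>dirm \<theta> s\<bar> \<le> 2 * sqrt (real p) * sqrt (grad2 \<theta>)"
proof -
  have "\<bar>dirm \<theta> s\<bar> = \<bar>\<Sum>i=1..2*p. (outw p i * act \<theta> i s) * disp \<theta> i s\<bar>"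
    using label[OF assms] by (simp add: dirm_def abs_mult mult.assoc)
  also have "\<dots> \<le> sqrt (\<Sum>i=1..2*p. (outw p i * act \<theta> i s)^2) * sqrt (\<Sum>i=1..2*p. (disp \<theta> i s)^2)"
    by (rule abs_sum_mult_le)
  also have "\<dots> \<le> sqrt (2 * real p) * sqrt (2 * grad2 \<theta>)"
  proof (intro mult_mono real_sqrt_le_mono disp_sq_le assms)
    have "(\<Sum>i=1..2*p. (outw p i * act \<theta> i s)^2) \<le> (\<Sum>i=1..2*p. 1)"
      using act_bounds by (intro sum_mono) (simp add: power_mult_distrib abs_outw power_le_one)
    then show "(\<Sum>i=1..2*p. (outw p i * act \<theta> i s)^2) \<le> 2 * real p" by simp
  qed (auto intro!: sum_nonneg)
  also have "\<dots> = 2 * sqrt (real p) * sqrt (grad2 \<theta>)"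
    by (simp add: real_sqrt_mult)
  finally show ?thesis .
qed

definition mwt :: "params \<Rightarrow> real" where "mwt \<theta> = (\<Sum>s=1..n. wt \<theta> s) / real n"

lemma mwt_pos: "0 < mwt \<theta>"
  unfolding mwt_def using n_pos wt_bounds by (intro divide_pos_pos sum_pos) auto

lemma mwt_le_1: "mwt \<theta> \<le> 1"
proof -
  have "(\<Sum>s=1..n. wt \<theta> s) \<le> (\<Sum>s=1..n. 1)" using wt_bounds less_imp_le by (intro sum_mono) blast
  then show ?thesis using n_pos by (simp add: mwt_def)
qed

lemma mwt_le_loss: "mwt \<theta> \<le> L \<theta>"
  unfolding mwt_def loss_eq wt_def by (intro divide_right_mono sum_mono sigm_le_logi) auto

lemma avg_wt_le:
  assumes "\<And>s. s \<in> {1..n} \<Longrightarrow> F s \<le> c"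
  shows "(\<Sum>s=1..n. wt \<theta> s * F s) / real n \<le> mwt \<theta> * c"
proof -
  have "(\<Sum>s=1..n. wt \<theta> s * F s) \<le> (\<Sum>s=1..n. wt \<theta> s * c)"
    using assms wt_bounds[THEN less_imp_le] by (intro sum_mono mult_left_mono) auto
  then show ?thesis by (simp add: mwt_def sum_distrib_right divide_right_mono)
qed

text \<open>The squared gradient norm is a weighted mean of the \<open>dirm\<close>s, each of which
  is at most 2 * sqrt p times the norm itself; one factor of the norm cancels. As \<open>mwt\<close>
  is at most the loss, the gradient vanishes at least as fast as the loss.\<close>

lemma sqrt_grad2_le: "sqrt (grad2 \<theta>) \<le> 2 * sqrt (real p) * mwt \<theta>"
proof -
  let ?G = "sqrt (grad2 \<theta>)"
  have "?G * ?G = grad2 \<theta>" using grad2_nonneg by simp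
  also have "\<dots> \<le> mwt \<theta> * (2 * sqrt (real p) * ?G)"
    by (subst grad2_eq, rule avg_wt_le) (use abs_dirm_le abs_le_D1 in blast)
  finally have "?G * ?G \<le> (2 * sqrt (real p) * mwt \<theta>) * ?G" by (simp add: mult_ac)
  moreover have "?G \<ge> 0" using grad2_nonneg by simp
  ultimately show ?thesis
    using mwt_pos[of \<theta>] mult_right_le_imp_le[of ?G ?G "2 * sqrt (real p) * mwt \<theta>"] by (cases "?G = 0") auto
qed

text \<open>Each neuron has curvature at most 1/h = p, so its remainder is at most p/2 times its
  squared displacement, and the squared displacements add up to at most 2 * a^2 * grad2.\<close>

lemma marg_step:
  assumes "s \<in> {1..n}"
  shows "\<bar>marg (gd_step Ix L a \<theta>) s - marg \<theta> s - a * dirm \<theta> s\<bar> \<le> real p * a^2 * grad2 \<theta>"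
proof -
  let ?R = "\<lambda>i. huber h (pre \<theta> i s + a * disp \<theta> i s) - huber h (pre \<theta> i s) - act \<theta> i s * (a * disp \<theta> i s)"
  have eq: "marg (gd_step Ix L a \<theta>) s - marg \<theta> s - a * dirm \<theta> s = y s * (\<Sum>i=1..2*p. outw p i * ?R i)"
  proof -
    have "(\<Sum>i=1..2*p. outw p i * huber h (pre (gd_step Ix L a \<theta>) i s)) =
        (\<Sum>i=1..2*p. outw p i * huber h (pre \<theta> i s + a * disp \<theta> i s))"
      by (intro sum.cong refl) (simp add: pre_step)
    moreover have "(\<Sum>i=1..2*p. outw p i * (act \<theta> i s * (a * disp \<theta> i s))) =
        a * (\<Sum>i=1..2*p. outw p i * (act \<theta> i s * disp \<theta> i s))"
      unfolding sum_distrib_left by (intro sum.cong refl) (simp only: mult_ac)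
    ultimately show ?thesis
      unfolding marg_def net_eq dirm_def right_diff_distrib sum_subtractf by (simp add: mult_ac)
  qed
  have "\<bar>marg (gd_step Ix L a \<theta>) s - marg \<theta> s - a * dirm \<theta> s\<bar> = \<bar>\<Sum>i=1..2*p. outw p i * ?R i\<bar>"
    unfolding eq abs_mult[of "y s"] label[OF assms] by (rule mult_1)
  also have "\<dots> \<le> (\<Sum>i=1..2*p. \<bar>outw p i * ?R i\<bar>)" by (rule sum_abs)
  also have "\<dots> \<le> (\<Sum>i=1..2*p. (a * disp \<theta> i s)^2 / (2 * h))"
    unfolding abs_mult[of "outw p _"] abs_outw mult_1 act_def by (intro sum_mono huber_taylor h_pos)
  also have "\<dots> = real p * a^2 / 2 * (\<Sum>i=1..2*p. (disp \<theta> i s)^2)"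
    unfolding sum_distrib_left by (intro sum.cong refl) (simp add: power_mult_distrib)
  also have "\<dots> \<le> real p * a^2 / 2 * (2 * grad2 \<theta>)"
    using disp_sq_le[OF assms] by (intro mult_left_mono) auto
  finally show ?thesis by simp
qed

section \<open>Decrease of the loss in one step\<close>

text \<open>The effective curvature along the step is of order p * L rather than p, since each
  second-order term carries the weight of its example. Steps up to 1/(28 p L) are therefore
  admissible, and they may grow as the loss falls.\<close>

lemma descent:
  assumes "0 \<le> a" "28 * real p * a * L \<theta> \<le> 1"
  shows "L (gd_step Ix L a \<theta>) \<le> L \<theta> - 3/4 * a * grad2 \<theta>"
proof -
  let ?\<theta>' = "gd_step Ix L a \<theta>" and ?G = "sqrt (grad2 \<theta>)"
  \<comment> \<open>The scale of the step: the first-order change of any margin is at most 2z, and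
    its second-order error at most z^2.\<close>
  define z where "z = sqrt (real p) * a * ?G"
  have z0: "0 \<le> z" unfolding z_def using assms grad2_nonneg by simp
  have zz: "z^2 = real p * a^2 * grad2 \<theta>" using grad2_nonneg by (simp add: z_def power_mult_distrib)
  have "z \<le> sqrt (real p) * a * (2 * sqrt (real p) * L \<theta>)"
    unfolding z_def using assms(1) sqrt_grad2_le[of \<theta>] mwt_le_loss[of \<theta>]
    by (intro mult_left_mono order_trans[OF sqrt_grad2_le]) auto
  also have "\<dots> = 2 * real p * a * L \<theta>" by (simp add: mult_ac)
  also have "\<dots> \<le> 1/14" using assms(2) by simp
  finally have z: "z \<le> 1/14" .
  have "z * z \<le> z * (1/14)" using z z0 by (intro mult_left_mono) auto
  then have z2: "z^2 \<le> z / 14" by (simp add: power2_eq_square)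
  \<comment> \<open>The 7 is 1 + 6: the error z^2 of the linearised margin, and e^2 <= (29/14)^2 *
    z^2 <= 6 * z^2. Multiplied by 4 it becomes the 28 of the hypothesis.\<close>
  have pt: "logi (marg ?\<theta>' s) \<le> logi (marg \<theta> s) - a * (wt \<theta> s * dirm \<theta> s) + wt \<theta> s * (7 * z^2)"
    if s: "s \<in> {1..n}" for s
  proof -
    define e where "e = marg ?\<theta>' s - marg \<theta> s"
    have e1: "\<bar>e - a * dirm \<theta> s\<bar> \<le> z^2" unfolding e_def zz by (rule marg_step[OF s])
    have "\<bar>a * dirm \<theta> s\<bar> \<le> a * (2 * sqrt (real p) * ?G)"
      using assms(1) abs_dirm_le[OF s, of \<theta>] by (simp add: abs_mult mult_left_mono)
    also have "\<dots> = 2 * z" by (simp add: z_def)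
    finally have "\<bar>e\<bar> \<le> 2 * z + z^2" using e1 by linarith
    then have e2: "\<bar>e\<bar> \<le> (29/14) * z" using z2 by linarith
    then have e3: "\<bar>e\<bar> \<le> 1" using z by linarith
    have "\<bar>e\<bar>^2 \<le> ((29/14) * z)^2" using e2 by (intro power_mono) auto
    also have "\<dots> \<le> 6 * z^2" by (simp add: power_mult_distrib power2_eq_square)
    finally have e4: "e^2 \<le> 6 * z^2" by simp
    have "logi (marg ?\<theta>' s) = logi (marg \<theta> s + e)" by (simp add: e_def)
    also have "\<dots> \<le> logi (marg \<theta> s) + wt \<theta> s * (- e + e^2)"
      using logi_quadratic[OF e3, of "marg \<theta> s"] by (simp add: wt_def algebra_simps)
    also have "wt \<theta> s * (- e + e^2) \<le> wt \<theta> s * (- a * dirm \<theta> s + 7 * z^2)"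
      using e1 e4 wt_bounds[of \<theta> s] by (intro mult_left_mono) auto
    finally show ?thesis by (simp add: algebra_simps)
  qed
  have "L ?\<theta>' \<le> (\<Sum>s=1..n. logi (marg \<theta> s) - a * (wt \<theta> s * dirm \<theta> s) + wt \<theta> s * (7 * z^2)) / real n"
    unfolding loss_eq[of ?\<theta>'] using pt by (intro divide_right_mono sum_mono) auto
  also have "\<dots> = L \<theta> - a * grad2 \<theta> + mwt \<theta> * (7 * z^2)"
    unfolding loss_eq grad2_eq mwt_def
    by (simp add: sum.distrib sum_subtractf add_divide_distrib diff_divide_distrib sum_distrib_left sum_distrib_right)
  also have "mwt \<theta> * (7 * z^2) \<le> L \<theta> * (7 * z^2)"
    using mwt_le_loss by (intro mult_right_mono) auto
  also have "\<dots> = (28 * real p * a * L \<theta>) * (a * grad2 \<theta> / 4)"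
    unfolding zz by (simp add: power2_eq_square)
  also have "\<dots> \<le> 1 * (a * grad2 \<theta> / 4)"
    using assms grad2_nonneg by (intro mult_right_mono) auto
  finally show ?thesis by simp
qed

subsection \<open>Convergence of the adaptive iteration\<close>

definition lam :: "params \<Rightarrow> real" where "lam \<theta> = ln (1 / L \<theta>)"
definition nrm :: "params \<Rightarrow> real" where "nrm \<theta> = sqrt (nrm2 \<theta>)"

lemma lam_eq: "lam \<theta> = - ln (L \<theta>)" using loss_pos by (simp add: lam_def ln_div)
lemma loss_lam: "L \<theta> = exp (- lam \<theta>)" using loss_pos by (simp add: lam_eq)

lemma nrm_step: assumes "0 \<le> a" shows "nrm (gd_step Ix L a \<theta>) \<le> nrm \<theta> + a * sqrt (grad2 \<theta>)"
proof -
  have "nrm (gd_step Ix L a \<theta>) = L2_set (\<lambda>k. \<theta> k + (- a) * partial_grad L \<theta> k) Ix"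
    unfolding nrm_def nrm2_def L2_set_def by (intro arg_cong[of _ _ sqrt] sum.cong) (auto simp: gd_step_def)
  also have "\<dots> \<le> L2_set \<theta> Ix + L2_set (\<lambda>k. (- a) * partial_grad L \<theta> k) Ix"
    by (rule L2_set_triangle_ineq)
  also have "L2_set (\<lambda>k. (- a) * partial_grad L \<theta> k) Ix = a * sqrt (grad2 \<theta>)"
    unfolding L2_set_def grad2_def using assms
    by (simp add: power_mult_distrib real_sqrt_mult sum_distrib_left[symmetric])
  finally show ?thesis by (simp add: nrm_def nrm2_def L2_set_def)
qed

lemma grad_inner_le: "(\<Sum>k\<in>Ix. - partial_grad L \<theta> k * \<theta> k) \<le> nrm \<theta> * sqrt (grad2 \<theta>)"
  using abs_sum_mult_le[of "\<lambda>k. - partial_grad L \<theta> k" \<theta> Ix]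
  by (simp add: nrm_def nrm2_def grad2_def mult.commute)

text \<open>For a 1-homogeneous network the right-hand side would be the margin itself; smoothing the kink
  costs at most \<open>h / 2\<close> per neuron.\<close>

lemma euler_defect:
  assumes "s \<in> {1..n}"
  shows "marg \<theta> s - 1 \<le> y s * (\<Sum>i=1..2*p. outw p i * (act \<theta> i s * pre \<theta> i s))"
proof -
  let ?r = "\<lambda>i. act \<theta> i s * pre \<theta> i s - huber h (pre \<theta> i s)"
  have "\<bar>y s * (\<Sum>i=1..2*p. outw p i * (act \<theta> i s * pre \<theta> i s)) - marg \<theta> s\<bar> =
     \<bar>y s\<bar> * \<bar>\<Sum>i=1..2*p. outw p i * ?r i\<bar>"
    unfolding marg_def net_eq abs_mult[symmetric] by (simp add: sum_subtractf right_diff_distrib)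
  also have "\<dots> \<le> (\<Sum>i=1..2*p. \<bar>outw p i * ?r i\<bar>)"
    using label[OF assms] by (simp only: mult_1 sum_abs)
  also have "\<dots> \<le> (\<Sum>i=1..2*p. h / 2)"
  proof (intro sum_mono)
    fix i
    show "\<bar>outw p i * ?r i\<bar> \<le> h / 2"
      using huber_euler[OF h_pos, of "pre \<theta> i s"] unfolding abs_mult abs_outw act_def by (simp only: mult_1 abs_le_iff) linarith
  qed
  also have "\<dots> = 1" using p_pos by simp
  finally show ?thesis by linarith
qed

text \<open>The gradient is tested against the parameters themselves, where near-homogeneity gives
  each margin a derivative of at least the margin minus 1. A single loss is at most n * L, so the
  bound on ln n forces every margin to be about 15/16 * lam or more. The factor 2/3 lies below 9/10
  * 9/10, the product of the losses in the weights and in the margins.\<close>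

lemma grad_inner_ge:
  assumes lam: "100 \<le> lam \<theta>" and n: "ln (real n) \<le> lam \<theta> / 16"
  shows "2/3 * L \<theta> * lam \<theta> \<le> nrm \<theta> * sqrt (grad2 \<theta>)"
proof -
  have pt: "81/100 * (logi (marg \<theta> s) * lam \<theta>) \<le>
     wt \<theta> s * (y s * (\<Sum>i=1..2*p. outw p i * (act \<theta> i s * pre \<theta> i s)))" if s: "s \<in> {1..n}" for s
  proof -
    let ?l = "logi (marg \<theta> s)"
    have "?l \<le> (\<Sum>s=1..n. logi (marg \<theta> s))"
      using s logi_pos less_imp_le by (intro member_le_sum) auto
    then have "?l \<le> real n * L \<theta>" using n_pos by (simp add: loss_eq)
    then have "ln ?l \<le> ln (real n * L \<theta>)" using logi_pos loss_pos n_pos by simp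
    also have "\<dots> = ln (real n) - lam \<theta>" using n_pos loss_pos[of \<theta>] by (simp add: ln_mult lam_eq)
    finally have l: "ln ?l \<le> - (15/16) * lam \<theta>" using n by simp
    have "?l = exp (ln ?l)" using logi_pos by simp
    also have "\<dots> \<le> exp (- 9)" using l lam by simp
    also have "\<dots> \<le> 1/10" using exp_ge_add_one_self[of 9] by (simp add: exp_minus field_simps)
    finally have l10: "?l \<le> 1/10" .
    have "- ln (2 * ?l) = - ln 2 - ln ?l" using logi_pos[of "marg \<theta> s"] by (simp add: ln_mult)
    moreover have "ln 2 \<le> (1::real)" using ln_add_one_self_le_self[of 1] by simp
    ultimately have "marg \<theta> s - 1 \<ge> 15/16 * lam \<theta> - 2"
      using margin_ge_ln_logi[of "marg \<theta> s"] l l10 by simp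
    then have m: "marg \<theta> s - 1 \<ge> 9/10 * lam \<theta>" using lam by simp
    have "81/100 * (?l * lam \<theta>) = (9/10 * ?l) * (9/10 * lam \<theta>)" by simp
    also have "\<dots> \<le> wt \<theta> s * (y s * (\<Sum>i=1..2*p. outw p i * (act \<theta> i s * pre \<theta> i s)))"
    proof (rule mult_mono)
      show "9/10 * ?l \<le> wt \<theta> s" using sigm_ge_logi[OF l10] by (simp add: wt_def)
      show "9/10 * lam \<theta> \<le> y s * (\<Sum>i=1..2*p. outw p i * (act \<theta> i s * pre \<theta> i s))"
        using m euler_defect[OF s, of \<theta>] by linarith
    qed (use lam wt_bounds[of \<theta> s] in auto)
    finally show ?thesis .
  qed
  have "2/3 * L \<theta> * lam \<theta> \<le> 81/100 * (L \<theta> * lam \<theta>)" using loss_pos[of \<theta>] lam by simp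
  also have "\<dots> = (\<Sum>s=1..n. 81/100 * (logi (marg \<theta> s) * lam \<theta>)) / real n"
    by (simp add: loss_eq sum_distrib_right sum_distrib_left sum_divide_distrib)
  also have "\<dots> \<le> (\<Sum>k\<in>Ix. - partial_grad L \<theta> k * \<theta> k)"
    unfolding grad_inner_eq using pt by (intro divide_right_mono sum_mono) auto
  also have "\<dots> \<le> nrm \<theta> * sqrt (grad2 \<theta>)" by (rule grad_inner_le)
  finally show ?thesis .
qed

text \<open>The last claim is the invariant behind the rate. The norm grows relatively by at most a
  G / N, while \<open>lam\<close> grows by at least w = 3/4 * a G^2 / L. With N G >= 2/3 * L * lam
  this makes a G / N <= 2 w / lam. The exponent 2 of \<open>lam\<close> is thus the inverse of 3/4 *
  2/3, and 1/3 is 3/4 * (2/3)^2.\<close>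

lemma adaptive_step:
  assumes lam: "100 \<le> lam \<theta>" and n: "ln (real n) \<le> lam \<theta> / 16"
  defines "\<theta>' \<equiv> gd_step Ix L ((lam \<theta>)^2 / real p) \<theta>"
  shows "0 < nrm \<theta>" "L \<theta>' \<le> L \<theta> - 1/3 * (lam \<theta>)^4 / (real p * (nrm \<theta>)^2) * (L \<theta>)^2"
    "nrm \<theta>' * (lam \<theta>)^2 \<le> nrm \<theta> * (lam \<theta>')^2"
proof -
  define a G where "a = (lam \<theta>)^2 / real p" and "G = sqrt (grad2 \<theta>)"
  have a0: "0 \<le> a" and G0: "0 \<le> G" and GG: "grad2 \<theta> = G^2"
    using grad2_nonneg by (auto simp: a_def G_def)
  have NG: "2/3 * L \<theta> * lam \<theta> \<le> nrm \<theta> * G" using grad_inner_ge[OF lam n] by (simp add: G_def)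
  have N0: "0 \<le> nrm \<theta>" unfolding nrm_def nrm2_def by (simp add: sum_nonneg)
  have pos: "0 < 2/3 * L \<theta> * lam \<theta>" using loss_pos lam by simp
  then show N: "0 < nrm \<theta>" using NG N0 by (cases "nrm \<theta> = 0") auto
  \<comment> \<open>This is the step-size condition of \<open>descent\<close>, because 28 p a L = 28
    * lam^2 * exp (-lam). It holds for lam >= 100 since 28 * 256 <= 100^2.\<close>
  have "28 * (lam \<theta>)^2 \<le> exp (lam \<theta>)"
  proof -
    have "28 * (lam \<theta>)^2 \<le> (lam \<theta>)^2 / 256 * (lam \<theta>)^2"
      using lam power_mono[OF lam, of 2] by (intro mult_right_mono) auto
    also have "\<dots> = (lam \<theta> / 4)^4" by (simp add: power4_eq_xxxx power2_eq_square)
    also have "\<dots> \<le> exp (lam \<theta> / 4)^4"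
      using lam exp_ge_add_one_self[of "lam \<theta> / 4"] by (intro power_mono) linarith+
    also have "\<dots> = exp (real 4 * (lam \<theta> / 4))" by (rule exp_of_nat_mult[symmetric])
    also have "\<dots> = exp (lam \<theta>)" by simp
    finally show ?thesis .
  qed
  then have "28 * (lam \<theta>)^2 * exp (- lam \<theta>) \<le> 1" by (simp add: exp_minus field_simps)
  then have "28 * (lam \<theta>)^2 * L \<theta> \<le> 1" by (simp only: loss_lam[symmetric])
  then have "28 * real p * a * L \<theta> \<le> 1" using p_pos by (simp add: a_def)
  from descent[OF a0 this] have desc: "L \<theta>' \<le> L \<theta> - 3/4 * a * G^2"
    by (simp add: \<theta>'_def a_def GG)
  have "(2/3 * L \<theta> * lam \<theta>)^2 \<le> (nrm \<theta> * G)^2" using NG pos by (intro power_mono) auto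
  then have "4/9 * (L \<theta>)^2 * (lam \<theta>)^2 \<le> G^2 * (nrm \<theta>)^2"
    by (simp add: power_mult_distrib power2_eq_square mult_ac)
  then have "4/9 * (L \<theta>)^2 * (lam \<theta>)^2 / (nrm \<theta>)^2 \<le> G^2"
    using N by (simp only: pos_divide_le_eq zero_less_power)
  then have "3/4 * a * (4/9 * (L \<theta>)^2 * (lam \<theta>)^2 / (nrm \<theta>)^2) \<le> 3/4 * a * G^2"
    using a0 by (intro mult_left_mono) auto
  moreover have "3/4 * a * (4/9 * (L \<theta>)^2 * (lam \<theta>)^2 / (nrm \<theta>)^2) =
      1/3 * (lam \<theta>)^4 / (real p * (nrm \<theta>)^2) * (L \<theta>)^2"
    by (simp add: a_def power4_eq_xxxx power2_eq_square)
  ultimately show "L \<theta>' \<le> L \<theta> - 1/3 * (lam \<theta>)^4 / (real p * (nrm \<theta>)^2) * (L \<theta>)^2"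
    using desc by linarith
  \<comment> \<open>A lower bound for the increase of \<open>lam\<close>, obtained from ln r <= r -
    1 with r the ratio of the two losses.\<close>
  define w where "w = 3/4 * a * G^2 / L \<theta>"
  have w0: "0 \<le> w" using a0 loss_pos[of \<theta>] by (simp add: w_def)
  have "ln (L \<theta>' / L \<theta>) \<le> L \<theta>' / L \<theta> - 1" using loss_pos by (intro ln_le_minus_one) simp
  also have "\<dots> = (L \<theta>' - L \<theta>) / L \<theta>" using loss_pos[of \<theta>] by (simp add: diff_divide_distrib)
  also have "\<dots> \<le> (- (3/4 * a * G^2)) / L \<theta>"
    using desc loss_pos[of \<theta>] by (intro divide_right_mono) auto
  also have "\<dots> = - w" by (simp add: w_def)
  finally have lam': "lam \<theta> + w \<le> lam \<theta>'" using loss_pos[of \<theta>] loss_pos[of \<theta>'] by (simp add: ln_div lam_eq)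
  have "nrm \<theta>' * (lam \<theta>)^2 \<le> (nrm \<theta> + a * G) * (lam \<theta>)^2"
    using nrm_step[OF a0, of \<theta>] by (intro mult_right_mono) (auto simp: \<theta>'_def a_def G_def)
  also have "\<dots> \<le> nrm \<theta> * ((lam \<theta>)^2 + 2 * lam \<theta> * w)"
  proof -
    have "a * G * (lam \<theta>)^2 = 3/2 * lam \<theta> * a * G / L \<theta> * (2/3 * L \<theta> * lam \<theta>)"
      using loss_pos[of \<theta>] by (simp add: power2_eq_square)
    also have "\<dots> \<le> 3/2 * lam \<theta> * a * G / L \<theta> * (nrm \<theta> * G)"
      using NG lam a0 G0 loss_pos[of \<theta>] by (intro mult_left_mono) auto
    also have "\<dots> = nrm \<theta> * (2 * lam \<theta> * w)" by (simp add: w_def power2_eq_square)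
    finally show ?thesis by (simp add: algebra_simps)
  qed
  also have "\<dots> \<le> nrm \<theta> * (lam \<theta>')^2"
  proof (intro mult_left_mono N0)
    have "(lam \<theta>)^2 + 2 * lam \<theta> * w \<le> (lam \<theta> + w)^2" by (simp add: power2_eq_square algebra_simps)
    also have "\<dots> \<le> (lam \<theta>')^2" using lam' lam w0 by (intro power_mono) auto
    finally show "(lam \<theta>)^2 + 2 * lam \<theta> * w \<le> (lam \<theta>')^2" .
  qed
  finally show "nrm \<theta>' * (lam \<theta>)^2 \<le> nrm \<theta> * (lam \<theta>')^2" .
qed

text \<open>In the induction, monotonicity of \<open>lam\<close> keeps the hypotheses of
  \<open>adaptive_step\<close> alive, and the norm invariant keeps the coefficient of L^2 at or
  above its initial value \<open>c\<close>. Then L' <= L - c * L^2 makes 1/L grow by at least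
  \<open>c\<close> per step.\<close>

lemma adaptive_rate:
  assumes lam: "100 \<le> lam (\<Theta> 0)" and n: "ln (real n) \<le> lam (\<Theta> 0) / 16"
    and step: "\<And>t. \<Theta> (Suc t) = gd_step Ix L ((lam (\<Theta> t))^2 / real p) (\<Theta> t)"
  shows "L (\<Theta> t) * real t \<le> 3 * real p * nrm2 (\<Theta> 0) / (lam (\<Theta> 0))^4"
proof -
  define c where "c = 1/3 * (lam (\<Theta> 0))^4 / (real p * (nrm (\<Theta> 0))^2)"
  have N0: "0 < nrm (\<Theta> 0)" using adaptive_step(1)[OF lam n] .
  have c: "0 < c" unfolding c_def using N0 lam p_pos by simp
  have "lam (\<Theta> 0) \<le> lam (\<Theta> t) \<and> nrm (\<Theta> t) * (lam (\<Theta> 0))^2 \<le> nrm (\<Theta> 0) * (lam (\<Theta> t))^2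
     \<and> c * real t * L (\<Theta> t) \<le> 1" for t
  proof (induction t)
    case 0
    then show ?case by simp
  next
    case (Suc t)
    let ?\<theta> = "\<Theta> t" and ?\<theta>' = "\<Theta> (Suc t)"
    have l: "100 \<le> lam ?\<theta>" "ln (real n) \<le> lam ?\<theta> / 16" using Suc lam n by auto
    note st = adaptive_step[OF l, folded step]
    have "((lam (\<Theta> 0))^2 / nrm (\<Theta> 0))^2 \<le> ((lam ?\<theta>)^2 / nrm ?\<theta>)^2"
      using Suc N0 st(1) by (intro power_mono) (auto simp: field_simps)
    then have "(lam (\<Theta> 0))^4 / (nrm (\<Theta> 0))^2 \<le> (lam ?\<theta>)^4 / (nrm ?\<theta>)^2"
      by (simp add: power_divide flip: power_mult)
    from divide_right_mono[OF this, of "3 * real p"]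
    have "c \<le> 1/3 * (lam ?\<theta>)^4 / (real p * (nrm ?\<theta>)^2)" by (simp add: c_def mult_ac)
    then have "c * (L ?\<theta>)^2 \<le> 1/3 * (lam ?\<theta>)^4 / (real p * (nrm ?\<theta>)^2) * (L ?\<theta>)^2"
      by (intro mult_right_mono) auto
    then have L': "L ?\<theta>' \<le> L ?\<theta> - c * (L ?\<theta>)^2" using st(2) by linarith
    then have "L ?\<theta>' \<le> L ?\<theta>" using c by (smt (verit) mult_nonneg_nonneg zero_le_power2)
    then have mono: "lam ?\<theta> \<le> lam ?\<theta>'" using loss_pos by (simp add: lam_eq)
    have "nrm ?\<theta>' * (lam (\<Theta> 0))^2 * (lam ?\<theta>)^2 \<le> nrm (\<Theta> 0) * (lam ?\<theta>')^2 * (lam ?\<theta>)^2"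
    proof -
      have "nrm ?\<theta>' * (lam (\<Theta> 0))^2 * (lam ?\<theta>)^2 \<le> nrm ?\<theta> * (lam ?\<theta>')^2 * (lam (\<Theta> 0))^2"
        using mult_right_mono[OF st(3), of "(lam (\<Theta> 0))^2"] by (simp add: mult_ac)
      also have "\<dots> \<le> nrm (\<Theta> 0) * (lam ?\<theta>)^2 * (lam ?\<theta>')^2"
        using mult_right_mono[of "nrm ?\<theta> * (lam (\<Theta> 0))^2" "nrm (\<Theta> 0) * (lam ?\<theta>)^2" "(lam ?\<theta>')^2"] Suc by (simp add: mult_ac)
      finally show ?thesis by (simp add: mult_ac)
    qed
    then have N: "nrm ?\<theta>' * (lam (\<Theta> 0))^2 \<le> nrm (\<Theta> 0) * (lam ?\<theta>')^2"
      using l by (simp add: mult_le_cancel_right)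
    have "c * real (Suc t) * L ?\<theta>' = c * real t * L ?\<theta>' + c * L ?\<theta>'" by (simp add: algebra_simps)
    also have "\<dots> \<le> (1 / L ?\<theta> + c) * L ?\<theta>'"
    proof -
      have "c * real t \<le> 1 / L ?\<theta>" using Suc loss_pos[of ?\<theta>] by (simp add: field_simps)
      then have "c * real t * L ?\<theta>' \<le> 1 / L ?\<theta> * L ?\<theta>'"
        using loss_pos[of ?\<theta>'] by (intro mult_right_mono) auto
      then show ?thesis by (simp add: algebra_simps)
    qed
    also have "\<dots> \<le> (1 / L ?\<theta> + c) * (L ?\<theta> - c * (L ?\<theta>)^2)"
      using L' c loss_pos[of ?\<theta>] by (intro mult_left_mono) auto
    \<comment> \<open>The discrete form of (1/L)' >= c, multiplied out so that no reciprocal of the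
      new loss is needed.\<close>
    also have "\<dots> = 1 - (c * L ?\<theta>)^2"
    proof -
      have "(1 / l + c) * (l - c * l^2) = 1 - (c * l)^2" if "l > 0" for l :: real
        using that by (simp add: algebra_simps power2_eq_square)
      then show ?thesis using loss_pos[of ?\<theta>] by blast
    qed
    also have "\<dots> \<le> 1" by simp
    finally show ?case using Suc mono N by auto
  qed
  then have "c * real t * L (\<Theta> t) \<le> 1" by blast
  moreover have "(nrm (\<Theta> 0))^2 = nrm2 (\<Theta> 0)" by (simp add: nrm_def nrm2_def sum_nonneg)
  moreover have "0 < 3 * real p * (nrm (\<Theta> 0))^2 / (lam (\<Theta> 0))^4" using lam p_pos N0 by simp
  moreover have "c * (3 * real p * (nrm (\<Theta> 0))^2 / (lam (\<Theta> 0))^4) = 1"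
    using lam p_pos N0 by (simp add: c_def)
  ultimately have "c * (L (\<Theta> t) * real t) \<le> c * (3 * real p * nrm2 (\<Theta> 0) / (lam (\<Theta> 0))^4)"
    by (simp only: mult_ac)
  then show ?thesis using c by (simp only: mult_le_cancel_left_pos)
qed

subsection \<open>The first step\<close>

text \<open>Counts strict sign patterns instead of summing the slopes \<open>act\<close>: sign
  events of Gaussians have probabilities that can be bounded directly, and the difference to
  \<open>act\<close> is absorbed by \<open>near\<close>.\<close>

definition both :: "params \<Rightarrow> nat \<Rightarrow> nat \<Rightarrow> real" where
  "both \<theta> s t = (\<Sum>i=1..2*p. of_bool (0 < pre \<theta> i s \<and> 0 < pre \<theta> i t))"
definition near :: "real \<Rightarrow> params \<Rightarrow> nat \<Rightarrow> real" where
  "near w \<theta> s = (\<Sum>i=1..2*p. of_bool (\<bar>pre \<theta> i s\<bar> \<le> w))"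

lemma abs_disp_le:
  assumes "i \<in> {1..2*p}" "s \<in> {1..n}"
  shows "\<bar>disp \<theta> i s\<bar> \<le> 2"
proof -
  have "\<bar>disp \<theta> i s\<bar> \<le> (\<Sum>t=1..n. \<bar>wt \<theta> t * (y t * (outw p i * (act \<theta> i t * gram t s)))\<bar>) / real n"
    unfolding disp_eq[OF assms(1)] abs_divide by (simp add: divide_right_mono)
  also have "\<dots> \<le> (\<Sum>t=1..n. 2) / real n"
  proof (intro divide_right_mono sum_mono)
    fix t assume t: "t \<in> {1..n}"
    have "wt \<theta> t * (act \<theta> i t * gram t s) \<le> 1 * (1 * 2)"
      using wt_bounds[of \<theta> t] act_bounds[of \<theta> i t] gram_bounds[OF t assms(2)]
      by (intro mult_mono) auto
    then show "\<bar>wt \<theta> t * (y t * (outw p i * (act \<theta> i t * gram t s)))\<bar> \<le> 2"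
      using wt_bounds[of \<theta> t] act_bounds[of \<theta> i t] gram_bounds[OF t assms(2)] label[OF t]
      by (simp add: abs_mult abs_outw)
  qed auto
  finally show ?thesis using n_pos by simp
qed

text \<open>The step moves a preactivation by at most 2a, so a neuron outside the band of width 2a +
  h stays on its linear piece and responds exactly linearly. Neurons in the band around
  \<open>s\<close> cost at most 2a each; replacing slopes by signs on the other examples costs
  another 2B, since \<open>gram\<close> is at most 2 and the mean weight at most 1. Together this is
  the 4B.\<close>

lemma first_step:
  assumes s: "s \<in> {1..n}" and a: "0 \<le> a"
    and B: "\<And>t. t \<in> {1..n} \<Longrightarrow> near (2 * a + h) \<theta> t \<le> B"
  shows "marg \<theta> s + a * ((\<Sum>t=1..n. wt \<theta> t * (y t * y s * (gram t s * both \<theta> s t))) / real n - 4 * B)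
    \<le> marg (gd_step Ix L a \<theta>) s"
proof -
  define A where "A = (\<lambda>i t. of_bool (0 < pre \<theta> i t) :: real)"
  define nb where "nb = (\<lambda>i t. of_bool (\<bar>pre \<theta> i t\<bar> \<le> 2 * a + h) :: real)"
  let ?e = "\<lambda>i. huber h (pre \<theta> i s + a * disp \<theta> i s) - huber h (pre \<theta> i s)"
  have e1: "\<bar>outw p i * ?e i - a * (outw p i * (disp \<theta> i s * A i s))\<bar> \<le> 2 * a * nb i s" if i: "i \<in> {1..2*p}" for i
  proof -
    have ad: "\<bar>a * disp \<theta> i s\<bar> \<le> 2 * a"
      using mult_left_mono[OF abs_disp_le[OF i s, of \<theta>] a] a by (simp add: abs_mult)
    have "\<bar>?e i - a * disp \<theta> i s * A i s\<bar> \<le> 2 * a * nb i s"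
    proof (cases "\<bar>pre \<theta> i s\<bar> \<le> 2 * a + h")
      case True
      obtain c where c: "0 \<le> c" "c \<le> 1" "?e i = c * (a * disp \<theta> i s)" using huber_secant[OF h_pos] by blast
      have "\<bar>c - A i s\<bar> \<le> 1" using c by (auto simp: A_def)
      moreover have "?e i - a * disp \<theta> i s * A i s = (c - A i s) * (a * disp \<theta> i s)"
        unfolding c(3) by (simp add: algebra_simps)
      ultimately have "\<bar>?e i - a * disp \<theta> i s * A i s\<bar> \<le> 1 * (2 * a)"
        using mult_mono[of "\<bar>c - A i s\<bar>" 1 "\<bar>a * disp \<theta> i s\<bar>" "2 * a"] ad by (simp only: abs_mult) simp
      then show ?thesis using True by (simp add: nb_def)
    next
      case False
      then have "?e i = (if 0 < pre \<theta> i s then a * disp \<theta> i s else 0)"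
        using ad by (intro huber_far[OF h_pos]) linarith
      then show ?thesis using a by (simp add: A_def nb_def)
    qed
    moreover have "outw p i * ?e i - a * (outw p i * (disp \<theta> i s * A i s)) = outw p i * (?e i - a * disp \<theta> i s * A i s)"
      by (simp add: algebra_simps)
    ultimately show ?thesis by (simp only: abs_mult abs_outw mult_1)
  qed
  have nearB: "(\<Sum>i=1..2*p. nb i t) \<le> B" if "t \<in> {1..n}" for t
    using B[OF that] by (simp add: near_def nb_def)
  let ?S = "\<Sum>i=1..2*p. outw p i * (disp \<theta> i s * A i s)"
  have "\<bar>(marg (gd_step Ix L a \<theta>) s - marg \<theta> s) - y s * (a * ?S)\<bar> =
     \<bar>y s\<bar> * \<bar>\<Sum>i=1..2*p. (outw p i * ?e i - a * (outw p i * (disp \<theta> i s * A i s)))\<bar>"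
    unfolding marg_def net_eq abs_mult[symmetric]
    by (simp add: pre_step sum_subtractf sum_distrib_left right_diff_distrib)
  also have "\<dots> \<le> (\<Sum>i=1..2*p. \<bar>outw p i * ?e i - a * (outw p i * (disp \<theta> i s * A i s))\<bar>)"
    using label[OF s] by (simp only: mult_1 sum_abs)
  also have "\<dots> \<le> (\<Sum>i=1..2*p. 2 * a * nb i s)" by (intro sum_mono e1)
  also have "\<dots> = 2 * a * (\<Sum>i=1..2*p. nb i s)" by (simp add: sum_distrib_left)
  also have "\<dots> \<le> 2 * a * B" using a nearB[OF s] by (intro mult_left_mono) auto
  finally have m1: "\<bar>(marg (gd_step Ix L a \<theta>) s - marg \<theta> s) - y s * (a * ?S)\<bar> \<le> 2 * a * B" .
  have "?S = (\<Sum>i=1..2*p. (\<Sum>t=1..n. wt \<theta> t * (y t * (act \<theta> i t * gram t s)) * A i s) / real n)"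
  proof (intro sum.cong refl)
    fix i assume i: "i \<in> {1..2*p}"
    have "outw p i * (outw p i * z) = z" for z by (metis abs_outw(2) mult.assoc mult_1)
    then show "outw p i * (disp \<theta> i s * A i s) = (\<Sum>t=1..n. wt \<theta> t * (y t * (act \<theta> i t * gram t s)) * A i s) / real n"
      unfolding disp_eq[OF i] times_divide_eq_left times_divide_eq_right sum_distrib_left sum_distrib_right
      by (intro arg_cong2[of _ _ _ _ "(/)"] sum.cong refl) (simp add: mult_ac)
  qed
  also have "\<dots> = (\<Sum>t=1..n. wt \<theta> t * (y t * (gram t s * (\<Sum>i=1..2*p. act \<theta> i t * A i s)))) / real n"
  proof -
    have "(\<Sum>i=1..2*p. \<Sum>t=1..n. wt \<theta> t * (y t * (act \<theta> i t * gram t s)) * A i s) =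
       (\<Sum>t=1..n. \<Sum>i=1..2*p. wt \<theta> t * (y t * (act \<theta> i t * gram t s)) * A i s)" by (rule sum.swap)
    also have "\<dots> = (\<Sum>t=1..n. wt \<theta> t * (y t * (gram t s * (\<Sum>i=1..2*p. act \<theta> i t * A i s))))"
      unfolding sum_distrib_left by (intro sum.cong refl) (simp only: mult_ac)
    finally show ?thesis by (simp only: sum_divide_distrib[symmetric])
  qed
  finally have S_eq: "?S = (\<Sum>t=1..n. wt \<theta> t * (y t * (gram t s * (\<Sum>i=1..2*p. act \<theta> i t * A i s)))) / real n" .
  have both_eq: "both \<theta> s t = (\<Sum>i=1..2*p. A i t * A i s)" for t
    unfolding both_def A_def by (intro sum.cong) auto
  have dv: "(\<Sum>t=1..n. wt \<theta> t * (y t * y s * (gram t s * both \<theta> s t))) / real n - y s * ?S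
     = (\<Sum>t=1..n. wt \<theta> t * (y t * y s * (gram t s * (\<Sum>i=1..2*p. (A i t - act \<theta> i t) * A i s)))) / real n"
  proof -
    define Q R where "Q t = (\<Sum>i=1..2*p. act \<theta> i t * A i s)" and "R t = (\<Sum>i=1..2*p. A i t * A i s)" for t
    have "(\<Sum>i=1..2*p. (A i t - act \<theta> i t) * A i s) = R t - Q t" for t
      unfolding Q_def R_def by (simp add: left_diff_distrib sum_subtractf)
    moreover have "y s * ?S = (\<Sum>t=1..n. wt \<theta> t * (y t * y s * (gram t s * Q t))) / real n"
      unfolding S_eq Q_def[symmetric] times_divide_eq_right sum_distrib_left
      by (intro arg_cong2[of _ _ _ _ "(/)"] sum.cong refl) (simp add: mult_ac)
    ultimately show ?thesis
      unfolding both_eq R_def[symmetric]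
      by (simp add: sum_subtractf right_diff_distrib diff_divide_distrib)
  qed
  also have "\<dots> \<le> mwt \<theta> * (2 * B)"
  proof (rule avg_wt_le)
    fix t assume t: "t \<in> {1..n}"
    have "\<bar>\<Sum>i=1..2*p. (A i t - act \<theta> i t) * A i s\<bar> \<le> (\<Sum>i=1..2*p. \<bar>(A i t - act \<theta> i t) * A i s\<bar>)"
      by (rule sum_abs)
    also have "\<dots> \<le> (\<Sum>i=1..2*p. nb i t)"
    proof (rule sum_mono)
      fix i
      have "\<bar>A i t - act \<theta> i t\<bar> \<le> nb i t"
        using a h_pos act_bounds[of \<theta> i t] by (auto simp: A_def nb_def act_def dhuber_def)
      moreover have "\<bar>A i s\<bar> \<le> 1" by (simp add: A_def)
      ultimately have "\<bar>A i t - act \<theta> i t\<bar> * \<bar>A i s\<bar> \<le> nb i t * 1" by (intro mult_mono) auto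
      then show "\<bar>(A i t - act \<theta> i t) * A i s\<bar> \<le> nb i t" by (simp add: abs_mult)
    qed
    also have "\<dots> \<le> B" by (rule nearB[OF t])
    finally have q: "\<bar>\<Sum>i=1..2*p. (A i t - act \<theta> i t) * A i s\<bar> \<le> B" .
    have "\<bar>y t * y s * (gram t s * (\<Sum>i=1..2*p. (A i t - act \<theta> i t) * A i s))\<bar> \<le> 2 * B"
      using gram_bounds[OF t s] label[OF t] label[OF s] q
      by (simp only: abs_mult) (simp, intro mult_mono, auto)
    then show "y t * y s * (gram t s * (\<Sum>i=1..2*p. (A i t - act \<theta> i t) * A i s)) \<le> 2 * B" by linarith
  qed
  also have "\<dots> \<le> 1 * (2 * B)"
  proof (intro mult_right_mono mwt_le_1)
    have "0 \<le> (\<Sum>i=1..2*p. nb i s)" by (intro sum_nonneg) (auto simp: nb_def)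
    then show "0 \<le> 2 * B" using nearB[OF s] by linarith
  qed
  finally have "(\<Sum>t=1..n. wt \<theta> t * (y t * y s * (gram t s * both \<theta> s t))) / real n - 4 * B \<le> y s * ?S - 2 * B" by simp
  from mult_left_mono[OF this a] m1 show ?thesis by (simp add: algebra_simps abs_le_iff)
qed

section \<open>Inner products within and across clusters\<close>

lemma gram_dist:
  assumes "s \<in> {1..n}" "t \<in> {1..n}"
  shows "gram s t = 2 - (\<Sum>j=0..d. (ext s j - ext t j)^2) / 2"
proof -
  have "(\<Sum>j=0..d. (ext s j - ext t j)^2) = (\<Sum>j=0..d. (ext s j)^2) + (\<Sum>j=0..d. (ext t j)^2) - 2 * gram s t"
    unfolding gram_def by (simp add: power2_diff sum.distrib sum_subtractf sum_distrib_left mult.assoc)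
  then have "(\<Sum>j=0..d. (ext s j - ext t j)^2) = 4 - 2 * gram s t"
    unfolding ext_norm[OF assms(1)] ext_norm[OF assms(2)] by linarith
  then show ?thesis by linarith
qed

lemma ext_dist_le:
  assumes "vnorm d (\<lambda>j. x s j - m j) \<le> r" "vnorm d (\<lambda>j. x t j - m j) \<le> r"
  shows "(\<Sum>j=0..d. (ext s j - ext t j)^2) \<le> 4 * r^2"
proof -
  have "L2_set (\<lambda>j. (x s j - m j) + (m j - x t j)) {1..d} \<le>
      L2_set (\<lambda>j. x s j - m j) {1..d} + L2_set (\<lambda>j. m j - x t j) {1..d}"
    by (rule L2_set_triangle_ineq)
  also have "\<dots> \<le> r + r"
    using assms by (intro add_mono) (simp_all add: vnorm_def L2_set_def power2_commute)
  finally have "sqrt (\<Sum>j=1..d. (x s j - x t j)^2) \<le> 2 * r" by (simp add: L2_set_def)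
  then have "(\<Sum>j=1..d. (x s j - x t j)^2) \<le> (2 * r)^2"
    by (rule sqrt_le_D)
  then show ?thesis by (simp add: sum_0_d ext_def power_mult_distrib)
qed

lemma gram_across_le:
  assumes "t \<in> {1..n}" "vnorm d m = 1"
    "vnorm d (\<lambda>j. x s j - m j) \<le> r" "vnorm d (\<lambda>j. x t j - m' j) \<le> r" "dotp d m m' \<le> \<Delta>"
  shows "gram s t \<le> 1 + \<Delta> + 2 * r"
proof -
  have *: "dotp d v w \<le> vnorm d v * vnorm d w" for v w
    using abs_sum_mult_le[of v w "{1..d}"] by (simp add: dotp_def vnorm_def abs_le_iff)
  have xt: "vnorm d (x t) = 1" using unit[OF assms(1)] by (simp add: vnorm_def)
  have "dotp d (x s) (x t) = dotp d (\<lambda>j. x s j - m j) (x t) + dotp d m (\<lambda>j. x t j - m' j) + dotp d m m'"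
    unfolding dotp_def by (simp add: algebra_simps flip: sum.distrib)
  moreover have "dotp d (\<lambda>j. x s j - m j) (x t) \<le> r"
    using *[of "\<lambda>j. x s j - m j" "x t"] assms(3) xt by simp
  moreover have "dotp d m (\<lambda>j. x t j - m' j) \<le> r"
    using *[of m "\<lambda>j. x t j - m' j"] assms(2,4) by simp
  ultimately show ?thesis using assms(5) by (simp add: gram_eq)
qed

text \<open>The hypotheses on \<open>net\<close>, \<open>near\<close> and \<open>both\<close> are
  exactly what a good initialisation supplies, so no probability occurs here. Points of one cluster
  are at squared distance at most (2r)^2 <= 4/10^12, and inner products across labels are at most 1
  + \<Delta> + 2r <= 1 + 3/10^6.\<close>

lemma cluster_margin:
  assumes cl: "cluster_assms d n x y K \<mu> \<epsilon> r \<Delta>"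
    and small: "\<Delta> < 1/10^6" "r < 1/10^6" "\<epsilon> < 1/10^6" and a: "0 \<le> a"
    and f0: "\<And>t. t \<in> {1..n} \<Longrightarrow> \<bar>net d p h \<theta> (x t)\<bar> \<le> 1/10000"
    and near: "\<And>t. t \<in> {1..n} \<Longrightarrow> near (2 * a + h) \<theta> t \<le> 2 * real p / 20000"
    and same: "\<And>s t. s \<in> {1..n} \<Longrightarrow> t \<in> {1..n} \<Longrightarrow> (\<Sum>j=0..d. (ext s j - ext t j)^2) \<le> 4/10^12 \<Longrightarrow>
        both \<theta> s t \<ge> 2 * real p * (1/2 - 1/1000)"
    and opp: "\<And>s t. s \<in> {1..n} \<Longrightarrow> t \<in> {1..n} \<Longrightarrow> gram s t \<le> 1 + 3/10^6 \<Longrightarrow>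
        both \<theta> s t \<le> 2 * real p * (1/2 - 9/2000)"
    and s: "s \<in> {1..n}"
  shows "marg (gd_step Ix L a \<theta>) s \<ge> a * real p / 1000 - 1/10000"
proof -
  have U: "(\<Union>k\<in>{1..4}. K k) = {1..n}"
    and lab: "\<And>k s. k \<in> {1..4} \<Longrightarrow> s \<in> K k \<Longrightarrow> y s = (if k \<le> 2 then 1 else -1)"
    and crd: "\<And>k. k \<in> {1..4} \<Longrightarrow> (1/4 - \<epsilon>) * real n \<le> real (card (K k)) \<and> real (card (K k)) \<le> (1/4 + \<epsilon>) * real n"
    and r0: "0 < r"
    and mu: "\<And>k. k \<in> {1..4} \<Longrightarrow> vnorm d (\<mu> k) = 1"
    and cen: "\<And>k s. k \<in> {1..4} \<Longrightarrow> s \<in> K k \<Longrightarrow> vnorm d (\<lambda>j. x s j - \<mu> k j) \<le> r"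
    and sep: "\<And>k l. k \<in> {1..4} \<Longrightarrow> l \<in> {1..4} \<Longrightarrow> (k \<le> 2) \<noteq> (l \<le> 2) \<Longrightarrow> dotp d (\<mu> k) (\<mu> l) \<le> \<Delta>"
    using cl unfolding cluster_assms_def by blast+
  have inK: "\<exists>k\<in>{1..4}. t \<in> K k" if "t \<in> {1..n}" for t using U that by blast
  have Kn: "K k \<subseteq> {1..n}" if "k \<in> {1..4}" for k using U that by blast
  obtain k where k: "k \<in> {1..4}" "s \<in> K k" using inK[OF s] by blast
  define P where "P = 2 * real p"
  have P0: "0 < P" using p_pos by (simp add: P_def)
  have r2: "4 * r^2 \<le> 4/10^12"
  proof -
    have "r^2 \<le> (1/10^6)^2" using r0 small by (intro power_mono) auto
    then show ?thesis by (simp add: power_divide)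
  qed
  have wt: "9999/20000 \<le> wt \<theta> t" "wt \<theta> t \<le> 10001/20000" if t: "t \<in> {1..n}" for t
  proof -
    have "\<bar>marg \<theta> t\<bar> \<le> 1/10000" using f0[OF t] label[OF t] by (simp add: marg_def abs_mult)
    then show "9999/20000 \<le> wt \<theta> t" "wt \<theta> t \<le> 10001/20000"
      using abs_sigm_half[of "marg \<theta> t"] unfolding wt_def by linarith+
  qed
  have both0: "0 \<le> both \<theta> s t" for t unfolding both_def by (intro sum_nonneg) auto
  define v where "v = (\<lambda>t. wt \<theta> t * (y t * y s * (gram t s * both \<theta> s t)))"
  \<comment> \<open>Lower bound for the contribution of a member of the own cluster, and upper bound
    for the damage done by an example of the other label; the weights lie within 1/20000 of
    1/2.\<close>
  define lo hi where "lo = (9999/20000) * ((2 - 2/10^12) * (P * (1/2 - 1/1000)))"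
    and "hi = (10001/20000) * ((1 + 3/10^6) * (P * (1/2 - 9/2000)))"
  have hi0: "0 \<le> hi" unfolding hi_def using P0 by simp
  have vt: "lo * of_bool (t \<in> K k) - hi * of_bool (y t \<noteq> y s) \<le> v t" if t: "t \<in> {1..n}" for t
  proof (cases "y t = y s")
    case True
    then have v: "v t = wt \<theta> t * (gram t s * both \<theta> s t)" using label_sq[OF s] by (simp add: v_def)
    show ?thesis
    proof (cases "t \<in> K k")
      case True
      have dd: "(\<Sum>j=0..d. (ext t j - ext s j)^2) \<le> 4/10^12" "(\<Sum>j=0..d. (ext s j - ext t j)^2) \<le> 4/10^12"
        using ext_dist_le[OF cen[OF k(1) True] cen[OF k]] ext_dist_le[OF cen[OF k] cen[OF k(1) True]] r2 by linarith+
      have "2 - 2/10^12 \<le> gram t s" using gram_dist[OF t s] dd by simp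
      moreover have "P * (1/2 - 1/1000) \<le> both \<theta> s t" unfolding P_def by (rule same[OF s t dd(2)])
      ultimately have "lo \<le> v t" unfolding lo_def v
        using wt[OF t] P0 gram_bounds[OF t s] wt_bounds[of \<theta> t] by (intro mult_mono) auto
      then show ?thesis using True \<open>y t = y s\<close> by simp
    next
      case False
      \<comment> \<open>The other cluster with the same label is simply dropped: its contributions
        are nonnegative because \<open>gram\<close> is.\<close>
      then show ?thesis using True both0[of t] gram_bounds[OF t s] wt_bounds[of \<theta> t] by (simp add: v)
    qed
  next
    case False
    obtain l where l: "l \<in> {1..4}" "t \<in> K l" using inK[OF t] by blast
    have kl: "(l \<le> 2) \<noteq> (k \<le> 2)" using lab[OF k] lab[OF l] False by (auto split: if_splits)
    then have "t \<notin> K k" using lab[OF k] lab[OF l] lab[OF k(1), of t] False by auto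
    have yy: "y t * y s = -1" using lab[OF k] lab[OF l] kl by auto
    have g: "gram t s \<le> 1 + 3/10^6" "gram s t \<le> 1 + 3/10^6"
      using gram_across_le[OF s mu[OF l(1)] cen[OF l] cen[OF k] sep[OF l(1) k(1) kl]] small
      gram_across_le[OF t mu[OF k(1)] cen[OF k] cen[OF l] sep[OF k(1) l(1)]] kl by simp_all
    have "both \<theta> s t \<le> P * (1/2 - 9/2000)" unfolding P_def by (rule opp[OF s t g(2)])
    then have "wt \<theta> t * (gram t s * both \<theta> s t) \<le> hi" unfolding hi_def
      using wt[OF t] P0 g gram_bounds[OF t s] wt_bounds[of \<theta> t] both0 by (intro mult_mono) auto
    then show ?thesis using False yy \<open>t \<notin> K k\<close> by (simp add: v_def)
  qed
  have c1: "(\<Sum>t=1..n. of_bool (t \<in> K k)) = real (card (K k))"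
    using Kn[OF k(1)] by (simp add: Int_absorb1 flip: Int_def)
  have c2: "(\<Sum>t=1..n. of_bool (y t \<noteq> y s)) \<le> 2 * ((1/4 + \<epsilon>) * real n)"
  proof -
    obtain l l' where l: "l \<in> {1..4}" "l' \<in> {1..4}" "{t \<in> {1..n}. y t \<noteq> y s} \<subseteq> K l \<union> K l'"
    proof (cases "k \<le> 2")
      case True
      have "{t \<in> {1..n}. y t \<noteq> y s} \<subseteq> K 3 \<union> K 4"
      proof
        fix t assume t: "t \<in> {t \<in> {1..n}. y t \<noteq> y s}"
        then obtain l where l: "l \<in> {1..4}" "t \<in> K l" using inK by blast
        then have "\<not> l \<le> 2" using lab[OF k] lab[OF l] True t by (auto split: if_splits)
        then have "l = 3 \<or> l = 4" using l by auto
        then show "t \<in> K 3 \<union> K 4" using l by auto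
      qed
      then show ?thesis using that[of 3 4] by simp
    next
      case False
      have "{t \<in> {1..n}. y t \<noteq> y s} \<subseteq> K 1 \<union> K 2"
      proof
        fix t assume t: "t \<in> {t \<in> {1..n}. y t \<noteq> y s}"
        then obtain l where l: "l \<in> {1..4}" "t \<in> K l" using inK by blast
        then have "l \<le> 2" by (rule_tac ccontr) (use lab[OF k] lab[OF l] False t in simp)
        then have "l = 1 \<or> l = 2" using l by auto
        then show "t \<in> K 1 \<union> K 2" using l by auto
      qed
      then show ?thesis using that[of 1 2] by simp
    qed
    have "(\<Sum>t=1..n. of_bool (y t \<noteq> y s)) = real (card {t \<in> {1..n}. y t \<noteq> y s})"
      by (simp add: Int_def)
    also have "\<dots> \<le> real (card (K l \<union> K l'))"
      using l Kn finite_subset[OF Kn[OF l(1)]] finite_subset[OF Kn[OF l(2)]] by (intro of_nat_mono card_mono) auto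
    also have "\<dots> \<le> real (card (K l)) + real (card (K l'))"
      using card_Un_le[of "K l" "K l'"] by linarith
    also have "\<dots> \<le> 2 * ((1/4 + \<epsilon>) * real n)" using crd[OF l(1)] crd[OF l(2)] by linarith
    finally show ?thesis .
  qed
  have "(lo * ((1/4 - 1/10^6) * real n) - hi * (2 * ((1/4 + 1/10^6) * real n))) \<le>
      lo * (\<Sum>t=1..n. of_bool (t \<in> K k)) - hi * (\<Sum>t=1..n. of_bool (y t \<noteq> y s))"
  proof (intro diff_mono mult_left_mono hi0)
    have "(1/4 - 1/10^6) * real n \<le> (1/4 - \<epsilon>) * real n" using small by (intro mult_right_mono) auto
    then show "(1/4 - 1/10^6) * real n \<le> (\<Sum>t=1..n. of_bool (t \<in> K k))" unfolding c1 using crd[OF k(1)] by linarith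
    have "2 * ((1/4 + \<epsilon>) * real n) \<le> 2 * ((1/4 + 1/10^6) * real n)" using small by (intro mult_left_mono mult_right_mono) auto
    then show "(\<Sum>t=1..n. of_bool (y t \<noteq> y s)) \<le> 2 * ((1/4 + 1/10^6) * real n)" using c2 by linarith
    show "0 \<le> lo" unfolding lo_def using P0 by simp
  qed
  also have "\<dots> = (\<Sum>t=1..n. lo * of_bool (t \<in> K k) - hi * of_bool (y t \<noteq> y s))"
    by (simp only: sum_subtractf sum_distrib_left)
  also have "\<dots> \<le> (\<Sum>t=1..n. v t)" by (intro sum_mono vt)
  finally have "(lo * (1/4 - 1/10^6) - hi * (2 * (1/4 + 1/10^6))) * real n \<le> (\<Sum>t=1..n. v t)"
    by (simp add: algebra_simps)
  then have "lo * (1/4 - 1/10^6) - hi * (2 * (1/4 + 1/10^6)) \<le> (\<Sum>t=1..n. v t) / real n"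
    using n_pos by (simp add: pos_le_divide_eq)
  \<comment> \<open>The leading terms P/8 cancel. What remains is 9P/8000 from the deficit 9/2000,
    minus P/4000 lost to the tolerance 1/1000, up to much smaller errors. This pays for the margin
    P/2000 and for the 4B of \<open>first_step\<close>.\<close>
  moreover have "P / 2000 + 4 * (P / 20000) \<le> lo * (1/4 - 1/10^6) - hi * (2 * (1/4 + 1/10^6))"
    unfolding lo_def hi_def using P0 by (simp add: field_simps)
  ultimately have "P / 2000 \<le> (\<Sum>t=1..n. v t) / real n - 4 * (P / 20000)" by linarith
  from mult_left_mono[OF this a]
  have "a * real p / 1000 \<le> a * ((\<Sum>t=1..n. v t) / real n - 4 * (P / 20000))" by (simp add: P_def)
  moreover have "\<bar>marg \<theta> s\<bar> \<le> 1/10000" using f0[OF s] label[OF s] by (simp add: marg_def abs_mult)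
  moreover have "marg \<theta> s + a * ((\<Sum>t=1..n. v t) / real n - 4 * (P / 20000)) \<le> marg (gd_step Ix L a \<theta>) s"
    unfolding v_def by (rule first_step[OF s a]) (use near in \<open>simp add: P_def\<close>)
  ultimately show ?thesis unfolding abs_le_iff by linarith
qed

lemma loss_le_exp:
  assumes "\<And>s. s \<in> {1..n} \<Longrightarrow> M \<le> marg \<theta> s"
  shows "L \<theta> \<le> exp (- M)"
proof -
  have "(\<Sum>s=1..n. logi (marg \<theta> s)) \<le> (\<Sum>s=1..n. exp (- M))"
    using assms by (intro sum_mono order_trans[OF logi_le_exp]) auto
  then show ?thesis using n_pos by (simp add: loss_eq field_simps)
qed

end

section \<open>Gaussian random variables\<close>

context prob_space
begin

lemma normal_prob_pos:
  assumes "0 < s" "distributed M lborel X (normal_density 0 s)"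
  shows "prob {\<omega> \<in> space M. 0 < X \<omega>} = 1/2"
proof -
  have X[measurable]: "X \<in> borel_measurable M" using distributed_measurable[OF assms(2)] by simp
  have D: "distributed M lborel (\<lambda>\<omega>. - X \<omega>) (normal_density 0 s)"
    using normal_density_affine[OF assms(2,1), of "-1" 0] by simp
  have "distr M lborel X = distr M lborel (\<lambda>\<omega>. - X \<omega>)"
    using distributed_distr_eq_density[OF assms(2)] distributed_distr_eq_density[OF D] by simp
  then have "measure (distr M lborel X) {0<..} = measure (distr M lborel (\<lambda>\<omega>. - X \<omega>)) {0<..}" by simp
  then have "prob (X -` {0<..} \<inter> space M) = prob ((\<lambda>\<omega>. - X \<omega>) -` {0<..} \<inter> space M)"
    by (simp add: measure_distr)
  moreover have "X -` {0<..} \<inter> space M = {\<omega> \<in> space M. 0 < X \<omega>}"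
    "(\<lambda>\<omega>. - X \<omega>) -` {0<..} \<inter> space M = {\<omega> \<in> space M. X \<omega> < 0}" by auto
  ultimately have neg: "prob {\<omega> \<in> space M. 0 < X \<omega>} = prob {\<omega> \<in> space M. X \<omega> < 0}" by simp
  have "(\<integral>\<^sup>+x. ennreal (normal_density 0 s x) * indicator {0} x \<partial>lborel) = 0"
    by (rule nn_integral_null_set) (simp add: null_sets_def)
  then have "emeasure M (X -` {0} \<inter> space M) = 0"
    using distributed_emeasure[OF assms(2), of "{0}"] by simp
  moreover have "X -` {0} \<inter> space M = {\<omega> \<in> space M. X \<omega> = 0}" by auto
  ultimately have zero: "prob {\<omega> \<in> space M. X \<omega> = 0} = 0"
    by (simp add: measure_def)
  have "space M = {\<omega> \<in> space M. 0 < X \<omega>} \<union> ({\<omega> \<in> space M. X \<omega> < 0} \<union> {\<omega> \<in> space M. X \<omega> = 0})"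
    by force
  then have "1 = prob ({\<omega> \<in> space M. 0 < X \<omega>} \<union> ({\<omega> \<in> space M. X \<omega> < 0} \<union> {\<omega> \<in> space M. X \<omega> = 0}))"
    using prob_space by metis
  also have "\<dots> = prob {\<omega> \<in> space M. 0 < X \<omega>} + (prob {\<omega> \<in> space M. X \<omega> < 0} + prob {\<omega> \<in> space M. X \<omega> = 0})"
  proof -
    have "prob ({\<omega> \<in> space M. X \<omega> < 0} \<union> {\<omega> \<in> space M. X \<omega> = 0}) =
        prob {\<omega> \<in> space M. X \<omega> < 0} + prob {\<omega> \<in> space M. X \<omega> = 0}"
      by (rule finite_measure_Union) auto
    then show ?thesis by (subst finite_measure_Union) auto
  qed
  finally show ?thesis using neg zero by linarith
qed

text \<open>The density is at most 1/(2s), because sqrt (2 * pi) >= 2, and the interval has length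
  2w.\<close>

lemma normal_abs_le:
  assumes "0 < s" "distributed M lborel X (normal_density 0 s)" "0 \<le> w"
  shows "prob {\<omega> \<in> space M. \<bar>X \<omega>\<bar> \<le> w} \<le> w / s"
proof -
  have dens: "normal_density 0 s x \<le> 1 / (2 * s)" for x
  proof -
    have "2 * s = sqrt (4 * s^2)" using assms(1) by (simp add: real_sqrt_mult)
    also have "\<dots> \<le> sqrt (2 * pi * s^2)" using pi_ge_two by (intro real_sqrt_le_mono mult_right_mono) auto
    finally have "1 / sqrt (2 * pi * s^2) \<le> 1 / (2 * s)" using assms(1) by (intro frac_le) auto
    moreover have "exp (- ((x - 0)^2) / (2 * s^2)) \<le> 1" by simp
    ultimately have "1 / sqrt (2 * pi * s^2) * exp (- ((x - 0)^2) / (2 * s^2)) \<le> 1 / (2 * s) * 1"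
      using assms(1) by (intro mult_mono) auto
    then show ?thesis by (simp add: normal_density_def)
  qed
  have eq: "X -` {-w..w} \<inter> space M = {\<omega> \<in> space M. \<bar>X \<omega>\<bar> \<le> w}" by (auto simp: abs_le_iff)
  have "emeasure M (X -` {-w..w} \<inter> space M) = (\<integral>\<^sup>+x. ennreal (normal_density 0 s x) * indicator {-w..w} x \<partial>lborel)"
    by (rule distributed_emeasure[OF assms(2)]) simp
  also have "\<dots> \<le> (\<integral>\<^sup>+x. ennreal (1 / (2 * s)) * indicator {-w..w} x \<partial>lborel)"
    using dens by (intro nn_integral_mono mult_right_mono ennreal_leI) auto
  also have "\<dots> = ennreal (1 / (2 * s)) * ennreal (2 * w)"
  proof -
    have "emeasure lborel {-w..w} = ennreal (2 * w)" using assms(3) by simp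
    then show ?thesis by (subst nn_integral_cmult_indicator) simp_all
  qed
  also have "\<dots> = ennreal (w / s)" using assms by (simp add: ennreal_mult[symmetric])
  finally show ?thesis using assms unfolding eq by (simp add: emeasure_eq_measure)
qed

lemma normal_abs_expectation:
  assumes "0 < s" "distributed M lborel X (normal_density 0 s)"
  shows "expectation (\<lambda>\<omega>. \<bar>X \<omega>\<bar>) = s * sqrt (2 / pi)" "integrable M (\<lambda>\<omega>. \<bar>X \<omega>\<bar>)"
    "expectation (\<lambda>\<omega>. (X \<omega>)^2) = s^2" "integrable M (\<lambda>\<omega>. (X \<omega>)^2)"
proof -
  note i = distributed_integral[OF assms(2)]
  note j = distributed_integrable[OF assms(2)]
  show "expectation (\<lambda>\<omega>. \<bar>X \<omega>\<bar>) = s * sqrt (2 / pi)"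
    using integral_normal_moment_abs_odd[OF assms(1), of 0 0] i[of "\<lambda>x. \<bar>x\<bar>"] by simp
  show "integrable M (\<lambda>\<omega>. \<bar>X \<omega>\<bar>)"
    using integrable_normal_moment_abs[OF assms(1), of 0 1] j[of "\<lambda>x. \<bar>x\<bar>"] by simp
  show "expectation (\<lambda>\<omega>. (X \<omega>)^2) = s^2"
    using integral_normal_moment_even[OF assms(1), of 0 1] i[of "\<lambda>x. x^2"] by (simp add: eval_nat_numeral)
  show "integrable M (\<lambda>\<omega>. (X \<omega>)^2)"
    using integrable_normal_moment[OF assms(1), of 0 2] j[of "\<lambda>x. x^2"] by simp
qed

text \<open>Multiplying the density by exp (x^2/(4s^2)) gives sqrt 2 times the Gaussian density of
  variance 2s^2. This one moment yields both the tail of a preactivation and the bound on the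
  parameter norm.\<close>

lemma normal_exp_square:
  assumes "0 < s" "distributed M lborel X (normal_density 0 s)"
  shows "(\<integral>\<^sup>+\<omega>. ennreal (exp ((X \<omega>)^2 / (4 * s^2))) \<partial>M) = ennreal (sqrt 2)"
proof -
  have e: "normal_density 0 s x * exp (x^2 / (4 * s^2)) = sqrt 2 * normal_density 0 (s * sqrt 2) x" for x
  proof -
    have "exp (- (x^2) / (2 * s^2)) * exp (x^2 / (4 * s^2)) = exp (- (x^2) / (4 * s^2))"
      using assms(1) by (simp add: exp_add[symmetric] field_simps)
    moreover have "normal_density 0 s x * exp (x^2 / (4 * s^2)) =
        1 / sqrt (2 * pi * s^2) * (exp (- (x^2) / (2 * s^2)) * exp (x^2 / (4 * s^2)))"
      by (simp add: normal_density_def)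
    moreover have "sqrt 2 * normal_density 0 (s * sqrt 2) x =
        sqrt 2 * (1 / sqrt (2 * (2 * pi * s^2))) * exp (- (x^2) / (4 * s^2))"
      by (simp add: normal_density_def power_mult_distrib mult_ac)
    moreover have "sqrt 2 * (1 / sqrt (2 * (2 * pi * s^2))) = 1 / sqrt (2 * pi * s^2)"
      by (subst real_sqrt_mult) simp
    ultimately show ?thesis by (simp only:)
  qed
  have "(\<integral>\<^sup>+\<omega>. ennreal (exp ((X \<omega>)^2 / (4 * s^2))) \<partial>M) =
     (\<integral>\<^sup>+x. ennreal (normal_density 0 s x) * ennreal (exp (x^2 / (4 * s^2))) \<partial>lborel)"
    by (rule distributed_nn_integral[OF assms(2), symmetric]) simp
  also have "\<dots> = (\<integral>\<^sup>+x. ennreal (sqrt 2) * ennreal (normal_density 0 (s * sqrt 2) x) \<partial>lborel)"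
    using e by (simp add: ennreal_mult[symmetric])
  also have "\<dots> = ennreal (sqrt 2) * 1"
    using assms(1) by (subst nn_integral_cmult) (auto simp: nn_integral_eq_integral)
  finally show ?thesis by simp
qed

lemma normal_tail:
  assumes "0 < s" "distributed M lborel X (normal_density 0 s)" "0 \<le> w"
  shows "prob {\<omega> \<in> space M. w < \<bar>X \<omega>\<bar>} \<le> 2 * exp (- (w^2) / (4 * s^2))"
proof -
  have X[measurable]: "X \<in> borel_measurable M" using distributed_measurable[OF assms(2)] by simp
  have "emeasure M {\<omega> \<in> space M. w < \<bar>X \<omega>\<bar>} \<le>
     ennreal (exp (- (w^2) / (4 * s^2))) * (\<integral>\<^sup>+\<omega>. ennreal (exp ((X \<omega>)^2 / (4 * s^2))) \<partial>M)"
  proof -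
    have "emeasure M {\<omega> \<in> space M. w < \<bar>X \<omega>\<bar>} = (\<integral>\<^sup>+\<omega>. indicator {\<omega> \<in> space M. w < \<bar>X \<omega>\<bar>} \<omega> \<partial>M)" by simp
    also have "\<dots> \<le> (\<integral>\<^sup>+\<omega>. ennreal (exp (- (w^2) / (4 * s^2))) * ennreal (exp ((X \<omega>)^2 / (4 * s^2))) \<partial>M)"
    proof (rule nn_integral_mono)
      fix \<omega>
      show "indicator {\<omega> \<in> space M. w < \<bar>X \<omega>\<bar>} \<omega> \<le> ennreal (exp (- (w^2) / (4 * s^2))) * ennreal (exp ((X \<omega>)^2 / (4 * s^2)))"
      proof (cases "w < \<bar>X \<omega>\<bar>")
        case True
        then have "w^2 \<le> \<bar>X \<omega>\<bar>^2" using assms(3) by (intro power_mono) auto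
        then have "1 \<le> exp (- (w^2) / (4 * s^2) + (X \<omega>)^2 / (4 * s^2))"
          using assms(1) by (simp add: divide_right_mono)
        then have "1 \<le> ennreal (exp (- (w^2) / (4 * s^2)) * exp ((X \<omega>)^2 / (4 * s^2)))"
          unfolding exp_add by simp
        then have "1 \<le> ennreal (exp (- (w^2) / (4 * s^2))) * ennreal (exp ((X \<omega>)^2 / (4 * s^2)))"
          by (simp add: ennreal_mult)
        then show ?thesis by (auto simp: indicator_def)
      qed simp
    qed
    also have "\<dots> = ennreal (exp (- (w^2) / (4 * s^2))) * (\<integral>\<^sup>+\<omega>. ennreal (exp ((X \<omega>)^2 / (4 * s^2))) \<partial>M)"
      by (rule nn_integral_cmult) simp
    finally show ?thesis .
  qed
  also have "\<dots> = ennreal (exp (- (w^2) / (4 * s^2)) * sqrt 2)"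
    unfolding normal_exp_square[OF assms(1,2)] by (simp add: ennreal_mult)
  finally have "prob {\<omega> \<in> space M. w < \<bar>X \<omega>\<bar>} \<le> exp (- (w^2) / (4 * s^2)) * sqrt 2"
    by (simp add: emeasure_eq_measure)
  also have "\<dots> \<le> exp (- (w^2) / (4 * s^2)) * 2"
    using real_sqrt_le_mono[of 2 4] by (intro mult_left_mono) auto
  finally show ?thesis by (simp add: mult.commute)
qed

text \<open>The defect in the triangle inequality for the absolute values of two Gaussians is
  supported on the event that they have opposite signs, so only one-dimensional marginals
  are needed to bound the probability of this event from below.\<close>

lemma normal_opposite_signs:
  assumes s: "0 < s" and u: "0 < u"
    and X: "distributed M lborel X (normal_density 0 s)"
    and Y: "distributed M lborel Y (normal_density 0 s)"
    and Z: "distributed M lborel (\<lambda>\<omega>. X \<omega> + Y \<omega>) (normal_density 0 u)"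
    and us: "u \<le> 17321/10000 * s"
  shows "prob {\<omega> \<in> space M. 0 < X \<omega> \<and> 0 < Y \<omega>} \<le> 1/2 - 1/200"
proof -
  have [measurable]: "X \<in> borel_measurable M" "Y \<in> borel_measurable M"
    using distributed_measurable[OF X] distributed_measurable[OF Y] by simp_all
  define A where "A = {\<omega> \<in> space M. X \<omega> * Y \<omega> < 0}"
  have [measurable]: "A \<in> sets M" unfolding A_def by measurable
  \<comment> \<open>Under opposite signs the defect is at most 2|X|, which the AM-GM inequality
    splits into a second moment and an indicator. The weight 10 keeps the second-moment term, s/10
    in expectation, below the expected defect.\<close>
  have pt: "\<bar>X \<omega>\<bar> + \<bar>Y \<omega>\<bar> - \<bar>X \<omega> + Y \<omega>\<bar> \<le> (X \<omega>)^2 / (10 * s) + 10 * s * indicator A \<omega>" if "\<omega> \<in> space M" for \<omega>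
  proof (cases "\<omega> \<in> A")
    case True
    have "0 \<le> (\<bar>X \<omega>\<bar> / 10 - s)^2 * 10 / s" using s by simp
    then have "2 * \<bar>X \<omega>\<bar> \<le> (X \<omega>)^2 / (10 * s) + 10 * s"
      using s by (simp add: power2_diff field_simps power2_eq_square)
    then show ?thesis using True by simp
  next
    case False
    then have "0 \<le> X \<omega> * Y \<omega>" using that by (simp add: A_def)
    then have "\<bar>X \<omega>\<bar> + \<bar>Y \<omega>\<bar> = \<bar>X \<omega> + Y \<omega>\<bar>" by (auto simp: zero_le_mult_iff)
    then show ?thesis using False s by simp
  qed
  note EX = normal_abs_expectation[OF s X] and EY = normal_abs_expectation[OF s Y] and EZ = normal_abs_expectation[OF u Z]
  have ind: "integrable M (indicat_real A)"
    by (intro integrable_real_indicator) (auto simp: emeasure_eq_measure)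
  then have int: "integrable M (\<lambda>\<omega>. (X \<omega>)^2 / (10 * s) + 10 * s * indicator A \<omega>)"
    using EX(4) by auto
  have "(2 * s - u) * sqrt (2 / pi) = expectation (\<lambda>\<omega>. \<bar>X \<omega>\<bar> + \<bar>Y \<omega>\<bar> - \<bar>X \<omega> + Y \<omega>\<bar>)"
    using EX(1,2) EY(1,2) EZ(1,2) by (simp add: algebra_simps)
  also have "\<dots> \<le> expectation (\<lambda>\<omega>. (X \<omega>)^2 / (10 * s) + 10 * s * indicator A \<omega>)"
    using EX(2) EY(2) EZ(2) pt int by (intro integral_mono) auto
  also have "\<dots> = s^2 / (10 * s) + 10 * s * prob A"
    using EX(3,4) ind by simp
  finally have 1: "(2 * s - u) * sqrt (2 / pi) \<le> s / 10 + 10 * s * prob A"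
    using s by (simp add: power2_eq_square)
  \<comment> \<open>Numerically, (2 - 1.7321) * 0.79 exceeds 0.21; removing 1/10 and dividing by 10
    leaves more than 1/100.\<close>
  have "pi < 32/10" by (rule le_less_trans[OF pi_approx(2)]) simp
  then have "(79/100)^2 \<le> 2 / pi" using pi_gt_zero by (simp add: field_simps power2_eq_square)
  then have "79/100 \<le> sqrt (2 / pi)" by (rule real_le_rsqrt)
  then have "(2679/10000 * s) * (79/100) \<le> (2 * s - u) * sqrt (2 / pi)"
    using s us by (intro mult_mono) auto
  with 1 have "s * (1/100) \<le> s * prob A" using s by linarith
  then have q: "1/100 \<le> prob A" using s by (simp only: mult_le_cancel_left_pos)
  let ?B = "{\<omega> \<in> space M. 0 < X \<omega> \<and> 0 < Y \<omega>}"
  let ?C = "{\<omega> \<in> space M. 0 < X \<omega> \<and> Y \<omega> < 0}" and ?D = "{\<omega> \<in> space M. X \<omega> < 0 \<and> 0 < Y \<omega>}"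
  \<comment> \<open>\<open>?B\<close> with \<open>?C\<close> lies in {X > 0} and \<open>?B\<close>
    with \<open>?D\<close> in {Y > 0}, both of probability 1/2; hence 2 * prob ?B + prob A <=
    1.\<close>
  have "A = ?C \<union> ?D" unfolding A_def by (auto simp: mult_less_0_iff)
  then have "prob A \<le> prob ?C + prob ?D" using measure_Un_le[of ?C M ?D] by simp
  moreover have "prob ?B + prob ?C = prob (?B \<union> ?C)" by (rule finite_measure_Union[symmetric]) auto
  moreover have "prob (?B \<union> ?C) \<le> prob {\<omega> \<in> space M. 0 < X \<omega>}" by (rule finite_measure_mono) auto
  moreover have "prob ?B + prob ?D = prob (?B \<union> ?D)" by (rule finite_measure_Union[symmetric]) auto
  moreover have "prob (?B \<union> ?D) \<le> prob {\<omega> \<in> space M. 0 < Y \<omega>}" by (rule finite_measure_mono) auto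
  ultimately show ?thesis using q normal_prob_pos[OF s X] normal_prob_pos[OF s Y] by linarith
qed

text \<open>If X > 0 but Y is not positive, then X lies within \<open>w\<close> of 0 or differs from
  Y by at least \<open>w\<close>. The second case is handled by Chebyshev, so the joint law of X and
  Y never enters.\<close>

lemma normal_same_signs:
  assumes s: "0 < s" and w: "0 < w"
    and X: "distributed M lborel X (normal_density 0 s)"
    and [measurable]: "Y \<in> borel_measurable M"
    and Z: "integrable M (\<lambda>\<omega>. (X \<omega> - Y \<omega>)^2)"
  shows "1/2 - w / s - expectation (\<lambda>\<omega>. (X \<omega> - Y \<omega>)^2) / w^2 \<le> prob {\<omega> \<in> space M. 0 < X \<omega> \<and> 0 < Y \<omega>}"
proof -
  have [measurable]: "X \<in> borel_measurable M" using distributed_measurable[OF X] by simp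
  let ?B = "{\<omega> \<in> space M. 0 < X \<omega> \<and> 0 < Y \<omega>}" and ?C = "{\<omega> \<in> space M. \<bar>X \<omega>\<bar> \<le> w}"
    and ?D = "{\<omega> \<in> space M. w^2 \<le> (X \<omega> - Y \<omega>)^2}"
  have "{\<omega> \<in> space M. 0 < X \<omega>} \<subseteq> ?B \<union> (?C \<union> ?D)"
  proof
    fix \<omega> assume \<omega>: "\<omega> \<in> {\<omega> \<in> space M. 0 < X \<omega>}"
    show "\<omega> \<in> ?B \<union> (?C \<union> ?D)"
    proof (cases "0 < Y \<omega> \<or> \<bar>X \<omega>\<bar> \<le> w")
      case False
      then have "w^2 \<le> (X \<omega> - Y \<omega>)^2" using \<omega> w by (intro power_mono) auto
      then show ?thesis using \<omega> by simp
    qed (use \<omega> in auto)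
  qed
  then have "prob {\<omega> \<in> space M. 0 < X \<omega>} \<le> prob (?B \<union> (?C \<union> ?D))" by (rule finite_measure_mono) auto
  moreover have "prob (?B \<union> (?C \<union> ?D)) \<le> prob ?B + prob (?C \<union> ?D)" by (rule measure_Un_le) auto
  moreover have "prob (?C \<union> ?D) \<le> prob ?C + prob ?D" by (rule measure_Un_le) auto
  moreover have "prob ?C \<le> w / s" using normal_abs_le[OF s X] w by simp
  moreover have "prob ?D \<le> expectation (\<lambda>\<omega>. (X \<omega> - Y \<omega>)^2) / w^2"
    using w by (intro integral_Markov_inequality_measure[OF Z, where A="{}"]) auto
  ultimately show ?thesis using normal_prob_pos[OF s X] by linarith
qed

end

section \<open>Concentration of empirical frequencies\<close>

context prob_space
begin

lemma expectation_of_bool: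
  assumes [measurable]: "Measurable.pred M P"
  shows "expectation (\<lambda>\<omega>. of_bool (P \<omega>)) = prob {\<omega> \<in> space M. P \<omega>}"
proof -
  have "expectation (\<lambda>\<omega>. of_bool (P \<omega>)) = expectation (indicat_real {\<omega> \<in> space M. P \<omega>})"
    by (intro Bochner_Integration.integral_cong) (auto simp: indicator_def)
  then show ?thesis by simp
qed

text \<open>Only a one-sided bound \<open>m\<close> on the probabilities is at hand, so Hoeffding is
  applied around the true mean \<open>mu\<close>, which is then compared with
  \<open>card J * m\<close>.\<close>

lemma hoeffding_frequency:
  assumes J: "finite J" "J \<noteq> {}" and ind: "indep_vars (\<lambda>_. borel) (\<lambda>i \<omega>. of_bool (P i \<omega>) :: real) J"
    and P: "\<And>i. i \<in> J \<Longrightarrow> Measurable.pred M (P i)" and e: "0 \<le> e"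
  shows "(\<And>i. i \<in> J \<Longrightarrow> prob {\<omega> \<in> space M. P i \<omega>} \<le> m) \<Longrightarrow>
      prob {\<omega> \<in> space M. real (card J) * (m + e) \<le> (\<Sum>i\<in>J. of_bool (P i \<omega>))} \<le> exp (- 2 * real (card J) * e^2)"
    and "(\<And>i. i \<in> J \<Longrightarrow> m \<le> prob {\<omega> \<in> space M. P i \<omega>}) \<Longrightarrow>
      prob {\<omega> \<in> space M. (\<Sum>i\<in>J. of_bool (P i \<omega>)) \<le> real (card J) * (m - e)} \<le> exp (- 2 * real (card J) * e^2)"
proof -
  define mu where "mu = (\<Sum>i\<in>J. expectation (\<lambda>\<omega>. of_bool (P i \<omega>) :: real))"
  interpret Hoeffding_ineq M J "\<lambda>i \<omega>. of_bool (P i \<omega>)" "\<lambda>_. 0" "\<lambda>_. 1" mu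
    by unfold_locales (use J ind in \<open>auto simp: mu_def\<close>)
  have c0: "0 < real (card J)" using J by (simp add: card_gt_0_iff)
  have m1: "(\<lambda>\<omega>. \<Sum>i\<in>J. of_bool (P i \<omega>) :: real) \<in> borel_measurable M"
    by (intro borel_measurable_sum random_variable)
  have mu_eq: "mu = (\<Sum>i\<in>J. prob {\<omega> \<in> space M. P i \<omega>})"
    unfolding mu_def by (intro sum.cong refl expectation_of_bool P)
  have ex: "- 2 * (real (card J) * e)^2 / (\<Sum>i\<in>J. (1 - 0)^2) = - 2 * real (card J) * e^2"
    using c0 by (simp add: power2_eq_square)
  have e': "0 \<le> real (card J) * e" using e by simp
  have s0: "0 < (\<Sum>i\<in>J. (1 - 0)^2 :: real)" using c0 by simp
  { assume m: "\<And>i. i \<in> J \<Longrightarrow> prob {\<omega> \<in> space M. P i \<omega>} \<le> m"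
    have "mu \<le> real (card J) * m" unfolding mu_eq using m by (intro sum_bounded_above) auto
    then have "{\<omega> \<in> space M. real (card J) * (m + e) \<le> (\<Sum>i\<in>J. of_bool (P i \<omega>))} \<subseteq>
        {\<omega> \<in> space M. (\<Sum>i\<in>J. of_bool (P i \<omega>)) \<ge> mu + real (card J) * e}"
      by (auto simp: distrib_left)
    then have "prob {\<omega> \<in> space M. real (card J) * (m + e) \<le> (\<Sum>i\<in>J. of_bool (P i \<omega>))} \<le>
        prob {\<omega> \<in> space M. (\<Sum>i\<in>J. of_bool (P i \<omega>)) \<ge> mu + real (card J) * e}"
      using m1 by (intro finite_measure_mono) measurable
    also have "\<dots> \<le> exp (- 2 * real (card J) * e^2)"
      using Hoeffding_ineq_ge[OF e' s0] unfolding ex by simp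
    finally show "prob {\<omega> \<in> space M. real (card J) * (m + e) \<le> (\<Sum>i\<in>J. of_bool (P i \<omega>))} \<le> exp (- 2 * real (card J) * e^2)" . }
  { assume m: "\<And>i. i \<in> J \<Longrightarrow> m \<le> prob {\<omega> \<in> space M. P i \<omega>}"
    have "real (card J) * m \<le> mu" unfolding mu_eq using m by (intro sum_bounded_below) auto
    then have "{\<omega> \<in> space M. (\<Sum>i\<in>J. of_bool (P i \<omega>)) \<le> real (card J) * (m - e)} \<subseteq>
        {\<omega> \<in> space M. (\<Sum>i\<in>J. of_bool (P i \<omega>)) \<le> mu - real (card J) * e}"
      by (auto simp: right_diff_distrib)
    then have "prob {\<omega> \<in> space M. (\<Sum>i\<in>J. of_bool (P i \<omega>)) \<le> real (card J) * (m - e)} \<le>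
        prob {\<omega> \<in> space M. (\<Sum>i\<in>J. of_bool (P i \<omega>)) \<le> mu - real (card J) * e}"
      using m1 by (intro finite_measure_mono) measurable
    also have "\<dots> \<le> exp (- 2 * real (card J) * e^2)"
      using Hoeffding_ineq_le[OF e' s0] unfolding ex by simp
    finally show "prob {\<omega> \<in> space M. (\<Sum>i\<in>J. of_bool (P i \<omega>)) \<le> real (card J) * (m - e)} \<le> exp (- 2 * real (card J) * e^2)" . }
qed

end

section \<open>Linear forms and norms under the Gaussian product measure\<close>

locale gauss_space =
  fixes I :: "(nat \<times> nat) set" and \<sigma> :: real
  assumes fin_I: "finite I" and I_ne: "I \<noteq> {}" and sigma_pos: "0 < \<sigma>"
begin

abbreviation "G \<equiv> gauss_init I \<sigma>"

lemma prob_space_G: "prob_space G"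
  unfolding gauss_init_def using sigma_pos by (intro prob_space_PiM prob_space_normal_density) auto

sublocale prob_space G by (rule prob_space_G)

lemma sets_G: "sets G = sets (PiM I (\<lambda>_. borel))"
  unfolding gauss_init_def by (intro sets_PiM_cong) auto

lemma coord_measurable: "k \<in> I \<Longrightarrow> (\<lambda>\<theta>. \<theta> k) \<in> borel_measurable G"
  unfolding measurable_cong_sets[OF sets_G refl] by (rule measurable_component_singleton)

lemma distr_coord:
  assumes "k \<in> I"
  shows "distr G borel (\<lambda>\<theta>. \<theta> k) = density lborel (normal_density 0 \<sigma>)"
proof -
  have "distr G (density lborel (normal_density 0 \<sigma>)) (\<lambda>\<theta>. \<theta> k) = density lborel (normal_density 0 \<sigma>)"
    unfolding gauss_init_def using assms sigma_pos
    by (intro distr_PiM_component prob_space_normal_density) auto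
  then show ?thesis by (subst distr_cong[OF refl _ refl]) auto
qed

lemma coord_distributed: "k \<in> I \<Longrightarrow> distributed G lborel (\<lambda>\<theta>. \<theta> k) (normal_density 0 \<sigma>)"
  unfolding distributed_def using distr_coord[of k] coord_measurable[of k]
  by (auto simp: distr_cong[OF refl sets_lborel refl])

text \<open>Independence means that the joint law is the product of the marginals, and the joint law
  of all coordinates is the law of the identity map.\<close>

lemma coord_indep: "indep_vars (\<lambda>_. borel) (\<lambda>k \<theta>. \<theta> k) I"
proof (subst indep_vars_iff_distr_eq_PiM')
  show "distr G (PiM I (\<lambda>_. borel)) (\<lambda>x. \<lambda>i\<in>I. x i) = PiM I (\<lambda>i. distr G borel (\<lambda>x. x i))"
  proof -
    have "distr G (PiM I (\<lambda>_. borel)) (\<lambda>x. \<lambda>i\<in>I. x i) = distr G G (\<lambda>x. x)"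
    proof (intro distr_cong refl)
      show "sets (PiM I (\<lambda>_. borel)) = sets G" by (simp add: sets_G)
      show "restrict x I = x" if "x \<in> space G" for x
        using that by (auto simp: gauss_init_def space_PiM PiE_restrict)
    qed
    also have "\<dots> = PiM I (\<lambda>i. distr G borel (\<lambda>x. x i))"
      unfolding distr_id by (subst gauss_init_def) (intro PiM_cong refl, simp add: distr_coord)
    finally show ?thesis .
  qed
qed (use I_ne coord_measurable in auto)

text \<open>Coefficients that vanish are discarded first: their terms are constants without a
  density, and the sum rule for independent normals asks for positive variances.\<close>

lemma linear_distributed:
  assumes "J \<subseteq> I" "0 < (\<Sum>k\<in>J. (c k)^2)"
  shows "distributed G lborel (\<lambda>\<theta>. \<Sum>k\<in>J. c k * \<theta> k) (normal_density 0 (\<sigma> * sqrt (\<Sum>k\<in>J. (c k)^2)))"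
proof -
  have fin: "finite J" using assms(1) fin_I by (rule finite_subset)
  define J' where "J' = {k \<in> J. c k \<noteq> 0}"
  have J': "J' \<subseteq> J" "finite J'" "J' \<subseteq> I" using fin assms(1) by (auto simp: J'_def)
  have sq: "(\<Sum>k\<in>J. (c k)^2) = (\<Sum>k\<in>J'. (c k)^2)"
    using fin unfolding J'_def by (intro sum.mono_neutral_right) auto
  have lin: "(\<Sum>k\<in>J. c k * \<theta> k) = (\<Sum>k\<in>J'. c k * \<theta> k)" for \<theta>
    using fin unfolding J'_def by (intro sum.mono_neutral_right) auto
  have ne: "J' \<noteq> {}" using assms(2) unfolding sq by auto
  have ind: "indep_vars (\<lambda>_. borel) (\<lambda>k \<theta>. c k * \<theta> k) J'"
    using indep_vars_compose2[OF indep_vars_subset[OF coord_indep J'(3)], of "\<lambda>k x. c k * x" "\<lambda>_. borel"] by simp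
  have "distributed G lborel (\<lambda>\<theta>. \<Sum>k\<in>J'. c k * \<theta> k)
     (normal_density (\<Sum>k\<in>J'. 0) (sqrt (\<Sum>k\<in>J'. (\<bar>c k\<bar> * \<sigma>)^2)))"
  proof (rule sum_indep_normal[OF J'(2) ne ind])
    fix k assume k: "k \<in> J'"
    then have c: "c k \<noteq> 0" by (simp add: J'_def)
    then show "0 < \<bar>c k\<bar> * \<sigma>" using sigma_pos by simp
    show "distributed G lborel (\<lambda>\<theta>. c k * \<theta> k) (normal_density 0 (\<bar>c k\<bar> * \<sigma>))"
      using normal_density_affine[OF coord_distributed sigma_pos c, of k 0] k J' by auto
  qed
  moreover have "sqrt (\<Sum>k\<in>J'. (\<bar>c k\<bar> * \<sigma>)^2) = \<sigma> * sqrt (\<Sum>k\<in>J. (c k)^2)"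
    using sigma_pos by (simp add: sq power_mult_distrib real_sqrt_mult flip: sum_distrib_right)
  ultimately show ?thesis by (simp add: lin)
qed

text \<open>Covers the zero form too, which occurs as the difference of preactivations on two
  coinciding inputs.\<close>

lemma linear_second_moment:
  assumes "J \<subseteq> I"
  shows "integrable G (\<lambda>\<theta>. (\<Sum>k\<in>J. c k * \<theta> k)^2)"
    "expectation (\<lambda>\<theta>. (\<Sum>k\<in>J. c k * \<theta> k)^2) = \<sigma>^2 * (\<Sum>k\<in>J. (c k)^2)"
proof -
  have fin: "finite J" using assms(1) fin_I by (rule finite_subset)
  have "integrable G (\<lambda>\<theta>. (\<Sum>k\<in>J. c k * \<theta> k)^2) \<and> expectation (\<lambda>\<theta>. (\<Sum>k\<in>J. c k * \<theta> k)^2) = \<sigma>^2 * (\<Sum>k\<in>J. (c k)^2)"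
  proof (cases "(\<Sum>k\<in>J. (c k)^2) = 0")
    case True
    then have "\<forall>k\<in>J. c k = 0" using fin by (simp add: sum_nonneg_eq_0_iff)
    then show ?thesis by simp
  next
    case False
    then have pos: "0 < (\<Sum>k\<in>J. (c k)^2)" by (simp add: sum_nonneg less_le)
    then have s: "0 < \<sigma> * sqrt (\<Sum>k\<in>J. (c k)^2)" using sigma_pos by simp
    show ?thesis
      using normal_abs_expectation(3,4)[OF s linear_distributed[OF assms pos]] pos by (simp add: power_mult_distrib)
  qed
  then show "integrable G (\<lambda>\<theta>. (\<Sum>k\<in>J. c k * \<theta> k)^2)"
    "expectation (\<lambda>\<theta>. (\<Sum>k\<in>J. c k * \<theta> k)^2) = \<sigma>^2 * (\<Sum>k\<in>J. (c k)^2)" by auto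
qed

text \<open>Chernoff bound: by independence the exponential moment is (sqrt 2)^N, and sqrt 2 <= exp
  (1/2) leaves exp (-N/2).\<close>

lemma square_sum_tail:
  "prob {\<theta> \<in> space G. 4 * \<sigma>^2 * real (card I) \<le> (\<Sum>k\<in>I. (\<theta> k)^2)} \<le> exp (- real (card I) / 2)"
proof -
  note coord_measurable[measurable]
  define N where "N = real (card I)"
  have "emeasure G {\<theta> \<in> space G. N \<le> (\<Sum>k\<in>I. (\<theta> k)^2 / (4 * \<sigma>^2))} \<le>
    ennreal (exp (- 1 * N)) * (\<integral>\<^sup>+\<theta>\<in>space G. exp (1 * (\<Sum>k\<in>I. (\<theta> k)^2 / (4 * \<sigma>^2))) \<partial>G)"
    by (rule Chernoff_ineq_nn_integral_ge) auto
  also have "(\<integral>\<^sup>+\<theta>\<in>space G. exp (1 * (\<Sum>k\<in>I. (\<theta> k)^2 / (4 * \<sigma>^2))) \<partial>G) =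
     (\<integral>\<^sup>+\<theta>. (\<Prod>k\<in>I. ennreal (exp ((\<theta> k)^2 / (4 * \<sigma>^2)))) \<partial>G)"
    by (intro nn_integral_cong) (simp add: exp_sum fin_I prod_ennreal)
  also have "\<dots> = (\<Prod>k\<in>I. \<integral>\<^sup>+\<theta>. ennreal (exp ((\<theta> k)^2 / (4 * \<sigma>^2))) \<partial>G)"
    by (intro indep_vars_nn_integral fin_I indep_vars_compose2[OF coord_indep]) auto
  also have "\<dots> = (\<Prod>k\<in>I. ennreal (sqrt 2))"
    by (intro prod.cong refl normal_exp_square[OF sigma_pos coord_distributed])
  also have "\<dots> = ennreal (sqrt 2 ^ card I)" by (simp add: ennreal_power)
  also have "ennreal (exp (- 1 * N)) * ennreal (sqrt 2 ^ card I) = ennreal (exp (- N) * sqrt 2 ^ card I)"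
    by (simp add: ennreal_mult)
  finally have 1: "prob {\<theta> \<in> space G. N \<le> (\<Sum>k\<in>I. (\<theta> k)^2 / (4 * \<sigma>^2))} \<le> exp (- N) * sqrt 2 ^ card I"
    by (simp add: emeasure_eq_measure)
  have "sqrt 2 \<le> exp (1/2)"
  proof (rule real_le_lsqrt)
    show "2 \<le> (exp (1/2::real))^2" using exp_ge_add_one_self[of 1] by (simp flip: exp_double)
  qed auto
  then have "sqrt 2 ^ card I \<le> exp (1/2) ^ card I" by (intro power_mono) auto
  also have "\<dots> = exp (N / 2)" unfolding N_def exp_of_nat_mult[symmetric] by simp
  finally have "exp (- N) * sqrt 2 ^ card I \<le> exp (- N) * exp (N / 2)" by (intro mult_left_mono) auto
  also have "\<dots> = exp (- N / 2)" by (simp flip: exp_add)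
  finally have "prob {\<theta> \<in> space G. N \<le> (\<Sum>k\<in>I. (\<theta> k)^2 / (4 * \<sigma>^2))} \<le> exp (- N / 2)" using 1 by linarith
  moreover have "N \<le> (\<Sum>k\<in>I. (\<theta> k)^2 / (4 * \<sigma>^2)) \<longleftrightarrow> 4 * \<sigma>^2 * N \<le> (\<Sum>k\<in>I. (\<theta> k)^2)" for \<theta> :: params
    using sigma_pos by (simp add: pos_le_divide_eq mult_ac flip: sum_divide_distrib)
  ultimately show ?thesis by (simp add: N_def)
qed

end

section \<open>Random initialisation\<close>

lemma borel_measurable_huber [measurable]: "huber h \<in> borel_measurable borel"
  unfolding huber_def[abs_def] by measurable

lemma huber_bounds:
  assumes "0 < h" shows "0 \<le> huber h z" "huber h z \<le> \<bar>z\<bar>"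
proof -
  show "0 \<le> huber h z" using assms by (auto simp: huber_def)
  obtain c where c: "0 \<le> c" "c \<le> 1" "huber h (0 + z) - huber h 0 = c * z" using huber_secant[OF assms] by blast
  have "c * z \<le> c * \<bar>z\<bar>" using c by (intro mult_left_mono) auto
  also have "\<dots> \<le> 1 * \<bar>z\<bar>" using c by (intro mult_right_mono) auto
  finally have "c * z \<le> 1 * \<bar>z\<bar>" .
  then show "huber h z \<le> \<bar>z\<bar>" using c(3) assms by (simp add: huber_def)
qed

locale random_net = net_data +
  fixes \<sigma> :: real
  assumes sigma: "0 < \<sigma>"
begin

lemma card_Ix: "card Ix = 2 * p * (d + 1)" by (simp add: param_idx_def card_cartesian_product)

sublocale gauss_space Ix \<sigma>
proof
  show "finite Ix" by (simp add: param_idx_def)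
  show "Ix \<noteq> {}" using p_pos by (simp add: param_idx_def)
qed (rule sigma)

lemma block_subset: "i \<in> {1..2*p} \<Longrightarrow> {i} \<times> {0..d} \<subseteq> Ix" by (auto simp: param_idx_def)

lemma block_sum: "(\<Sum>k\<in>{i}\<times>{0..d}. f k) = (\<Sum>j=0..d. f (i,j))" for f :: "nat \<times> nat \<Rightarrow> real"
proof -
  have "{i} \<times> {0..d} = (\<lambda>j. (i,j)) ` {0..d}" by auto
  then show ?thesis by (simp add: sum.reindex inj_on_def)
qed

lemma lin_distributed:
  assumes "i \<in> {1..2*p}" "0 < (\<Sum>j=0..d. (c j)^2)"
  shows "distributed G lborel (\<lambda>\<theta>. \<Sum>j=0..d. \<theta> (i,j) * c j) (normal_density 0 (\<sigma> * sqrt (\<Sum>j=0..d. (c j)^2)))"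
  using linear_distributed[OF block_subset[OF assms(1)], of "\<lambda>k. c (snd k)"] assms(2)
  by (simp add: block_sum mult.commute)

lemma pre_distributed:
  assumes "i \<in> {1..2*p}" "s \<in> {1..n}"
  shows "distributed G lborel (\<lambda>\<theta>. pre \<theta> i s) (normal_density 0 (\<sigma> * sqrt 2))"
  using lin_distributed[OF assms(1), of "ext s"] ext_norm[OF assms(2)] by (simp add: pre_def)

lemma pre_measurable: "i \<in> {1..2*p} \<Longrightarrow> (\<lambda>\<theta>. pre \<theta> i s) \<in> borel_measurable G"
  unfolding pre_def by (intro borel_measurable_sum borel_measurable_times coord_measurable) (auto simp: param_idx_def)

lemma pre_add_distributed:
  assumes "i \<in> {1..2*p}" "s \<in> {1..n}" "t \<in> {1..n}"
  shows "distributed G lborel (\<lambda>\<theta>. pre \<theta> i s + pre \<theta> i t) (normal_density 0 (\<sigma> * sqrt (4 + 2 * gram s t)))"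
proof -
  have "(\<Sum>j=0..d. (ext s j + ext t j)^2) = (\<Sum>j=0..d. (ext s j)^2) + (\<Sum>j=0..d. (ext t j)^2) + 2 * gram s t"
    unfolding gram_def by (simp add: power2_sum sum.distrib sum_distrib_left mult.assoc)
  then have eq: "(\<Sum>j=0..d. (ext s j + ext t j)^2) = 4 + 2 * gram s t"
    unfolding ext_norm[OF assms(2)] ext_norm[OF assms(3)] by simp
  have "0 < (\<Sum>j=0..d. (ext s j + ext t j)^2)"
    unfolding eq using gram_bounds[OF assms(2,3)] by simp
  from lin_distributed[OF assms(1) this] show ?thesis
    by (simp only: eq pre_def sum.distrib[symmetric] distrib_left)
qed

lemma pre_diff_second_moment:
  assumes "i \<in> {1..2*p}"
  shows "integrable G (\<lambda>\<theta>. (pre \<theta> i s - pre \<theta> i t)^2)"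
    "expectation (\<lambda>\<theta>. (pre \<theta> i s - pre \<theta> i t)^2) = \<sigma>^2 * (\<Sum>j=0..d. (ext s j - ext t j)^2)"
proof -
  have eq: "pre \<theta> i s - pre \<theta> i t = (\<Sum>k\<in>{i}\<times>{0..d}. (ext s (snd k) - ext t (snd k)) * \<theta> k)" for \<theta>
    by (simp add: block_sum pre_def sum_subtractf[symmetric] algebra_simps)
  show "integrable G (\<lambda>\<theta>. (pre \<theta> i s - pre \<theta> i t)^2)"
    "expectation (\<lambda>\<theta>. (pre \<theta> i s - pre \<theta> i t)^2) = \<sigma>^2 * (\<Sum>j=0..d. (ext s j - ext t j)^2)"
    unfolding eq
    using linear_second_moment[OF block_subset[OF assms], of "\<lambda>k. ext s (snd k) - ext t (snd k)"]
    by (simp_all add: block_sum)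
qed

text \<open>Different neurons read disjoint blocks of parameters. \<open>F\<close> receives the
  preactivations on two examples, so that joint activity is covered as well as events on one
  example.\<close>

lemma neurons_indep:
  fixes F :: "nat \<Rightarrow> real \<Rightarrow> real \<Rightarrow> real"
  assumes F: "\<And>i. (\<lambda>z. F i (fst z) (snd z)) \<in> borel_measurable (borel \<Otimes>\<^sub>M borel)"
  shows "indep_vars (\<lambda>_. borel) (\<lambda>i \<theta>. F i (pre \<theta> i s) (pre \<theta> i t)) {1..2*p}"
proof -
  let ?K = "\<lambda>i. {i} \<times> {0..d}"
  have *: "indep_vars (\<lambda>i. PiM (?K i) (\<lambda>_. borel)) (\<lambda>i \<theta>. restrict (\<lambda>k. \<theta> k) (?K i)) {1..2*p}"
    by (rule indep_vars_restrict[OF coord_indep]) (auto simp: param_idx_def disjoint_family_on_def)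
  have "indep_vars (\<lambda>_. borel) (\<lambda>i \<theta>. (\<lambda>\<omega>. F i (pre \<omega> i s) (pre \<omega> i t)) (restrict (\<lambda>k. \<theta> k) (?K i))) {1..2*p}"
  proof (rule indep_vars_compose2[OF *])
    fix i
    have m: "(\<lambda>\<omega>. pre \<omega> i s) \<in> borel_measurable (PiM (?K i) (\<lambda>_. borel))" for s
      unfolding pre_def by (intro borel_measurable_sum borel_measurable_times measurable_component_singleton) auto
    have "(\<lambda>\<omega>. (pre \<omega> i s, pre \<omega> i t)) \<in> PiM (?K i) (\<lambda>_. borel) \<rightarrow>\<^sub>M borel \<Otimes>\<^sub>M borel"
      by (intro measurable_Pair m)
    from measurable_compose[OF this F[of i]]
    show "(\<lambda>\<omega>. F i (pre \<omega> i s) (pre \<omega> i t)) \<in> borel_measurable (PiM (?K i) (\<lambda>_. borel))" by simp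
  qed
  moreover have "pre (restrict (\<lambda>k. \<theta> k) (?K i)) i s = pre \<theta> i s" for \<theta> i s
    unfolding pre_def by (intro sum.cong) auto
  ultimately show ?thesis by simp
qed

lemma card_neurons: "card {1..2*p} = 2 * p" "finite {1..2*p}" "{1..2*p} \<noteq> {}"
  using p_pos by auto

text \<open>Probability 1/40000 plus an equal Hoeffding deviation. The exponent 2 * 2p * (1/40000)^2
  is p/(4 * 10^8); the sharper bounds of the other events are weakened to this rate.\<close>

lemma near_concentration:
  assumes s: "s \<in> {1..n}" and w: "0 \<le> w" "w / (\<sigma> * sqrt 2) \<le> 1/40000"
  shows "prob {\<theta> \<in> space G. 2 * real p / 20000 \<le> near w \<theta> s} \<le> exp (- (real p / (4 * 10^8)))"
proof -
  have ind: "indep_vars (\<lambda>_. borel) (\<lambda>i \<theta>. of_bool (\<bar>pre \<theta> i s\<bar> \<le> w) :: real) {1..2*p}"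
    by (rule neurons_indep[of "\<lambda>i a b. of_bool (\<bar>a\<bar> \<le> w)"]) (simp add: of_bool_def)
  have m: "Measurable.pred G (\<lambda>\<theta>. \<bar>pre \<theta> i s\<bar> \<le> w)" if "i \<in> {1..2*p}" for i
    using pre_measurable[OF that] by measurable
  have pr: "prob {\<theta> \<in> space G. \<bar>pre \<theta> i s\<bar> \<le> w} \<le> 1/40000" if "i \<in> {1..2*p}" for i
    by (rule order_trans[OF normal_abs_le[OF _ pre_distributed[OF that s] w(1)] w(2)]) (use sigma in simp)
  have "prob {\<theta> \<in> space G. real (2 * p) * (1/40000 + 1/40000) \<le> (\<Sum>i=1..2*p. of_bool (\<bar>pre \<theta> i s\<bar> \<le> w))}
     \<le> exp (- 2 * real (2 * p) * (1/40000)^2)"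
    using hoeffding_frequency(1)[OF card_neurons(2,3) ind m _ pr, of "1/40000"] unfolding card_neurons(1) by simp
  then show ?thesis unfolding near_def by (simp add: power_divide)
qed

lemma both_pred:
  assumes "i \<in> {1..2*p}"
  shows "Measurable.pred G (\<lambda>\<theta>. 0 < pre \<theta> i s \<and> 0 < pre \<theta> i t)"
  using pre_measurable[OF assms, of s] pre_measurable[OF assms, of t] by measurable

lemma both_indep: "indep_vars (\<lambda>_. borel) (\<lambda>i \<theta>. of_bool (0 < pre \<theta> i s \<and> 0 < pre \<theta> i t) :: real) {1..2*p}"
  by (rule neurons_indep[of "\<lambda>i a b. of_bool (0 < a \<and> 0 < b)"]) (simp add: of_bool_def)

text \<open>For orthogonal inputs \<open>gram\<close> is 1, and the sum of the two preactivations
  has 3 times the variance of one of them. The ratio sqrt 3 is rounded up to 17321/10000, which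
  leaves room for 3/10^6. The Hoeffding deviation 1/2000 reduces the deficit 1/200 to
  9/2000.\<close>

lemma both_concentration_opposite:
  assumes s: "s \<in> {1..n}" and t: "t \<in> {1..n}" and g: "gram s t \<le> 1 + 3/10^6"
  shows "prob {\<theta> \<in> space G. 2 * real p * (1/2 - 9/2000) \<le> both \<theta> s t} \<le> exp (- (real p / (4 * 10^8)))"
proof -
  have pr: "prob {\<theta> \<in> space G. 0 < pre \<theta> i s \<and> 0 < pre \<theta> i t} \<le> 1/2 - 1/200" if i: "i \<in> {1..2*p}" for i
  proof (rule normal_opposite_signs[OF _ _ pre_distributed[OF i s] pre_distributed[OF i t] pre_add_distributed[OF i s t]])
    have "sqrt (4 + 2 * gram s t) \<le> sqrt ((17321/10000)^2 * 2)"
      using g by (intro real_sqrt_le_mono) (simp add: power2_eq_square)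
    then have "sqrt (4 + 2 * gram s t) \<le> 17321/10000 * sqrt 2" by (simp add: real_sqrt_mult)
    then have "\<sigma> * sqrt (4 + 2 * gram s t) \<le> \<sigma> * (17321/10000 * sqrt 2)" using sigma by (intro mult_left_mono) auto
    then show "\<sigma> * sqrt (4 + 2 * gram s t) \<le> 17321/10000 * (\<sigma> * sqrt 2)" by (simp add: mult_ac)
  qed (use sigma gram_bounds[OF s t] in auto)
  have "prob {\<theta> \<in> space G. real (2 * p) * ((1/2 - 1/200) + 1/2000) \<le> (\<Sum>i=1..2*p. of_bool (0 < pre \<theta> i s \<and> 0 < pre \<theta> i t))}
     \<le> exp (- 2 * real (2 * p) * (1/2000)^2)"
    using hoeffding_frequency(1)[OF card_neurons(2,3) both_indep both_pred _ pr, of "1/2000"] unfolding card_neurons(1) by simp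
  also have "\<dots> \<le> exp (- (real p / (4 * 10^8)))" by (simp add: power2_eq_square)
  finally show ?thesis unfolding both_def by simp
qed

text \<open>With the window \<sigma>/4000, the window and the Chebyshev term cost at most 1/4000
  each; the deviation 1/2000 brings the total to 1/1000.\<close>

lemma both_concentration_same:
  assumes s: "s \<in> {1..n}" and t: "t \<in> {1..n}" and g: "(\<Sum>j=0..d. (ext s j - ext t j)^2) \<le> 4/10^12"
  shows "prob {\<theta> \<in> space G. both \<theta> s t \<le> 2 * real p * (1/2 - 1/1000)} \<le> exp (- (real p / (4 * 10^8)))"
proof -
  have pr: "1/2 - 1/2000 \<le> prob {\<theta> \<in> space G. 0 < pre \<theta> i s \<and> 0 < pre \<theta> i t}" if i: "i \<in> {1..2*p}" for i
  proof -
    have w: "0 < \<sigma> / 4000" using sigma by simp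
    have sd: "0 < \<sigma> * sqrt 2" using sigma by simp
    have "\<sigma> / 4000 / (\<sigma> * sqrt 2) = 1 / (4000 * sqrt 2)" using sigma by simp
    also have "\<dots> \<le> 1 / (4000 * 1)" by (intro divide_left_mono mult_left_mono) auto
    finally have 1: "\<sigma> / 4000 / (\<sigma> * sqrt 2) \<le> 1/4000" by simp
    have "expectation (\<lambda>\<theta>. (pre \<theta> i s - pre \<theta> i t)^2) / (\<sigma> / 4000)^2 =
        (\<Sum>j=0..d. (ext s j - ext t j)^2) * 4000^2"
      unfolding pre_diff_second_moment(2)[OF i] using sigma by (simp add: power_divide)
    also have "\<dots> \<le> (4/10^12) * 4000^2" using g by (intro mult_right_mono) auto
    finally have 2: "expectation (\<lambda>\<theta>. (pre \<theta> i s - pre \<theta> i t)^2) / (\<sigma> / 4000)^2 \<le> 1/4000" by simp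
    show ?thesis
      using normal_same_signs[OF sd w pre_distributed[OF i s] pre_measurable[OF i] pre_diff_second_moment(1)[OF i], of t] 1 2
      by linarith
  qed
  have "prob {\<theta> \<in> space G. (\<Sum>i=1..2*p. of_bool (0 < pre \<theta> i s \<and> 0 < pre \<theta> i t)) \<le> real (2 * p) * ((1/2 - 1/2000) - 1/2000)}
     \<le> exp (- 2 * real (2 * p) * (1/2000)^2)"
    using hoeffding_frequency(2)[OF card_neurons(2,3) both_indep both_pred _ pr, of "1/2000"] unfolding card_neurons(1) by simp
  also have "\<dots> \<le> exp (- (real p / (4 * 10^8)))" by (simp add: power2_eq_square)
  finally show ?thesis unfolding both_def by simp
qed

text \<open>The balanced output weights make the expected initial output vanish, so the mean of a
  single activation is never computed.\<close>

lemma sum_outw: "(\<Sum>i=1..2*p. outw p i) = 0"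
proof -
  have "(\<Sum>i=1..2*p. outw p i) = (\<Sum>i=1..p. outw p i) + (\<Sum>i=p+1..2*p. outw p i)"
    using sum.ub_add_nat[of 1 p "outw p" p] by (simp add: mult_2)
  also have "(\<Sum>i=1..p. outw p i) = real p" by (simp add: outw_def)
  also have "(\<Sum>i=p+1..2*p. outw p i) = (\<Sum>i=p+1..2*p. -1)" by (intro sum.cong) (auto simp: outw_def)
  also have "\<dots> = - real p" by simp
  finally show ?thesis by simp
qed

lemma net_measurable [measurable]: "(\<lambda>\<theta>. net d p h \<theta> (x s)) \<in> borel_measurable G"
  unfolding net_eq
  by (intro borel_measurable_sum borel_measurable_times measurable_compose[OF pre_measurable borel_measurable_huber]) auto

text \<open>Hoeffding's inequality is applied to the activations truncated at \<open>T\<close>.\<close>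

lemma init_output_concentration:
  assumes s: "s \<in> {1..n}" and T: "0 < T" and e: "0 < e"
  shows "prob {\<theta> \<in> space G. e \<le> \<bar>net d p h \<theta> (x s)\<bar>} \<le>
    2 * exp (- (e^2 / (4 * real p * T^2))) + 4 * real p * exp (- (T^2 / (8 * \<sigma>^2)))"
proof -
  define X where "X = (\<lambda>i \<theta>. outw p i * min (huber h (pre \<theta> i s)) T)"
  have ind: "indep_vars (\<lambda>_. borel) X {1..2*p}"
    unfolding X_def by (rule neurons_indep[of "\<lambda>i a b. outw p i * min (huber h a) T"]) simp
  have rng: "X i \<theta> \<in> {-T..T}" for i \<theta>
  proof -
    have "\<bar>X i \<theta>\<bar> \<le> T" unfolding X_def abs_mult abs_outw using huber_bounds(1)[OF h_pos] T by simp
    then show ?thesis by (auto simp: abs_le_iff)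
  qed
  define mu where "mu = (\<Sum>i=1..2*p. expectation (X i))"
  interpret H: Hoeffding_ineq G "{1..2*p}" X "\<lambda>_. - T" "\<lambda>_. T" mu
    by unfold_locales (use ind rng in \<open>auto simp: mu_def\<close>)
  \<comment> \<open>All preactivations on \<open>s\<close> have the same law, so the expectations
    differ only by the sign \<open>outw p i\<close> and cancel.\<close>
  have "expectation (X i) = outw p i * (\<integral>z. normal_density 0 (\<sigma> * sqrt 2) z * min (huber h z) T \<partial>lborel)"
    if "i \<in> {1..2*p}" for i
    unfolding X_def using distributed_integral[OF pre_distributed[OF that s], of "\<lambda>z. min (huber h z) T"] by simp
  then have "mu = (\<Sum>i=1..2*p. outw p i * (\<integral>z. normal_density 0 (\<sigma> * sqrt 2) z * min (huber h z) T \<partial>lborel))"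
    unfolding mu_def by (intro sum.cong) auto
  then have mu0: "mu = 0" by (simp only: sum_distrib_right[symmetric] sum_outw mult_zero_left)
  have sm: "(\<Sum>i=1..2*p. (T - - T)^2) = 8 * real p * T^2" by (simp add: power2_eq_square)
  have pos: "0 < (\<Sum>i=1..2*p. (T - - T)^2)" unfolding sm using T p_pos by simp
  let ?Z = "{\<theta> \<in> space G. e \<le> \<bar>(\<Sum>i=1..2*p. X i \<theta>) - mu\<bar>}"
  let ?B = "\<lambda>i. {\<theta> \<in> space G. T < \<bar>pre \<theta> i s\<bar>}"
  have B0: "prob ?Z \<le> 2 * exp (- (e^2 / (4 * real p * T^2)))"
    using H.Hoeffding_ineq_abs_ge[of e] e pos unfolding sm by (simp add: mult_ac)
  have Bi: "prob (?B i) \<le> 2 * exp (- (T^2 / (8 * \<sigma>^2)))" if "i \<in> {1..2*p}" for i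
    using normal_tail[OF _ pre_distributed[OF that s], of T] T sigma by (simp add: power_mult_distrib mult_ac)
  have Bm: "?B i \<in> sets G" if "i \<in> {1..2*p}" for i
    using pre_measurable[OF that, of s] by measurable
  have Xm: "(\<lambda>\<theta>. \<Sum>i=1..2*p. X i \<theta>) \<in> borel_measurable G" by (intro borel_measurable_sum H.random_variable)
  have B0m: "?Z \<in> sets G" using Xm by measurable
  have "{\<theta> \<in> space G. e \<le> \<bar>net d p h \<theta> (x s)\<bar>} \<subseteq> ?Z \<union> (\<Union>i\<in>{1..2*p}. ?B i)"
  proof
    fix \<theta> assume th: "\<theta> \<in> {\<theta> \<in> space G. e \<le> \<bar>net d p h \<theta> (x s)\<bar>}"
    show "\<theta> \<in> ?Z \<union> (\<Union>i\<in>{1..2*p}. ?B i)"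
    proof (cases "\<exists>i\<in>{1..2*p}. T < \<bar>pre \<theta> i s\<bar>")
      case False
      have "X i \<theta> = outw p i * huber h (pre \<theta> i s)" if "i \<in> {1..2*p}" for i
      proof -
        have "\<not> T < \<bar>pre \<theta> i s\<bar>" using False that by blast
        then have "huber h (pre \<theta> i s) \<le> T" using huber_bounds(2)[OF h_pos, of "pre \<theta> i s"] by linarith
        then show ?thesis by (simp add: X_def)
      qed
      then have "(\<Sum>i=1..2*p. X i \<theta>) = net d p h \<theta> (x s)" unfolding net_eq by (intro sum.cong) auto
      then show ?thesis using th mu0 by simp
    qed (use th in auto)
  qed
  then have "prob {\<theta> \<in> space G. e \<le> \<bar>net d p h \<theta> (x s)\<bar>} \<le> prob (?Z \<union> (\<Union>i\<in>{1..2*p}. ?B i))"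
    using B0m Bm by (intro finite_measure_mono sets.Un sets.finite_UN) auto
  also have "\<dots> \<le> prob ?Z + prob (\<Union>i\<in>{1..2*p}. ?B i)"
    using B0m Bm by (intro measure_Un_le sets.finite_UN) auto
  finally have 1: "prob {\<theta> \<in> space G. e \<le> \<bar>net d p h \<theta> (x s)\<bar>} \<le> prob ?Z + prob (\<Union>i\<in>{1..2*p}. ?B i)" .
  have "prob (\<Union>i\<in>{1..2*p}. ?B i) \<le> (\<Sum>i=1..2*p. prob (?B i))"
    using Bm by (intro finite_measure_subadditive_finite) auto
  also have "\<dots> \<le> (\<Sum>i=1..2*p. 2 * exp (- (T^2 / (8 * \<sigma>^2))))" by (intro sum_mono Bi)
  also have "\<dots> = 4 * real p * exp (- (T^2 / (8 * \<sigma>^2)))" by simp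
  finally show ?thesis using 1 B0 by linarith
qed

section \<open>The event of a good initialisation\<close>

text \<open>Everything the deterministic analysis requires from the initial parameters: the
  hypotheses of \<open>cluster_margin\<close> and a norm bound.\<close>

definition good :: "real \<Rightarrow> params \<Rightarrow> bool" where
  "good w \<theta> \<longleftrightarrow> (\<forall>s\<in>{1..n}. \<bar>net d p h \<theta> (x s)\<bar> \<le> 1/10000 \<and> near w \<theta> s \<le> 2 * real p / 20000) \<and>
     (\<forall>s\<in>{1..n}. \<forall>t\<in>{1..n}.
        ((\<Sum>j=0..d. (ext s j - ext t j)^2) \<le> 4/10^12 \<longrightarrow> 2 * real p * (1/2 - 1/1000) \<le> both \<theta> s t) \<and>
        (gram s t \<le> 1 + 3/10^6 \<longrightarrow> both \<theta> s t \<le> 2 * real p * (1/2 - 9/2000))) \<and>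
     nrm2 \<theta> \<le> 4 * \<sigma>^2 * real (card Ix)"

text \<open>Union bound with a common rate \<open>q\<close>. An example accounts for 2 + 4p failure
  terms from its output, one from \<open>near\<close> and two per partner; the norm adds one more,
  and 12 * p * n^2 is a crude total. The conclusion provides a measurable set inside the good
  initialisations, the form in which the theorem asks for an event.\<close>

lemma good_event:
  assumes T: "0 < T" and w: "0 \<le> w" "w / (\<sigma> * sqrt 2) \<le> 1/40000"
    and q: "exp (- ((1/10000)^2 / (4 * real p * T^2))) \<le> q" "exp (- (T^2 / (8 * \<sigma>^2))) \<le> q"
      "exp (- (real p / (4 * 10^8))) \<le> q"
  shows "\<exists>A\<in>sets G. A \<subseteq> {\<theta> \<in> space G. good w \<theta>} \<and> 1 - 12 * real p * (real n)^2 * q \<le> measure G A"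
proof -
  have q0: "0 < q" using q(3) exp_gt_zero by (rule less_le_trans[rotated])
  define Bf where "Bf = (\<lambda>s. {\<theta> \<in> space G. 1/10000 \<le> \<bar>net d p h \<theta> (x s)\<bar>})"
  define Bn where "Bn = (\<lambda>s. {\<theta> \<in> space G. 2 * real p / 20000 \<le> near w \<theta> s})"
  define Bs where "Bs = (\<lambda>s t. if (\<Sum>j=0..d. (ext s j - ext t j)^2) \<le> 4/10^12
      then {\<theta> \<in> space G. both \<theta> s t \<le> 2 * real p * (1/2 - 1/1000)} else {})"
  define Bo where "Bo = (\<lambda>s t. if gram s t \<le> 1 + 3/10^6
      then {\<theta> \<in> space G. 2 * real p * (1/2 - 9/2000) \<le> both \<theta> s t} else {})"
  define Bc where "Bc = {\<theta> \<in> space G. 4 * \<sigma>^2 * real (card Ix) \<le> nrm2 \<theta>}"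
  define C where "C = (\<lambda>s. Bf s \<union> Bn s \<union> (\<Union>t\<in>{1..n}. Bs s t \<union> Bo s t))"
  have both_m: "(\<lambda>\<theta>. both \<theta> s t) \<in> borel_measurable G" for s t
    unfolding both_def of_bool_def
    by (intro borel_measurable_sum measurable_If borel_measurable_const both_pred[unfolded pred_def]) auto
  have near_m: "(\<lambda>\<theta>. near w \<theta> s) \<in> borel_measurable G" for s
  proof -
    have "Measurable.pred G (\<lambda>\<theta>. \<bar>pre \<theta> i s\<bar> \<le> w)" if "i \<in> {1..2*p}" for i
      using pre_measurable[OF that, of s] by measurable
    then show ?thesis unfolding near_def of_bool_def
      by (intro borel_measurable_sum measurable_If borel_measurable_const) (auto simp: pred_def)
  qed
  have nrm_m: "nrm2 \<in> borel_measurable G"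
    unfolding nrm2_def[abs_def] by (intro borel_measurable_sum borel_measurable_power coord_measurable)
  have m: "Bf s \<in> sets G" "Bn s \<in> sets G" "Bs s t \<in> sets G" "Bo s t \<in> sets G" "Bc \<in> sets G" for s t
    unfolding Bf_def Bn_def Bs_def Bo_def Bc_def using both_m[of s t] near_m[of s] nrm_m by (auto, measurable)
  have Cm: "C s \<in> sets G" for s unfolding C_def using m by (intro sets.Un sets.finite_UN) auto
  have pf: "prob (Bf s) \<le> 2 * q + 4 * real p * q" if "s \<in> {1..n}" for s
  proof -
    have "prob (Bf s) \<le> 2 * exp (- ((1/10000)^2 / (4 * real p * T^2))) + 4 * real p * exp (- (T^2 / (8 * \<sigma>^2)))"
      unfolding Bf_def by (rule init_output_concentration[OF that T]) simp
    also have "\<dots> \<le> 2 * q + 4 * real p * q" using q by (intro add_mono mult_left_mono) auto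
    finally show ?thesis .
  qed
  have pn: "prob (Bn s) \<le> q" if "s \<in> {1..n}" for s
    unfolding Bn_def using near_concentration[OF that w] q(3) by linarith
  have ps: "prob (Bs s t) \<le> q" if "s \<in> {1..n}" "t \<in> {1..n}" for s t
    unfolding Bs_def using both_concentration_same[OF that] q(3) q0 by auto
  have po: "prob (Bo s t) \<le> q" if "s \<in> {1..n}" "t \<in> {1..n}" for s t
    unfolding Bo_def using both_concentration_opposite[OF that] q(3) q0 by auto
  have pc: "prob Bc \<le> q"
  proof -
    have "prob Bc \<le> exp (- real (card Ix) / 2)" unfolding Bc_def nrm2_def by (rule square_sum_tail)
    also have "\<dots> \<le> exp (- (real p / (4 * 10^8)))"
    proof -
      have "real p / (4 * 10^8) \<le> real p * 1" by simp
      also have "\<dots> \<le> real p * (real d + 1)" by (intro mult_left_mono) auto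
      also have "\<dots> = real (card Ix) / 2" unfolding card_Ix by (simp add: algebra_simps)
      finally show ?thesis by simp
    qed
    finally show ?thesis using q(3) by linarith
  qed
  have pC: "prob (C s) \<le> (3 + 4 * real p + 2 * real n) * q" if s: "s \<in> {1..n}" for s
  proof -
    have "prob (C s) \<le> prob (Bf s \<union> Bn s) + prob (\<Union>t\<in>{1..n}. Bs s t \<union> Bo s t)"
      unfolding C_def using m by (intro measure_Un_le sets.Un sets.finite_UN) auto
    moreover have "prob (Bf s \<union> Bn s) \<le> prob (Bf s) + prob (Bn s)" using m by (intro measure_Un_le)
    moreover have "prob (\<Union>t\<in>{1..n}. Bs s t \<union> Bo s t) \<le> (\<Sum>t=1..n. prob (Bs s t \<union> Bo s t))"
      using m by (intro finite_measure_subadditive_finite) auto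
    moreover have "(\<Sum>t=1..n. prob (Bs s t \<union> Bo s t)) \<le> (\<Sum>t=1..n. 2 * q)"
    proof (rule sum_mono)
      fix t assume t: "t \<in> {1..n}"
      have "prob (Bs s t \<union> Bo s t) \<le> prob (Bs s t) + prob (Bo s t)" using m by (intro measure_Un_le)
      then show "prob (Bs s t \<union> Bo s t) \<le> 2 * q" using ps[OF s t] po[OF s t] by linarith
    qed
    ultimately have "prob (C s) \<le> (2 * q + 4 * real p * q) + q + real n * (2 * q)"
      using pf[OF s] pn[OF s] by simp
    then show ?thesis by (simp add: algebra_simps)
  qed
  define B where "B = (\<Union>s\<in>{1..n}. C s) \<union> Bc"
  have Bm: "B \<in> sets G" unfolding B_def using Cm m by (intro sets.Un sets.finite_UN) auto
  have "prob B \<le> prob (\<Union>s\<in>{1..n}. C s) + prob Bc"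
    unfolding B_def using Cm m by (intro measure_Un_le sets.finite_UN) auto
  also have "prob (\<Union>s\<in>{1..n}. C s) \<le> (\<Sum>s=1..n. prob (C s))"
    using Cm by (intro finite_measure_subadditive_finite) auto
  also have "\<dots> \<le> (\<Sum>s=1..n. (3 + 4 * real p + 2 * real n) * q)" by (intro sum_mono pC)
  finally have "prob B \<le> real n * ((3 + 4 * real p + 2 * real n) * q) + q" using pc by simp
  also have "\<dots> = (3 * real n + 4 * (real p * real n) + 2 * (real n * real n) + 1) * q" by (simp add: algebra_simps)
  also have "\<dots> \<le> (12 * (real p * (real n * real n))) * q"
  proof (intro mult_right_mono)
    have n1: "1 \<le> real n" and p1: "1 \<le> real p" using n_pos p_pos by auto
    have nn: "real n \<le> real n * real n" using n1 by (simp add: mult_le_cancel_left1)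
    have "real n * real n \<le> real p * (real n * real n)" using p1 n1 by (simp add: mult_le_cancel_right1)
    moreover have "real p * real n \<le> real p * (real n * real n)" using nn by (intro mult_left_mono) auto
    ultimately show "3 * real n + 4 * (real p * real n) + 2 * (real n * real n) + 1 \<le> 12 * (real p * (real n * real n))"
      using nn n1 by linarith
  qed (use q0 in simp)
  finally have pB: "prob B \<le> 12 * real p * (real n)^2 * q" by (simp add: power2_eq_square)
  have "space G - B \<subseteq> {\<theta> \<in> space G. good w \<theta>}"
  proof
    fix \<theta> assume th: "\<theta> \<in> space G - B"
    then have nC: "\<theta> \<notin> C s" if "s \<in> {1..n}" for s using that by (auto simp: B_def)
    have nc: "\<theta> \<notin> Bc" using th by (simp add: B_def)
    have "good w \<theta>" unfolding good_def
    proof (intro conjI ballI impI)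
      fix s assume s: "s \<in> {1..n}"
      show "\<bar>net d p h \<theta> (x s)\<bar> \<le> 1/10000" "near w \<theta> s \<le> 2 * real p / 20000"
        using nC[OF s] th unfolding C_def Bf_def Bn_def by (simp_all add: not_le)
      fix t assume t: "t \<in> {1..n}"
      have st: "\<theta> \<notin> Bs s t" "\<theta> \<notin> Bo s t" using nC[OF s] t unfolding C_def by blast+
      show "2 * real p * (1/2 - 1/1000) \<le> both \<theta> s t" if "(\<Sum>j=0..d. (ext s j - ext t j)^2) \<le> 4/10^12"
        using st(1) th that unfolding Bs_def by (simp add: not_le)
      show "both \<theta> s t \<le> 2 * real p * (1/2 - 9/2000)" if "gram s t \<le> 1 + 3/10^6"
        using st(2) th that unfolding Bo_def by (simp add: not_le)
    next
      show "nrm2 \<theta> \<le> 4 * \<sigma>^2 * real (card Ix)" using nc th unfolding Bc_def by (simp add: not_le)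
    qed
    then show "\<theta> \<in> {\<theta> \<in> space G. good w \<theta>}" using th by simp
  qed
  moreover have "measure G (space G - B) = 1 - prob B" using Bm by (rule prob_compl)
  ultimately show ?thesis using pB Bm by (intro bexI[of _ "space G - B"]) auto
qed

end

section \<open>Sufficiently wide networks\<close>

text \<open>In order, beyond z >= 1: the union bound is beaten; the band 2a + h is narrow relative
  to \<sigma>, since a/\<sigma> and h/\<sigma> are negative powers of the width; the first step
  yields lam >= 100; and ln n is at most lam/16, where 32000 = 16 * 2000.\<close>

lemma large_width:
  fixes \<beta> :: real
  assumes "0 < \<beta>" "\<beta> < 1/2"
  shows "\<exists>P. \<forall>z\<ge>P. 1 \<le> z \<and> ln (12 * z) + 2 * z powr (\<beta>/8) \<le> z powr (\<beta>/4) / (4 * 10^8) \<and>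
    (2 * z powr (- (1/2 + \<beta>)) + 1 / z) / (z powr (- (1/2 + \<beta>/2)) * sqrt 2) \<le> 1/40000 \<and>
    200000 \<le> z powr (1/2 - \<beta>) \<and> 32000 * z powr ((1/2 - \<beta>) / 2) \<le> z powr (1/2 - \<beta>)"
proof -
  define c where "c = 1/2 - \<beta>"
  have c: "0 < c" using assms by (simp add: c_def)
  have 1: "eventually (\<lambda>z::real. 1 \<le> z) at_top" by (rule eventually_ge_at_top)
  have 2: "eventually (\<lambda>z::real. ln (12 * z) + 2 * z powr (\<beta>/8) \<le> z powr (\<beta>/4) / (4 * 10^8)) at_top"
    using assms(1) by real_asymp
  have 3: "eventually (\<lambda>z::real. (2 * z powr (- (1/2 + \<beta>)) + 1 / z) / (z powr (- (1/2 + \<beta>/2)) * sqrt 2) \<le> 1/40000) at_top"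
  proof -
    have "((\<lambda>z::real. 2 * z powr (- (\<beta>/2)) + z powr (-1/2 + \<beta>/2)) \<longlongrightarrow> 0) at_top"
    proof -
      have "((\<lambda>z::real. z powr (- (\<beta>/2))) \<longlongrightarrow> 0) at_top" "((\<lambda>z::real. z powr (-1/2 + \<beta>/2)) \<longlongrightarrow> 0) at_top"
        using assms by (auto intro!: tendsto_neg_powr filterlim_ident)
      from tendsto_add[OF tendsto_mult_right[OF this(1), of 2] this(2)] show ?thesis by (simp add: mult.commute)
    qed
    then have "eventually (\<lambda>z::real. 2 * z powr (- (\<beta>/2)) + z powr (-1/2 + \<beta>/2) < 1/40000) at_top"
      by (rule order_tendstoD) simp
    then show ?thesis using eventually_gt_at_top[of 0]
    proof eventually_elim
      case (elim z)
      have "(2 * z powr (- (1/2 + \<beta>)) + 1 / z) / z powr (- (1/2 + \<beta>/2)) = 2 * z powr (- (\<beta>/2)) + z powr (-1/2 + \<beta>/2)"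
      proof -
        have "z powr (- (1/2 + \<beta>)) / z powr (- (1/2 + \<beta>/2)) = z powr (- (\<beta>/2))"
          by (simp add: powr_diff[symmetric] field_simps)
        moreover have "1 / z / z powr (- (1/2 + \<beta>/2)) = z powr (-1/2 + \<beta>/2)"
        proof -
          have "1 / z = z powr (-1)" using elim by (simp add: powr_minus_divide)
          then have "1 / z / z powr (- (1/2 + \<beta>/2)) = z powr (-1 - (- (1/2 + \<beta>/2)))"
            by (simp only: powr_diff)
          also have "-1 - (- (1/2 + \<beta>/2)) = -1/2 + \<beta>/2" by (simp add: field_simps)
          finally show ?thesis .
        qed
        ultimately show ?thesis by (simp add: add_divide_distrib)
      qed
      then have "(2 * z powr (- (1/2 + \<beta>)) + 1 / z) / z powr (- (1/2 + \<beta>/2)) < 1/40000" using elim by simp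
      moreover have "(2 * z powr (- (1/2 + \<beta>)) + 1 / z) / (z powr (- (1/2 + \<beta>/2)) * sqrt 2)
         \<le> (2 * z powr (- (1/2 + \<beta>)) + 1 / z) / (z powr (- (1/2 + \<beta>/2)) * 1)"
        using elim by (intro divide_left_mono mult_left_mono) auto
      ultimately show ?case by (simp only: mult_1_right)
    qed
  qed
  have 4: "eventually (\<lambda>z::real. 200000 \<le> z powr c) at_top" using c by real_asymp
  have 5: "eventually (\<lambda>z::real. 32000 * z powr (c / 2) \<le> z powr c) at_top" using c by real_asymp
  show ?thesis
    using eventually_conj[OF 1 eventually_conj[OF 2 eventually_conj[OF 3 eventually_conj[OF 4 5]]]]
    unfolding eventually_at_top_linorder c_def .
qed

context random_net
begin

text \<open>The truncation level T = \<sigma> * p^(\<beta>/8) serves both terms of the output bound: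
  T^2/\<sigma>^2 = p^(\<beta>/4) controls the tails, and p * T^2 = p^(-3\<beta>/4) makes the
  Hoeffding exponent large.\<close>

lemma gauss_good_event:
  fixes \<beta> :: real
  assumes sg: "\<sigma> = real p powr (- (1/2 + \<beta>/2))" and b: "0 < \<beta>" "\<beta> < 1/2"
    and w: "0 \<le> w" "w / (\<sigma> * sqrt 2) \<le> 1/40000"
  shows "\<exists>A\<in>sets G. A \<subseteq> {\<theta> \<in> space G. good w \<theta>} \<and>
    1 - 12 * real p * (real n)^2 * exp (- (real p powr (\<beta>/4) / (4 * 10^8))) \<le> measure G A"
proof -
  define T where "T = \<sigma> * real p powr (\<beta>/8)"
  have p1: "1 \<le> real p" using p_pos by simp
  have T: "0 < T" unfolding T_def using sigma p_pos by simp
  have T2: "T^2 = \<sigma>^2 * real p powr (\<beta>/4)"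
    unfolding T_def power_mult_distrib by (simp add: power2_eq_square flip: powr_add)
  have s2: "\<sigma>^2 = real p powr (- (1 + \<beta>))"
    unfolding sg by (simp add: power2_eq_square flip: powr_add)
  have pw: "real p powr (\<beta>/4) \<le> real p powr (3 * \<beta>/4)" "real p powr (\<beta>/4) \<le> real p"
    using p1 b powr_mono[of "\<beta>/4" 1 "real p"] by (auto intro!: powr_mono)
  have "real p * T^2 = real p powr 1 * (real p powr (- (1 + \<beta>)) * real p powr (\<beta>/4))"
    unfolding T2 s2 using p1 by simp
  also have "\<dots> = real p powr (1 + (- (1 + \<beta>) + \<beta>/4))" by (simp only: powr_add)
  also have "1 + (- (1 + \<beta>) + \<beta>/4) = - (3 * \<beta>/4)" by simp
  finally have pT: "real p * T^2 = real p powr (- (3 * \<beta>/4))" .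
  show ?thesis
  proof (rule good_event[OF T w])
    have "(1/10000)^2 / (4 * real p * T^2) = real p powr (3 * \<beta>/4) / (4 * 10^8)"
      unfolding mult.assoc pT by (simp add: powr_minus divide_simps)
    then show "exp (- ((1/10000)^2 / (4 * real p * T^2))) \<le> exp (- (real p powr (\<beta>/4) / (4 * 10^8)))"
      using pw(1) by simp
    have T8: "T^2 / (8 * \<sigma>^2) = real p powr (\<beta>/4) / 8" unfolding T2 using sigma by simp
    show "exp (- (T^2 / (8 * \<sigma>^2))) \<le> exp (- (real p powr (\<beta>/4) / (4 * 10^8)))" unfolding T8 by simp
    show "exp (- (real p / (4 * 10^8))) \<le> exp (- (real p powr (\<beta>/4) / (4 * 10^8)))" using pw(2) by simp
  qed
qed

section \<open>Deterministic consequences of a good initialisation\<close>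

context
  fixes \<beta> a :: real and K :: "nat \<Rightarrow> nat set" and \<mu> :: "nat \<Rightarrow> nat \<Rightarrow> real" and \<epsilon> r \<Delta> :: real and \<theta> :: params
  assumes b: "0 < \<beta>" "\<beta> < 1/2"
    and sg: "\<sigma> = real p powr (- (1/2 + \<beta>/2))" and a_eq: "a = real p powr (- (1/2 + \<beta>))"
    and cl: "cluster_assms d n x y K \<mu> \<epsilon> r \<Delta>"
    and small: "\<Delta> < 1/10^6" "r < 1/10^6" "\<epsilon> < 1/10^6"
    and good: "good (2 * a + h) \<theta>"
    and large: "200000 \<le> real p powr (1/2 - \<beta>)"
begin

lemma loss_after_first_step: "L (gd_step Ix L a \<theta>) \<le> exp (- (real p powr (1/2 - \<beta>) / 2000))"
proof (rule loss_le_exp)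
  fix s assume s: "s \<in> {1..n}"
  have "a * real p = real p powr (- (1/2 + \<beta>)) * real p powr 1" using p_pos by (simp add: a_eq)
  also have "\<dots> = real p powr (- (1/2 + \<beta>) + 1)" by (simp only: powr_add)
  also have "- (1/2 + \<beta>) + 1 = 1/2 - \<beta>" by simp
  finally have ap: "a * real p = real p powr (1/2 - \<beta>)" .
  have "a * real p / 1000 - 1/10000 \<le> marg (gd_step Ix L a \<theta>) s"
    by (rule cluster_margin[OF cl small _ _ _ _ _ s])
      (use good in \<open>auto simp: good_def a_eq\<close>)
  then show "real p powr (1/2 - \<beta>) / 2000 \<le> marg (gd_step Ix L a \<theta>) s" using ap large by simp
qed

text \<open>The constant is 2 * 16 + 2 * 4. The initial squared norm is of order p * d * \<sigma>^2
  = d * p^(-\<beta>), and the step adds only order p * a^2 = p^(-2\<beta>).\<close>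

lemma norm_after_first_step: "nrm2 (gd_step Ix L a \<theta>) \<le> 40 * real d * real p powr (- \<beta>)"
proof -
  have p1: "1 \<le> real p" using p_pos by simp
  have d1: "1 \<le> real d"
  proof (cases "d = 0")
    case True
    then show ?thesis using unit[of 1] n_pos by simp
  qed simp
  have a0: "0 \<le> a" by (simp add: a_eq)
  have N: "(nrm \<theta>)^2 = nrm2 \<theta>" for \<theta> by (simp add: nrm_def nrm2_def sum_nonneg)
  have N0: "0 \<le> nrm \<theta>" for \<theta> by (simp add: nrm_def nrm2_def sum_nonneg)
  have g: "a * sqrt (grad2 \<theta>) \<le> a * (2 * sqrt (real p))"
    using a0 sqrt_grad2_le[of \<theta>] mwt_le_1[of \<theta>] mult_left_mono[OF mwt_le_1[of \<theta>], of "2 * sqrt (real p)"]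
    by (intro mult_left_mono) auto
  have "nrm2 (gd_step Ix L a \<theta>) \<le> (nrm \<theta> + a * (2 * sqrt (real p)))^2"
    unfolding N[symmetric] using nrm_step[OF a0, of \<theta>] g N0 by (intro power_mono) auto
  also have "\<dots> \<le> 2 * nrm2 \<theta> + 2 * (a * (2 * sqrt (real p)))^2"
    unfolding N[symmetric] using sum_squares_bound[of "nrm \<theta>" "a * (2 * sqrt (real p))"]
    by (simp add: power2_sum)
  also have "nrm2 \<theta> \<le> 16 * real d * real p powr (- \<beta>)"
  proof -
    have "nrm2 \<theta> \<le> 4 * \<sigma>^2 * real (card Ix)" using good by (simp add: good_def)
    also have "\<dots> = 8 * (real p * \<sigma>^2) * (real d + 1)" unfolding card_Ix by (simp add: algebra_simps)
    also have "real p * \<sigma>^2 = real p powr 1 * (real p powr (- (1/2 + \<beta>/2)) * real p powr (- (1/2 + \<beta>/2)))"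
      unfolding sg power2_eq_square using p1 by simp
    also have "\<dots> = real p powr (1 + (- (1/2 + \<beta>/2) + - (1/2 + \<beta>/2)))" by (simp only: powr_add)
    also have "1 + (- (1/2 + \<beta>/2) + - (1/2 + \<beta>/2)) = - \<beta>" by simp
    also have "8 * real p powr (- \<beta>) * (real d + 1) \<le> 8 * real p powr (- \<beta>) * (2 * real d)"
      using d1 by (intro mult_left_mono) auto
    finally show ?thesis by (simp add: mult_ac)
  qed
  also have "(a * (2 * sqrt (real p)))^2 \<le> 4 * real d * real p powr (- \<beta>)"
  proof -
    have "(a * (2 * sqrt (real p)))^2 = 4 * (real p * a^2)" by (simp add: power_mult_distrib)
    also have "real p * a^2 = real p powr 1 * (real p powr (- (1/2 + \<beta>)) * real p powr (- (1/2 + \<beta>)))"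
      unfolding a_eq power2_eq_square using p1 by simp
    also have "\<dots> = real p powr (1 + (- (1/2 + \<beta>) + - (1/2 + \<beta>)))" by (simp only: powr_add)
    also have "1 + (- (1/2 + \<beta>) + - (1/2 + \<beta>)) = - 2 * \<beta>" by simp
    also have "real p powr (- 2 * \<beta>) \<le> real p powr (- \<beta>)" using b p1 by (intro powr_mono) auto
    also have "\<dots> \<le> real d * real p powr (- \<beta>)" using d1 by (simp add: mult_le_cancel_right1)
    finally show ?thesis by simp
  qed
  finally show ?thesis by simp
qed

text \<open>Exponent count: p times the squared norm d * p^(-\<beta>), divided by lam^4 of order
  p^(2 - 4\<beta>), is d / p^(1 - 3\<beta>).\<close>

lemma loss_along_iteration:
  assumes n: "ln (real n) \<le> real p powr (1/2 - \<beta>) / 32000"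
    and step0: "\<Theta> 0 = gd_step Ix L a \<theta>"
    and step: "\<And>t. \<Theta> (Suc t) = gd_step Ix L ((lam (\<Theta> t))^2 / real p) (\<Theta> t)"
    and t: "1 \<le> t"
  shows "L (\<Theta> t) \<le> (240 * 2000^4) * real d / (real p powr (1 - 3 * \<beta>) * real (Suc t))"
proof -
  define P where "P = real p powr (1/2 - \<beta>)"
  have p1: "1 \<le> real p" using p_pos by simp
  have P: "200000 \<le> P" using large by (simp add: P_def)
  have "ln (L (\<Theta> 0)) \<le> - (P / 2000)"
    using loss_after_first_step loss_pos unfolding step0 P_def by (metis ln_exp ln_le_cancel_iff exp_gt_zero)
  then have lam: "P / 2000 \<le> lam (\<Theta> 0)" by (simp add: lam_eq)
  have "L (\<Theta> t) * real t \<le> 3 * real p * nrm2 (\<Theta> 0) / (lam (\<Theta> 0))^4"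
    by (rule adaptive_rate[where \<Theta> = \<Theta>, OF _ _ step]) (use lam P n in \<open>auto simp: P_def\<close>)
  also have "\<dots> \<le> 3 * real p * (40 * real d * real p powr (- \<beta>)) / (P / 2000)^4"
    using norm_after_first_step lam P unfolding step0
    by (intro frac_le mult_left_mono power_mono) auto
  also have "\<dots> = (120 * 2000^4) * real d * (real p * real p powr (- \<beta>) / P^4)"
    by (simp add: power_divide)
  also have "real p * real p powr (- \<beta>) / P^4 = 1 / real p powr (1 - 3 * \<beta>)"
  proof -
    have "P^4 = real p powr (2 - 4 * \<beta>)"
      unfolding P_def power4_eq_xxxx by (simp flip: powr_add)
    moreover have "real p * real p powr (- \<beta>) = real p powr (1 - \<beta>)"
      using p1 powr_add[of "real p" 1 "- \<beta>"] by simp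
    ultimately have "real p * real p powr (- \<beta>) / P^4 = real p powr ((1 - \<beta>) - (2 - 4 * \<beta>))"
      by (simp only: powr_diff)
    also have "(1 - \<beta>) - (2 - 4 * \<beta>) = - (1 - 3 * \<beta>)" by simp
    finally show ?thesis by (simp only: powr_minus_divide)
  qed
  finally have 1: "L (\<Theta> t) * real t \<le> (120 * 2000^4) * real d / real p powr (1 - 3 * \<beta>)" by simp
  \<comment> \<open>\<open>\<Theta> 0\<close> is already the iterate after the first step, so time
    is shifted by one; t + 1 <= 2t turns 120 into 240.\<close>
  have "L (\<Theta> t) * real (Suc t) \<le> L (\<Theta> t) * (2 * real t)"
    using t loss_pos[of "\<Theta> t"] by (intro mult_left_mono) auto
  also have "\<dots> \<le> (240 * 2000^4) * real d / real p powr (1 - 3 * \<beta>)" using 1 by simp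
  finally have "L (\<Theta> t) \<le> (240 * 2000^4) * real d / real p powr (1 - 3 * \<beta>) / real (Suc t)"
    by (subst pos_le_divide_eq) auto
  then show ?thesis by (simp only: divide_divide_eq_left)
qed

end

end

text \<open>The form in which the width hypothesis is used: a large power of the logarithm below p
  makes the logarithm smaller than any prescribed small power of p.\<close>

lemma powr_ge_of_polylog:
  fixes l z c C :: real
  assumes "2 \<le> l" "l powr C \<le> z" "0 < c" "1 / c \<le> C"
  shows "l \<le> z powr c"
proof -
  have "l = l powr (1 / c * c)" using assms by simp
  also have "\<dots> = (l powr (1 / c)) powr c" by (simp only: powr_powr)
  also have "\<dots> \<le> (l powr C) powr c" using assms by (intro powr_mono2 powr_mono) auto
  also have "\<dots> \<le> z powr c" using assms by (intro powr_mono2) auto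
  finally show ?thesis .
qed

text \<open>One event serves both parts: on it the bound after the first step and the bounds at all
  later times hold together.\<close>

theorem theorem2:
  fixes \<beta> :: real
  assumes "0 < \<beta>" and "\<beta> < 1/2"
  shows "\<exists>C2 C3 C4 C5 C6 :: real. 0 < C2 \<and> 0 < C3 \<and> 0 < C4 \<and> 0 < C5 \<and> 0 < C6 \<and>
    (\<forall>(\<delta>::real) (n::nat) (d::nat) (p::nat) (x::nat \<Rightarrow> nat \<Rightarrow> real) (y::nat \<Rightarrow> real)
       (K::nat \<Rightarrow> nat set) (\<mu>::nat \<Rightarrow> nat \<Rightarrow> real) (\<epsilon>::real) (r::real) (\<Delta>::real).
      0 < \<delta> \<and> \<delta> < 1/2 \<and> 4 \<le> n \<and> cluster_assms d n x y K \<mu> \<epsilon> r \<Delta> \<and>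
      \<Delta> < C2 \<and> r < C2 \<and> \<epsilon> < C2 \<and>
      real p \<ge> ln (real n * real d / \<delta>) powr C3 \<longrightarrow>
      (let h = 1 / real p;
           \<sigma> = real p powr (- (1/2 + \<beta>/2));
           \<alpha>0 = real p powr (- (1/2 + \<beta>));
           I = param_idx d p;
           L = loss d p h n x y;
           M = gauss_init I \<sigma>
       in (\<exists>A\<in>sets M. A \<subseteq> {\<theta>0 \<in> space M.
                L (gd_iter I L (\<lambda>t \<theta>. \<alpha>0) \<theta>0 1) \<le> exp (- C4 * real p powr (1/2 - \<beta>))}
              \<and> measure M A \<ge> 1 - \<delta>)
        \<and> (\<exists>A\<in>sets M. A \<subseteq> {\<theta>0 \<in> space M.
                \<forall>t>1. L (gd_iter I L
                          (\<lambda>t \<theta>. if t = 0 then \<alpha>0 else C5 * (ln (1 / L \<theta>))^2 / real p) \<theta>0 t)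
                      \<le> C6 * real d / (real p powr (1 - 3*\<beta>) * real t)}
              \<and> measure M A \<ge> 1 - \<delta>)))"
proof -
  obtain P0 where P0: "\<And>z. P0 \<le> z \<Longrightarrow> 1 \<le> z \<and> ln (12 * z) + 2 * z powr (\<beta>/8) \<le> z powr (\<beta>/4) / (4 * 10^8) \<and>
    (2 * z powr (- (1/2 + \<beta>)) + 1 / z) / (z powr (- (1/2 + \<beta>/2)) * sqrt 2) \<le> 1/40000 \<and>
    200000 \<le> z powr (1/2 - \<beta>) \<and> 32000 * z powr ((1/2 - \<beta>) / 2) \<le> z powr (1/2 - \<beta>)"
    using large_width[OF assms] by blast
  \<comment> \<open>Each summand meets one demand: l <= p^(\<beta>/8) for the failure probability, l
    <= p^((1/2 - \<beta>)/2) for ln n, and p >= P0. The last works because l >= 2, so that p >= 2^C3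
    >= 1 + C3 * ln 2.\<close>
  define C3 where "C3 = 8 / \<beta> + 2 / (1/2 - \<beta>) + 2 * \<bar>P0\<bar>"
  have C3: "1 / (\<beta>/8) \<le> C3" "1 / ((1/2 - \<beta>) / 2) \<le> C3" "2 * \<bar>P0\<bar> \<le> C3" "0 < C3"
    using assms by (simp_all add: C3_def add_nonneg_nonneg add_pos_nonneg add_pos_pos)
  have main: "(\<exists>A\<in>sets (gauss_init (param_idx d p) (real p powr (- (1/2 + \<beta>/2)))).
            A \<subseteq> {\<theta>0 \<in> space (gauss_init (param_idx d p) (real p powr (- (1/2 + \<beta>/2)))).
                loss d p (1 / real p) n x y
                  (gd_iter (param_idx d p) (loss d p (1 / real p) n x y) (\<lambda>t \<theta>. real p powr (- (1/2 + \<beta>))) \<theta>0 1)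
                   \<le> exp (- (1/2000) * real p powr (1/2 - \<beta>)) \<and>
                (\<forall>t>1. loss d p (1 / real p) n x y
                   (gd_iter (param_idx d p) (loss d p (1 / real p) n x y)
                          (\<lambda>t \<theta>. if t = 0 then real p powr (- (1/2 + \<beta>))
                             else 1 * (ln (1 / loss d p (1 / real p) n x y \<theta>))^2 / real p) \<theta>0 t)
                      \<le> (240 * 2000^4) * real d / (real p powr (1 - 3*\<beta>) * real t))}
            \<and> measure (gauss_init (param_idx d p) (real p powr (- (1/2 + \<beta>/2)))) A \<ge> 1 - \<delta>)"
    if H: "0 < \<delta>" "\<delta> < 1/2" "4 \<le> n" "cluster_assms d n x y K \<mu> \<epsilon> r \<Delta>"
      "\<Delta> < 1/10^6" "r < 1/10^6" "\<epsilon> < 1/10^6" "ln (real n * real d / \<delta>) powr C3 \<le> real p"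
    for \<delta> :: real and n d p :: nat and x :: "nat \<Rightarrow> nat \<Rightarrow> real" and y :: "nat \<Rightarrow> real"
      and K :: "nat \<Rightarrow> nat set" and \<mu> :: "nat \<Rightarrow> nat \<Rightarrow> real" and \<epsilon> r \<Delta> :: real
  proof -
    define l where "l = ln (real n * real d / \<delta>)"
    have unit: "(\<Sum>j=1..d. (x s j)^2) = 1" if "s \<in> {1..n}" for s
      using H(4) that unfolding cluster_assms_def vnorm_def by (metis real_sqrt_eq_1_iff)
    have d1: "1 \<le> real d"
    proof (cases "d = 0")
      case True
      then show ?thesis using unit[of 1] H(3) by simp
    qed simp
    have nd: "real n / \<delta> \<le> real n * real d / \<delta>"
      using d1 H(1) by (intro divide_right_mono) (auto simp: mult_le_cancel_left1)
    have n8: "8 \<le> real n / \<delta>"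
    proof -
      have "8 * \<delta> \<le> 4" using H(2) by simp
      also have "\<dots> \<le> real n" using H(3) by simp
      finally show ?thesis using H(1) by (simp add: pos_le_divide_eq)
    qed
    \<comment> \<open>From n >= 4 and \<delta> < 1/2 the argument of the logarithm is at least 8,
      and ln 8 = 3 * ln 2 >= 2.\<close>
    have l2: "2 \<le> l"
    proof -
      have "2 \<le> ln ((2::real)^3)" unfolding ln_realpow[of 2, simplified] using ln2_ge_two_thirds by simp
      also have "\<dots> \<le> l" unfolding l_def using nd n8 by (subst ln_le_cancel_iff) auto
      finally show ?thesis .
    qed
    have lp: "l powr C3 \<le> real p" using H(8) by (simp add: l_def)
    have "P0 \<le> real p"
    proof -
      have "P0 \<le> 1 + C3 * ln 2"
      proof -
        have "2 * \<bar>P0\<bar> * (2/3) \<le> C3 * ln 2" using C3 ln2_ge_two_thirds by (intro mult_mono) auto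
        then show ?thesis by linarith
      qed
      also have "\<dots> \<le> exp (C3 * ln 2)" by (rule exp_ge_add_one_self)
      also have "\<dots> = 2 powr C3" by (simp add: powr_def)
      also have "\<dots> \<le> l powr C3" using l2 C3 by (intro powr_mono2) auto
      finally show ?thesis using lp by linarith
    qed
    note large = P0[OF this]
    have p1: "1 \<le> real p" using large by blast
    have pos: "0 < p" using p1 by (cases p) auto
    interpret random_net d p n x y "real p powr (- (1/2 + \<beta>/2))"
    proof
      show "\<bar>y s\<bar> = 1" if "s \<in> {1..n}" for s
        using H(4) that unfolding cluster_assms_def by (metis abs_1 abs_minus)
    qed (use pos H(3) unit in auto)
    define a where "a = real p powr (- (1/2 + \<beta>))"
    have w: "0 \<le> 2 * a + h" "(2 * a + h) / (real p powr (- (1/2 + \<beta>/2)) * sqrt 2) \<le> 1/40000"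
      using large by (auto simp: a_def)
    obtain A where A: "A \<in> sets G" "A \<subseteq> {\<theta> \<in> space G. good (2 * a + h) \<theta>}"
      "1 - 12 * real p * (real n)^2 * exp (- (real p powr (\<beta>/4) / (4 * 10^8))) \<le> measure G A"
      using gauss_good_event[OF refl assms w] by blast
    have lb: "l \<le> real p powr (\<beta>/8)" using powr_ge_of_polylog[OF l2 lp _ C3(1)] assms by simp
    have ln_n: "ln (real n) \<le> l" unfolding l_def using nd n8 H d1
      by (subst ln_le_cancel_iff) (auto simp: field_simps intro: order_trans)
    have nl: "ln (real n) \<le> real p powr (1/2 - \<beta>) / 32000"
    proof -
      have "l \<le> real p powr ((1/2 - \<beta>) / 2)" using powr_ge_of_polylog[OF l2 lp _ C3(2)] assms by simp
      then show ?thesis using ln_n large by linarith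
    qed
    have fail: "12 * real p * (real n)^2 * exp (- (real p powr (\<beta>/4) / (4 * 10^8))) \<le> \<delta>"
    proof -
      \<comment> \<open>The chain n^2 <= n^2/\<delta> = \<delta> * (n/\<delta>)^2 <= \<delta> * exp
        (2l) produces the factor \<delta> and turns the prefactors into exponents that p^(\<beta>/4)
        outweighs.\<close>
      have el: "exp l = real n * real d / \<delta>" unfolding l_def using nd n8 by (intro exp_ln) linarith
      have "(real n)^2 * 1 \<le> (real n)^2 * (1 / \<delta>)"
        using H(1,2) by (intro mult_left_mono) (auto simp: pos_le_divide_eq)
      also have "\<dots> = \<delta> * (real n / \<delta>)^2" using H(1) by (simp add: power2_eq_square)
      also have "\<dots> \<le> \<delta> * (exp l)^2" unfolding el using H(1) nd n8 by (intro mult_left_mono power_mono) auto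
      also have "\<dots> = \<delta> * exp (2 * l)" by (simp flip: exp_double)
      finally have "(real n)^2 \<le> \<delta> * exp (2 * l)" by simp
      moreover have "12 * real p = exp (ln (12 * real p))" using p1 by simp
      ultimately have "12 * real p * (real n)^2 * exp (- (real p powr (\<beta>/4) / (4 * 10^8))) \<le>
         exp (ln (12 * real p)) * (\<delta> * exp (2 * l)) * exp (- (real p powr (\<beta>/4) / (4 * 10^8)))"
        using H(1) by (intro mult_mono) auto
      also have "\<dots> = \<delta> * exp (ln (12 * real p) + 2 * l - real p powr (\<beta>/4) / (4 * 10^8))"
        by (simp only: exp_add exp_diff exp_minus divide_inverse mult_ac)
      also have "\<dots> \<le> \<delta> * 1"
      proof (intro mult_left_mono)
        have "ln (12 * real p) + 2 * l - real p powr (\<beta>/4) / (4 * 10^8) \<le> 0" using lb large by linarith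
        then show "exp (ln (12 * real p) + 2 * l - real p powr (\<beta>/4) / (4 * 10^8)) \<le> 1" by simp
      qed (use H(1) in simp)
      finally show ?thesis by simp
    qed
    show ?thesis
    proof (intro bexI[of _ A] conjI subsetI CollectI allI impI)
      show "1 - \<delta> \<le> measure G A" using A(3) fail by linarith
      show "A \<in> sets G" by (rule A(1))
    next
      fix \<theta> assume "\<theta> \<in> A"
      then have th: "\<theta> \<in> space G" "good (2 * a + h) \<theta>" using A(2) by auto
      show "\<theta> \<in> space G" by (rule th(1))
      have large': "200000 \<le> real p powr (1/2 - \<beta>)" using large by blast
      note ctx = assms refl a_def H(4-7) th(2) large'
      show "L (gd_iter Ix L (\<lambda>t \<theta>. real p powr (- (1/2 + \<beta>))) \<theta> 1) \<le> exp (- (1/2000) * real p powr (1/2 - \<beta>))"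
        using loss_after_first_step[OF ctx] by (simp add: a_def)
      fix t :: nat assume t: "1 < t"
      define S where "S = (\<lambda>(t::nat) \<theta>. if t = 0 then real p powr (- (1/2 + \<beta>)) else 1 * (ln (1 / L \<theta>))^2 / real p)"
      \<comment> \<open>Shifted by one: the branch \<open>t = 0\<close> of the step-size rule is
        used up by the first step, and \<open>\<Theta>\<close> sees only adaptive steps.\<close>
      define \<Theta> where "\<Theta> = (\<lambda>t. gd_iter Ix L S \<theta> (Suc t))"
      obtain t' where t': "t = Suc t'" "1 \<le> t'" using t by (cases t) auto
      have "L (\<Theta> t') \<le> (240 * 2000^4) * real d / (real p powr (1 - 3 * \<beta>) * real (Suc t'))"
        by (rule loss_along_iteration[OF ctx nl _ _ t'(2)]) (auto simp: \<Theta>_def S_def a_def lam_def Let_def)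
      then show "L (gd_iter Ix L (\<lambda>t \<theta>. if t = 0 then real p powr (- (1/2 + \<beta>))
          else 1 * (ln (1 / L \<theta>))^2 / real p) \<theta> t) \<le> (240 * 2000^4) * real d / (real p powr (1 - 3 * \<beta>) * real t)"
        by (simp only: \<Theta>_def S_def t'(1))
    qed
  qed
  show ?thesis
  proof (rule exI[of _ "1/10^6"], rule exI[of _ C3], rule exI[of _ "1/2000"], rule exI[of _ 1],
      rule exI[of _ "240 * 2000^4"], intro conjI allI impI)
    fix \<delta> :: real and n d p :: nat and x :: "nat \<Rightarrow> nat \<Rightarrow> real" and y :: "nat \<Rightarrow> real"
      and K :: "nat \<Rightarrow> nat set" and \<mu> :: "nat \<Rightarrow> nat \<Rightarrow> real" and \<epsilon> r \<Delta> :: real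
    assume H: "0 < \<delta> \<and> \<delta> < 1/2 \<and> 4 \<le> n \<and> cluster_assms d n x y K \<mu> \<epsilon> r \<Delta> \<and>
      \<Delta> < 1/10^6 \<and> r < 1/10^6 \<and> \<epsilon> < 1/10^6 \<and> real p \<ge> ln (real n * real d / \<delta>) powr C3"
    then obtain A where A: "A \<in> sets (gauss_init (param_idx d p) (real p powr (- (1/2 + \<beta>/2))))"
       "A \<subseteq> {\<theta>0 \<in> space (gauss_init (param_idx d p) (real p powr (- (1/2 + \<beta>/2)))).
                loss d p (1 / real p) n x y
                  (gd_iter (param_idx d p) (loss d p (1 / real p) n x y) (\<lambda>t \<theta>. real p powr (- (1/2 + \<beta>))) \<theta>0 1)
                   \<le> exp (- (1/2000) * real p powr (1/2 - \<beta>)) \<and>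
                (\<forall>t>1. loss d p (1 / real p) n x y
                   (gd_iter (param_idx d p) (loss d p (1 / real p) n x y)
                          (\<lambda>t \<theta>. if t = 0 then real p powr (- (1/2 + \<beta>))
                             else 1 * (ln (1 / loss d p (1 / real p) n x y \<theta>))^2 / real p) \<theta>0 t)
                      \<le> (240 * 2000^4) * real d / (real p powr (1 - 3*\<beta>) * real t))}"
       "measure (gauss_init (param_idx d p) (real p powr (- (1/2 + \<beta>/2)))) A \<ge> 1 - \<delta>"
      using main[of \<delta> n d x y K \<mu> \<epsilon> r \<Delta> p] by blast
    show "let h = 1 / real p;
           \<sigma> = real p powr (- (1/2 + \<beta>/2));
           \<alpha>0 = real p powr (- (1/2 + \<beta>));
           I = param_idx d p;
           L = loss d p h n x y;
           M = gauss_init I \<sigma>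
       in (\<exists>A\<in>sets M. A \<subseteq> {\<theta>0 \<in> space M.
                L (gd_iter I L (\<lambda>t \<theta>. \<alpha>0) \<theta>0 1) \<le> exp (- (1/2000) * real p powr (1/2 - \<beta>))}
              \<and> measure M A \<ge> 1 - \<delta>)
        \<and> (\<exists>A\<in>sets M. A \<subseteq> {\<theta>0 \<in> space M.
                \<forall>t>1. L (gd_iter I L
                          (\<lambda>t \<theta>. if t = 0 then \<alpha>0 else 1 * (ln (1 / L \<theta>))^2 / real p) \<theta>0 t)
                      \<le> (240 * 2000^4) * real d / (real p powr (1 - 3*\<beta>) * real t)}
              \<and> measure M A \<ge> 1 - \<delta>)"
      unfolding Let_def
      by (intro conjI bexI[of _ A]) (use A in \<open>blast+\<close>)
  qed (use C3 in auto)
qed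

end
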